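(* Let $\varphi\colon\Sigma_*\to(0,\infty)$ be a quasi-multiplicative potential. Then $$P(\varphi)=\sup\{P_\mu(\varphi):\mu\in\mathcal{M}_\sigma(\Sigma)\}.$$ Moreover, if $P(\varphi)<\infty$, then there exists a unique measure $\mu\in\mathcal{M}_\sigma(\Sigma)$ for which $P(\varphi)=P_\mu(\varphi)$.
   Context: $\mathbb{N}=\{1,2,\ldots\}$; $\Sigma=\mathbb{N}^{\mathbb{N}}$ carries the product topology of the discrete topology on $\mathbb{N}$; $\sigma$ is the left shift on $\Sigma$; $\mathcal{M}_\sigma(\Sigma)$ is the set of $\sigma$-invariant Borel probability measures on $\Sigma$. $\Sigma_n=\mathbb{N}^n$, $\Sigma_*=\bigcup_{n\in\mathbb{N}}\Sigma_n$ is the set of finite words, juxtaposition denotes concatenation, and for $\omega\in\Sigma_*$ the cylinder set is $[\omega]=\{\omega\tau:\tau\in\Sigma\}$. A potential is a map $\varphi\colon\Sigma_*\to(0,\infty)$. It is sub-multiplicative if $\varphi(\omega\tau)\le\varphi(\omega)\varphi(\tau)$ for all $\omega,\tau\in\Sigma_*$. A sub-multiplicative potential $\varphi$ is quasi-multiplicative if there exist a constant $c\ge1$ and a finite set $\Gamma\subset\Sigma_*$ such that for all $\omega,\tau\in\Sigma_*$ there is $\kappa\in\Gamma$ with $\varphi(\omega)\varphi(\tau)\le c\,\varphi(\omega\kappa\tau)$. The pressure of a sub-multiplicative potential is $P(\varphi)=\lim_{n\to\infty}\frac1n\log Z_n(\varphi)=\inf_{n\in\mathbb{N}}\frac1n\log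 Z_n(\varphi)$, where $Z_n(\varphi)=\sum_{\omega\in\Sigma_n}\varphi(\omega)$ (possibly infinite). For $\mu\in\mathcal{M}_\sigma(\Sigma)$ the measure-theoretical pressure is $$P_\mu(\varphi)=\inf_{n\in\mathbb{N}}\frac1n\sum_{\omega\in\Sigma_n}\mu([\omega])\log\frac{\varphi(\omega)}{\mu([\omega])},$$ with the convention $0\log(x/0)=0\log0=0$ for $x>0$. *)

theory Defs
  imports "HOL-Probability.Probability" "HOL-Library.Omega_Words_Fun"
begin

text \<open>
  The countably infinite discrete alphabet is the type \<^typ>\<open>nat\<close> (so the symbols are
  \<open>0, 1, 2, \<dots>\<close> instead of \<open>1, 2, 3, \<dots>\<close>) and \<open>\<Sigma>\<close> is the type \<^typ>\<open>nat \<Rightarrow> nat\<close>, whose topology is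
  the product topology of the discrete topologies.  Finite words are lists.  As the empty word
  does not belong to \<open>\<Sigma>\<^sub>*\<close>, the value of a potential at \<open>[]\<close> plays no role.
\<close>

definition words :: "nat \<Rightarrow> nat list set" where
  "words n = {\<omega>. length \<omega> = n}"

definition finite_words :: "nat list set" where
  "finite_words = (\<Union>n\<in>{1..}. words n)"

definition shift :: "(nat \<Rightarrow> nat) \<Rightarrow> nat \<Rightarrow> nat" where
  "shift = suffix 1"

definition cylinder :: "nat list \<Rightarrow> (nat \<Rightarrow> nat) set" where
  "cylinder \<omega> = {\<omega> \<frown> \<tau> | \<tau>. \<tau> \<in> UNIV}"

definition invariant_measures :: "(nat \<Rightarrow> nat) measure set" where
  "invariant_measures =
     {\<mu>. sets \<mu> = sets borel \<and> prob_space \<mu> \<and> distr \<mu> borel shift = \<mu>}"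

definition potential :: "(nat list \<Rightarrow> real) \<Rightarrow> bool" where
  "potential \<phi> \<longleftrightarrow> (\<forall>\<omega>\<in>finite_words. \<phi> \<omega> > 0)"

definition sub_multiplicative :: "(nat list \<Rightarrow> real) \<Rightarrow> bool" where
  "sub_multiplicative \<phi> \<longleftrightarrow>
     potential \<phi> \<and> (\<forall>\<omega>\<in>finite_words. \<forall>\<tau>\<in>finite_words. \<phi> (\<omega> @ \<tau>) \<le> \<phi> \<omega> * \<phi> \<tau>)"

definition quasi_multiplicative :: "(nat list \<Rightarrow> real) \<Rightarrow> bool" where
  "quasi_multiplicative \<phi> \<longleftrightarrow>
     sub_multiplicative \<phi> \<and>
     (\<exists>c\<ge>1. \<exists>\<Gamma>. finite \<Gamma> \<and> \<Gamma> \<subseteq> finite_words \<and>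
        (\<forall>\<omega>\<in>finite_words. \<forall>\<tau>\<in>finite_words. \<exists>\<kappa>\<in>\<Gamma>. \<phi> \<omega> * \<phi> \<tau> \<le> c * \<phi> (\<omega> @ \<kappa> @ \<tau>)))"

definition partition_sum :: "(nat list \<Rightarrow> real) \<Rightarrow> nat \<Rightarrow> ennreal" where
  "partition_sum \<phi> n = (\<integral>\<^sup>+\<omega>. ennreal (\<phi> \<omega>) \<partial>count_space (words n))"

definition log_ennreal :: "ennreal \<Rightarrow> ereal" where
  "log_ennreal z =
     (if z = \<infinity> then \<infinity> else if z = 0 then -\<infinity> else ereal (ln (enn2real z)))"

text \<open>
  The pressure is defined as the infimum; for quasi-multiplicative potentials it is also the
  limit, see \<open>pressure_LIMSEQ\<close> below.
\<close>

definition pressure :: "(nat list \<Rightarrow> real) \<Rightarrow> ereal" where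
  "pressure \<phi> = (INF n\<in>{1..}. ereal (1 / real n) * log_ennreal (partition_sum \<phi> n))"

text \<open>
  The sum of a family of reals with values in the extended reals: the sum of the positive parts
  minus the sum of the negative parts.  If both are infinite the sum has no meaning and is set
  to \<open>-\<infinity>\<close>; thus a measure for which one of the sums below is meaningless does not contribute to
  the supremum of the measure-theoretical pressures.  For quasi-multiplicative \<open>\<phi>\<close>
  this can only happen if all the \<^term>\<open>partition_sum \<phi> n\<close> are infinite.
\<close>

definition extended_sum :: "('a \<Rightarrow> real) \<Rightarrow> 'a set \<Rightarrow> ereal" where
  "extended_sum f A =
     (let p = (\<integral>\<^sup>+x. ennreal (f x) \<partial>count_space A);
          q = (\<integral>\<^sup>+x. ennreal (- f x) \<partial>count_space A)
      in if p = \<infinity> \<and> q = \<infinity> then -\<infinity> else enn2ereal p - enn2ereal q)"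

text \<open>The convention \<open>0 log (x / 0) = 0\<close> holds since \<^term>\<open>0 * t = (0 :: real)\<close> for all \<open>t\<close>.\<close>

definition measure_pressure :: "(nat \<Rightarrow> nat) measure \<Rightarrow> (nat list \<Rightarrow> real) \<Rightarrow> ereal" where
  "measure_pressure \<mu> \<phi> =
     (INF n\<in>{1..}. ereal (1 / real n) *
        extended_sum
          (\<lambda>\<omega>. measure \<mu> (cylinder \<omega>) * ln (\<phi> \<omega> / measure \<mu> (cylinder \<omega>))) (words n))"

lemma in_finite_words_iff [simp]: "\<omega> \<in> finite_words \<longleftrightarrow> \<omega> \<noteq> []"
  by (cases \<omega>) (auto simp: finite_words_def words_def)

lemma partition_sum_add_le:
  assumes "sub_multiplicative \<phi>" "m \<ge> 1" "n \<ge> 1"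
  shows "partition_sum \<phi> (m + n) \<le> partition_sum \<phi> m * partition_sum \<phi> n"
proof -
  have pos: "\<phi> \<omega> > 0" if "\<omega> \<noteq> []" for \<omega>
    using assms(1) that by (auto simp: sub_multiplicative_def potential_def)
  have sub: "\<phi> (\<omega> @ \<tau>) \<le> \<phi> \<omega> * \<phi> \<tau>" if "\<omega> \<noteq> []" "\<tau> \<noteq> []" for \<omega> \<tau>
    using assms(1) that by (auto simp: sub_multiplicative_def)
  have bij: "bij_betw (\<lambda>(\<omega>, \<tau>). \<omega> @ \<tau>) (words m \<times> words n) (words (m + n))"
    by (rule bij_betw_byWitness[where f' = "\<lambda>\<omega>. (take m \<omega>, drop m \<omega>)"])
       (auto simp: words_def)
  have "partition_sum \<phi> (m + n) =
      (\<integral>\<^sup>+x. ennreal (\<phi> (fst x @ snd x)) \<partial>count_space (words m \<times> words n))"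
    unfolding partition_sum_def
    by (subst nn_integral_bij_count_space[OF bij, symmetric]) (simp add: case_prod_unfold)
  also have "\<dots> \<le> (\<integral>\<^sup>+x. ennreal (\<phi> (fst x)) * ennreal (\<phi> (snd x)) \<partial>count_space (words m \<times> words n))"
  proof (rule nn_integral_mono)
    fix x assume "x \<in> space (count_space (words m \<times> words n))"
    then have "fst x \<noteq> []" "snd x \<noteq> []" using assms by (auto simp: words_def)
    then show "ennreal (\<phi> (fst x @ snd x)) \<le> ennreal (\<phi> (fst x)) * ennreal (\<phi> (snd x))"
      using sub pos less_imp_le by (metis ennreal_leI ennreal_mult'')
  qed
  also have "\<dots> = (\<integral>\<^sup>+x. (\<integral>\<^sup>+y. ennreal (\<phi> x) * ennreal (\<phi> y) \<partial>count_space (words n)) \<partial>count_space (words m))"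
  proof -
    interpret sigma_finite_measure "count_space (words n)"
      by (rule sigma_finite_measure_count_space_countable) simp
    have pair: "count_space (words m) \<Otimes>\<^sub>M count_space (words n) = count_space (words m \<times> words n)"
      by (rule pair_measure_countable) auto
    have "(\<lambda>x. ennreal (\<phi> (fst x)) * ennreal (\<phi> (snd x)))
        \<in> borel_measurable (count_space (words m) \<Otimes>\<^sub>M count_space (words n))"
      unfolding pair by simp
    from nn_integral_fst[OF this] show ?thesis by (simp add: pair)
  qed
  also have "\<dots> = partition_sum \<phi> m * partition_sum \<phi> n"
    by (simp add: partition_sum_def nn_integral_cmult nn_integral_multc)
  finally show ?thesis .
qed

lemma partition_sum_1_finite:
  assumes "quasi_multiplicative \<phi>" "n \<ge> 1" "partition_sum \<phi> n < \<infinity>"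
  shows "partition_sum \<phi> 1 < \<infinity>"
proof -
  obtain c \<Gamma> where c: "c \<ge> (1::real)" and G: "finite \<Gamma>" "[] \<notin> \<Gamma>"
    and q: "\<And>\<omega> \<tau>. \<omega> \<noteq> [] \<Longrightarrow> \<tau> \<noteq> [] \<Longrightarrow> \<exists>\<kappa>\<in>\<Gamma>. \<phi> \<omega> * \<phi> \<tau> \<le> c * \<phi> (\<omega> @ \<kappa> @ \<tau>)"
    using assms(1) unfolding quasi_multiplicative_def
    by (metis in_finite_words_iff subset_iff)
  have sm: "sub_multiplicative \<phi>" using assms(1) by (simp add: quasi_multiplicative_def)
  have pos: "\<phi> \<omega> > 0" if "\<omega> \<noteq> []" for \<omega>
    using sm that by (auto simp: sub_multiplicative_def potential_def)
  have sub: "\<phi> (\<omega> @ \<tau>) \<le> \<phi> \<omega> * \<phi> \<tau>" if "\<omega> \<noteq> []" "\<tau> \<noteq> []" for \<omega> \<tau>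
    using sm that by (auto simp: sub_multiplicative_def)
  define \<tau> where "\<tau> = replicate n (0::nat)"
  have \<tau>: "\<tau> \<noteq> []" "length \<tau> = n" using assms(2) by (auto simp: \<tau>_def)
  define D where "D \<kappa> = \<phi> (drop (n - 1) (\<kappa> @ \<tau>))" for \<kappa>
  define h where "h \<kappa> i = i # take (n - 1) (\<kappa> @ \<tau>)" for \<kappa> and i :: nat
  have D: "D \<kappa> > 0" for \<kappa> unfolding D_def using assms(2) \<tau> by (intro pos) auto
  have hlen: "h \<kappa> i \<in> words n" for \<kappa> i using assms(2) \<tau> by (auto simp: h_def words_def)
  have le: "ennreal (\<phi> [i]) \<le>
      ennreal (c / \<phi> \<tau>) * (\<Sum>\<kappa>\<in>\<Gamma>. ennreal (D \<kappa>) * ennreal (\<phi> (h \<kappa> i)))" for i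
  proof -
    obtain \<kappa> where k: "\<kappa> \<in> \<Gamma>" "\<phi> [i] * \<phi> \<tau> \<le> c * \<phi> ([i] @ \<kappa> @ \<tau>)" using q[of "[i]" \<tau>] \<tau> by auto
    have e: "[i] @ \<kappa> @ \<tau> = h \<kappa> i @ drop (n - 1) (\<kappa> @ \<tau>)"
      unfolding h_def by (simp only: append_Cons append_Nil append_take_drop_id)
    have hne: "h \<kappa> i \<noteq> []" by (simp add: h_def)
    have dne: "drop (n - 1) (\<kappa> @ \<tau>) \<noteq> []" using assms(2) \<tau> by auto
    have "\<phi> ([i] @ \<kappa> @ \<tau>) \<le> D \<kappa> * \<phi> (h \<kappa> i)"
      unfolding e D_def using sub[of "h \<kappa> i" "drop (n - 1) (\<kappa> @ \<tau>)"] hne dne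
      by (metis mult.commute)
    also have "\<dots> \<le> (\<Sum>\<kappa>\<in>\<Gamma>. D \<kappa> * \<phi> (h \<kappa> i))"
      using k(1) G(1) by (intro member_le_sum) (auto intro!: mult_nonneg_nonneg less_imp_le[OF D] less_imp_le[OF pos] simp: h_def)
    finally have "\<phi> [i] * \<phi> \<tau> \<le> c * (\<Sum>\<kappa>\<in>\<Gamma>. D \<kappa> * \<phi> (h \<kappa> i))"
      using k(2) c by (smt (verit) mult_left_mono)
    then have "\<phi> [i] \<le> c / \<phi> \<tau> * (\<Sum>\<kappa>\<in>\<Gamma>. D \<kappa> * \<phi> (h \<kappa> i))"
      using pos[OF \<tau>(1)] by (simp add: field_simps)
    then have "ennreal (\<phi> [i]) \<le> ennreal (c / \<phi> \<tau> * (\<Sum>\<kappa>\<in>\<Gamma>. D \<kappa> * \<phi> (h \<kappa> i)))"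
      by (rule ennreal_leI)
    also have "\<dots> = ennreal (c / \<phi> \<tau>) * ennreal (\<Sum>\<kappa>\<in>\<Gamma>. D \<kappa> * \<phi> (h \<kappa> i))"
      using c pos[OF \<tau>(1)] by (intro ennreal_mult') auto
    also have "ennreal (\<Sum>\<kappa>\<in>\<Gamma>. D \<kappa> * \<phi> (h \<kappa> i)) = (\<Sum>\<kappa>\<in>\<Gamma>. ennreal (D \<kappa> * \<phi> (h \<kappa> i)))"
      by (rule sum_ennreal[symmetric])
         (auto intro!: mult_nonneg_nonneg less_imp_le[OF D] less_imp_le[OF pos] simp: h_def)
    also have "\<dots> = (\<Sum>\<kappa>\<in>\<Gamma>. ennreal (D \<kappa>) * ennreal (\<phi> (h \<kappa> i)))"
      using D by (intro sum.cong refl ennreal_mult' less_imp_le)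
    finally show ?thesis .
  qed
  have hsum: "(\<integral>\<^sup>+i. ennreal (\<phi> (h \<kappa> i)) \<partial>count_space UNIV) \<le> partition_sum \<phi> n" for \<kappa>
  proof -
    have inj: "inj (h \<kappa>)" by (auto simp: h_def inj_on_def)
    have "(\<integral>\<^sup>+i. ennreal (\<phi> (h \<kappa> i)) \<partial>count_space UNIV) =
        (\<integral>\<^sup>+\<omega>. ennreal (\<phi> \<omega>) \<partial>count_space (range (h \<kappa>)))"
      using inj by (intro nn_integral_bij_count_space) (simp add: bij_betw_def)
    also have "\<dots> \<le> partition_sum \<phi> n"
      unfolding partition_sum_def using hlen
      by (subst (1 2) nn_integral_count_space_indicator)
         (auto intro!: nn_integral_mono split: split_indicator)
    finally show ?thesis .
  qed
  have bij: "bij_betw (\<lambda>i. [i]) UNIV (words 1)"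
    by (auto simp: bij_betw_def inj_on_def words_def length_Suc_conv)
  have "partition_sum \<phi> 1 = (\<integral>\<^sup>+i. ennreal (\<phi> [i]) \<partial>count_space UNIV)"
    unfolding partition_sum_def by (rule nn_integral_bij_count_space[OF bij, symmetric])
  also have "\<dots> \<le> (\<integral>\<^sup>+i. ennreal (c / \<phi> \<tau>) *
      (\<Sum>\<kappa>\<in>\<Gamma>. ennreal (D \<kappa>) * ennreal (\<phi> (h \<kappa> i))) \<partial>count_space UNIV)"
    by (intro nn_integral_mono le)
  also have "\<dots> = ennreal (c / \<phi> \<tau>) *
      (\<Sum>\<kappa>\<in>\<Gamma>. ennreal (D \<kappa>) * (\<integral>\<^sup>+i. ennreal (\<phi> (h \<kappa> i)) \<partial>count_space UNIV))"
    by (simp add: nn_integral_cmult nn_integral_sum)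
  also have "\<dots> \<le> ennreal (c / \<phi> \<tau>) * (\<Sum>\<kappa>\<in>\<Gamma>. ennreal (D \<kappa>) * partition_sum \<phi> n)"
    by (intro mult_left_mono sum_mono hsum) auto
  also have "\<dots> < \<infinity>"
    using assms(3) G(1) by (auto simp: ennreal_mult_less_top less_top[symmetric] ennreal_mult_eq_top_iff)
  finally show ?thesis .
qed

lemma subadditive_limit:
  fixes a :: "nat \<Rightarrow> real"
  assumes sub: "\<And>m n. m \<ge> 1 \<Longrightarrow> n \<ge> 1 \<Longrightarrow> a (m + n) \<le> a m + a n"
  shows "(\<lambda>n. ereal (a n / real n)) \<longlonglongrightarrow> (INF n\<in>{1..}. ereal (a n / real n))"
proof (rule order_tendstoI)
  fix l assume l: "l < (INF n\<in>{1..}. ereal (a n / real n))"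
  show "\<forall>\<^sub>F n in sequentially. l < ereal (a n / real n)"
    using eventually_ge_at_top[of 1]
    proof eventually_elim
    case (elim n)
    then have "(INF n\<in>{1..}. ereal (a n / real n)) \<le> ereal (a n / real n)" by (intro INF_lower) auto
    with l show ?case by (rule less_le_trans)
  qed
next
  fix u assume "(INF n\<in>{1..}. ereal (a n / real n)) < u"
  then obtain m where m: "m \<ge> 1" "ereal (a m / real m) < u" by (auto simp: INF_less_iff)
  define \<beta> where "\<beta> = a m / real m"
  define A where "A r = (if r = 0 then 0 else \<bar>a r\<bar>)" for r
  define M where "M = (\<Sum>r<m. A r)"
  have A: "A r \<le> M" if "r < m" for r
    unfolding M_def using that by (intro member_le_sum) (auto simp: A_def)
  have ind: "a (q * m + r) \<le> real q * a m + A r" if "q * m + r \<ge> 1" for q r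
    using that
  proof (induction q)
    case 0 then show ?case by (auto simp: A_def)
  next
    case (Suc q)
    show ?case
    proof (cases "q * m + r \<ge> 1")
      case True
      have "a (Suc q * m + r) \<le> a m + a (q * m + r)"
        using sub[OF m(1) True] by (simp add: add.assoc)
      with Suc.IH[OF True] show ?thesis by (simp add: algebra_simps)
    next
      case False
      then have "q * m + r = 0" by linarith
      then have "q = 0" "r = 0" using m(1) by simp_all
      then show ?thesis by (simp add: A_def)
    qed
  qed
  have bound: "a n / real n \<le> \<beta> + (real m * \<bar>\<beta>\<bar> + M) / real n" if "n \<ge> 1" for n
  proof -
    define q r where "q = n div m" and "r = n mod m"
    have n: "n = q * m + r" and r: "r < m" using m(1) by (auto simp: q_def r_def)
    have "a n \<le> real q * a m + M" using ind[of q r] A[OF r] n that by auto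
    also have "real q * a m = (real n - real r) * \<beta>"
      using m(1) by (simp add: n \<beta>_def field_simps)
    also have "\<dots> \<le> real n * \<beta> + real m * \<bar>\<beta>\<bar>"
    proof -
      have "- (real r * \<beta>) \<le> real r * \<bar>\<beta>\<bar>"
        by (metis abs_ge_minus_self abs_mult abs_of_nat)
      also have "\<dots> \<le> real m * \<bar>\<beta>\<bar>" using r by (intro mult_right_mono) auto
      finally show ?thesis by (simp add: algebra_simps)
    qed
    finally show ?thesis using that by (simp add: field_simps)
  qed
  have "(\<lambda>n. \<beta> + (real m * \<bar>\<beta>\<bar> + M) / real n) \<longlonglongrightarrow> \<beta> + 0"
    by (intro tendsto_add tendsto_const lim_const_over_n)
  then have "(\<lambda>n. ereal (\<beta> + (real m * \<bar>\<beta>\<bar> + M) / real n)) \<longlonglongrightarrow> ereal \<beta>"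
    by (simp add: tendsto_ereal)
  then have "\<forall>\<^sub>F n in sequentially. ereal (\<beta> + (real m * \<bar>\<beta>\<bar> + M) / real n) < u"
    using m(2) by (intro order_tendstoD(2)) (auto simp: \<beta>_def)
  then show "\<forall>\<^sub>F n in sequentially. ereal (a n / real n) < u"
    using eventually_ge_at_top[of 1]
    by eventually_elim (meson bound ereal_less_eq(3) le_less_trans)
qed

lemma pressure_LIMSEQ:
  assumes "quasi_multiplicative \<phi>"
  shows "(\<lambda>n. ereal (1 / real n) * log_ennreal (partition_sum \<phi> n)) \<longlonglongrightarrow> pressure \<phi>"
proof (cases "partition_sum \<phi> 1 = \<infinity>")
  case True
  have inf: "ereal (1 / real n) * log_ennreal (partition_sum \<phi> n) = \<infinity>" if "n \<ge> 1" for n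
    using partition_sum_1_finite[OF assms that] True that
    by (auto simp: log_ennreal_def less_top[symmetric])
  then have "pressure \<phi> = \<infinity>" unfolding pressure_def by simp
  moreover have "\<forall>\<^sub>F n in sequentially. ereal (1 / real n) * log_ennreal (partition_sum \<phi> n) = \<infinity>"
    using eventually_ge_at_top[of 1] by eventually_elim (rule inf)
  ultimately show ?thesis by (simp add: tendsto_eventually)
next
  case False
  have sm: "sub_multiplicative \<phi>" using assms by (simp add: quasi_multiplicative_def)
  have fin: "partition_sum \<phi> n < \<infinity>" if "n \<ge> 1" for n
    using that
  proof (induction n rule: dec_induct)
    case base then show ?case using False by (simp add: less_top)
  next
    case (step n)
    have "partition_sum \<phi> (n + 1) \<le> partition_sum \<phi> n * partition_sum \<phi> 1"
      using step by (intro partition_sum_add_le sm) auto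
    also have "\<dots> < \<infinity>" using step False by (auto simp: ennreal_mult_less_top less_top)
    finally show ?case by simp
  qed
  have pos: "partition_sum \<phi> n > 0" if "n \<ge> 1" for n
  proof -
    have w: "replicate n 0 \<in> words n" by (simp add: words_def)
    have "0 < \<phi> (replicate n 0)"
      using sm that by (auto simp: sub_multiplicative_def potential_def)
    moreover have "ennreal (\<phi> (replicate n 0)) \<le> partition_sum \<phi> n"
      unfolding partition_sum_def using w by (rule nn_integral_ge_point)
    ultimately show ?thesis by (meson ennreal_less_zero_iff less_le_trans)
  qed
  define a where "a n = ln (enn2real (partition_sum \<phi> n))" for n
  have rpos: "enn2real (partition_sum \<phi> n) > 0" if "n \<ge> 1" for n
    using pos[OF that] fin[OF that] by (simp add: enn2real_positive_iff)
  have sub: "a (m + n) \<le> a m + a n" if "m \<ge> 1" "n \<ge> 1" for m n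
  proof -
    have "enn2real (partition_sum \<phi> (m + n)) \<le> enn2real (partition_sum \<phi> m * partition_sum \<phi> n)"
      using partition_sum_add_le[OF sm that] fin that
      by (intro enn2real_mono) (auto simp: ennreal_mult_less_top)
    then have "enn2real (partition_sum \<phi> (m + n)) \<le>
        enn2real (partition_sum \<phi> m) * enn2real (partition_sum \<phi> n)"
      by (simp add: enn2real_mult)
    then have "a (m + n) \<le>
        ln (enn2real (partition_sum \<phi> m) * enn2real (partition_sum \<phi> n))"
      unfolding a_def using rpos[of "m + n"] that by (intro ln_mono) auto
    also have "\<dots> = a m + a n"
      unfolding a_def using rpos[OF that(1)] rpos[OF that(2)] by (simp add: ln_mult)
    finally show ?thesis .
  qed
  have eq: "ereal (1 / real n) * log_ennreal (partition_sum \<phi> n) = ereal (a n / real n)" if "n \<ge> 1" for n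
    using pos[OF that] fin[OF that] by (auto simp: log_ennreal_def a_def)
  have "pressure \<phi> = (INF n\<in>{1..}. ereal (a n / real n))"
    unfolding pressure_def using eq by (intro INF_cong) auto
  moreover have "\<forall>\<^sub>F n in sequentially.
      ereal (a n / real n) = ereal (1 / real n) * log_ennreal (partition_sum \<phi> n)"
    using eventually_ge_at_top[of 1] by eventually_elim (simp add: eq)
  ultimately show ?thesis
    using subadditive_limit[of a, OF sub] by (simp add: Lim_transform_eventually)
qed

end

theory Submission
  imports Defs
begin

text \<open>
Write \<open>Z n\<close> for the sum of \<open>\<phi>\<close> over all words of length \<open>n\<close>, and suppose first that \<open>Z 1\<close> is
finite.  Everything rests on one observation about connecting words.  If \<open>\<kappa>\<close> connects \<open>\<alpha>\<close> to
\<open>\<omega>\<close>, then in \<open>\<Sum>\<alpha>. \<phi> (\<alpha> @ \<kappa> @ \<omega>)\<close>, with \<open>\<alpha>\<close> ranging over all words of a given length, one may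
enlarge the range by letting \<open>\<kappa>\<close> vary freely too and then split off the first \<open>length \<kappa>\<close> letters;
sub-multiplicativity bounds the sum by \<open>Z (length \<kappa>)\<close> times \<open>\<Sum>\<alpha>. \<phi> (\<alpha> @ \<omega>)\<close>.  Thus, after
summation, the connecting words disappear at the price of a constant: with one finite constant \<open>G\<close>,
\<open>Z m * Z n \<le> G * Z (m + n)\<close> (\<open>Z_mult_le\<close>), and the sum of \<open>\<phi> (\<alpha> @ \<omega> @ \<beta>)\<close> over all \<open>\<alpha>\<close> and
\<open>\<beta>\<close> of lengths \<open>k\<close> and \<open>l\<close> is \<open>Z k * \<phi> \<omega> * Z l\<close> up to the factor \<open>G\<^sup>2\<close> (\<open>le_padded_sum\<close>).

The first estimate gives \<open>n * P \<le> ln (Z n) \<le> n * P + ln G\<close> with \<open>P\<close> the pressure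
(\<open>pressure_bounds\<close>).  The second one says that, if words of length \<open>M\<close> are drawn with probability
\<open>\<phi> / Z M\<close>, then \<open>\<omega>\<close> is found at any given position with probability comparable to
\<open>\<phi> \<omega> / Z (length \<omega>)\<close>, uniformly in \<open>M\<close> and in the position.  Averaging over positions and passing to
a pointwise limit produces a shift-invariant family of cylinder weights; no mass escapes because the
upper bound is summable, so that dominated convergence applies (\<open>gibbs_weights\<close>).
Kolmogorov's theorem turns the weights into an invariant measure \<open>\<mu>\<close> with
\<open>G\<^sup>-\<^sup>2 \<le> \<mu> [\<omega>] * Z (length \<omega>) / \<phi> \<omega> \<le> G\<^sup>2\<close>, a Gibbs measure (\<open>ex_gibbs_measure\<close>).

The inequality \<open>P\<^sub>\<nu> \<le> P\<close> for every invariant \<open>\<nu>\<close> is \<open>ln x \<le> x - 1\<close> summed over words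
(\<open>measure_pressure_le\<close>).  For the Gibbs measure the block sums \<open>S n = \<Sum>\<omega>. \<mu> [\<omega>] * ln (\<phi> \<omega> / \<mu> [\<omega>])\<close>
are at least \<open>ln (Z n) - 2 * ln G\<close>, and they are sub-additive in \<open>n\<close>; the bounded error is
therefore absorbed, \<open>S n \<ge> n * P\<close>, and \<open>P\<^sub>\<mu> = P\<close> (\<open>gibbs_measure_pressure_ge\<close>).

For uniqueness, let \<open>P\<^sub>\<nu> = P\<close>.  Then the block sums of \<open>\<nu>\<close> are at least \<open>n * P\<close>, and comparing \<open>\<phi>\<close>
with \<open>\<mu>\<close> shows that the relative entropy of \<open>\<nu>\<close> with respect to \<open>\<mu>\<close> on words of length \<open>n\<close> is
at most \<open>3 * ln G\<close> for all \<open>n\<close>.  Such a uniform bound forces \<open>\<nu>\<close> to be absolutely continuous with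
respect to \<open>\<mu>\<close> (\<open>equilibrium_measure_unique\<close>).  Quasi-multiplicativity makes \<open>\<mu>\<close> ergodic
(\<open>gibbs_measure_zero_one\<close>), and an invariant probability measure that is absolutely continuous with
respect to an ergodic one coincides with it (\<open>abs_cont_invariant_unique\<close>); hence \<open>\<nu> = \<mu>\<close>.

If \<open>Z 1 = \<infinity>\<close>, the pressure is infinite.  The same construction is applied to \<open>\<phi>\<close> restricted to words
over a finite alphabet \<open>I\<close> containing the letters of all connecting words.  The Gibbs measure of the
restriction is a competitor in the supremum for \<open>\<phi>\<close>, and its pressure \<open>P\<^sub>I\<close> is unbounded as \<open>I\<close>
grows because \<open>\<Sum>i\<in>I. \<phi> [i]\<close> is bounded in terms of \<open>P\<^sub>I\<close>, \<open>c\<close> and \<open>\<Gamma>\<close> only (\<open>z_1_le\<close>).  To treat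
both cases at once, the construction is carried out for weights that may vanish on some words.
\<close>

section \<open>Cylinders and Borel measures on sequences\<close>

lemma mem_cylinder_iff: "x \<in> cylinder \<omega> \<longleftrightarrow> prefix (length \<omega>) x = \<omega>"
  by (auto simp: cylinder_def) (metis prefix_suffix)

lemma open_cylinder: "open (cylinder \<omega>)"
proof -
  have "x \<in> cylinder \<omega> \<longleftrightarrow> (\<forall>i. x i \<in> (if i < length \<omega> then {\<omega> ! i} else UNIV))" for x
    unfolding mem_cylinder_iff list_eq_iff_nth_eq by auto
  then have "cylinder \<omega> = Pi\<^sub>E UNIV (\<lambda>i. if i < length \<omega> then {\<omega> ! i} else UNIV)"
    unfolding PiE_UNIV_domain by blast
  moreover have "open \<dots>"
    by (rule open_PiE) (auto intro: finite_subset[of _ "{..<length \<omega>}"] Topological_Spaces.open_discrete)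
  ultimately show ?thesis by simp
qed

lemma borel_cylinder [measurable, simp]: "cylinder \<omega> \<in> sets borel"
  by (simp add: open_cylinder borel_open)

lemma suffix_measurable [measurable]: "suffix k \<in> borel_measurable (borel :: (nat \<Rightarrow> nat) measure)"
proof -
  have "continuous_on UNIV (suffix k :: (nat \<Rightarrow> nat) \<Rightarrow> _)"
    by (rule continuous_on_coordinatewise_then_product) (simp add: suffix_def)
  then show ?thesis by (rule borel_measurable_continuous_onI)
qed

lemma prefix_measurable [measurable]: "prefix n \<in> borel \<rightarrow>\<^sub>M count_space (words n)"
proof (rule measurable_count_space_eq2_countable[THEN iffD2])
  have "prefix n -` {a} \<inter> space borel \<in> sets borel" if "a \<in> words n" for a :: "nat list"
  proof -
    have "prefix n -` {a} \<inter> space borel = cylinder a"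
      using that by (auto simp: mem_cylinder_iff words_def)
    then show ?thesis by simp
  qed
  then show "prefix n \<in> space borel \<rightarrow> words n \<and> (\<forall>a\<in>words n. prefix n -` {a} \<inter> space borel \<in> sets borel)"
    by (auto simp: words_def)
qed

lemma cylinder_prefix_antimono: "m \<le> n \<Longrightarrow> cylinder (prefix n x) \<subseteq> cylinder (prefix m x)"
  by (auto simp: mem_cylinder_iff list_eq_iff_nth_eq)

text \<open>
The union is increasing in \<open>n\<close>.  Inequalities between measures that are linear in the measures
thus pass from unions of cylinders of equal length to open sets, and by outer regularity to Borel sets.
\<close>

lemma open_eq_UN_cylinder_prefix:
  assumes "open U"
  shows "U = (\<Union>n. {x. cylinder (prefix n x) \<subseteq> U})"
proof (intro set_eqI iffI)
  fix x assume "x \<in> U"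
  then obtain X where X: "x \<in> Pi\<^sub>E UNIV X" "finite {i. X i \<noteq> UNIV}" "Pi\<^sub>E UNIV X \<subseteq> U"
    using assms product_topology_open_contains_basis[of "\<lambda>_. euclidean" UNIV U x]
    unfolding open_fun_def by auto
  obtain n where n: "{i. X i \<noteq> UNIV} \<subseteq> {..<n}" using X(2) finite_nat_iff_bounded by auto
  have "cylinder (prefix n x) \<subseteq> Pi\<^sub>E UNIV X"
  proof
    fix y assume "y \<in> cylinder (prefix n x)"
    then have "y i = x i" if "i < n" for i
      using that by (auto simp: mem_cylinder_iff list_eq_iff_nth_eq)
    then have "y i \<in> X i" for i using X(1) n by (cases "i < n") (force simp: PiE_iff)+
    then show "y \<in> Pi\<^sub>E UNIV X" by auto
  qed
  with X(3) show "x \<in> (\<Union>n. {x. cylinder (prefix n x) \<subseteq> U})" by auto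
next
  fix x assume "x \<in> (\<Union>n. {x. cylinder (prefix n x) \<subseteq> U})"
  then show "x \<in> U" by (auto simp: mem_cylinder_iff)
qed

lemma prefix_set_measurable [measurable]:
  fixes W :: "nat list set"
  shows "{x. prefix n x \<in> W} \<in> sets borel"
proof -
  have "{x. prefix n x \<in> W} = prefix n -` (W \<inter> words n) \<inter> space borel"
    by (auto simp: words_def)
  also have "\<dots> \<in> sets borel" by (rule measurable_sets[OF prefix_measurable]) auto
  finally show ?thesis .
qed

lemma open_emeasure_LIMSEQ:
  assumes "open U" "sets M = sets borel"
  shows "(\<lambda>n. emeasure M {x. prefix n x \<in> {\<omega>. cylinder \<omega> \<subseteq> U}}) \<longlonglongrightarrow> emeasure M U"
proof -
  have "(\<lambda>n. emeasure M {x. cylinder (prefix n x) \<subseteq> U}) \<longlonglongrightarrow> emeasure M (\<Union>n. {x. cylinder (prefix n x) \<subseteq> U})"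
  proof (rule Lim_emeasure_incseq)
    show "range (\<lambda>n. {x. cylinder (prefix n x) \<subseteq> U}) \<subseteq> sets M"
      using prefix_set_measurable[of _ "{\<omega>. cylinder \<omega> \<subseteq> U}"] assms(2) by auto
    show "incseq (\<lambda>n. {x. cylinder (prefix n x) \<subseteq> U})"
      by (intro monoI) (use cylinder_prefix_antimono in blast)
  qed
  with open_eq_UN_cylinder_prefix[OF assms(1)] show ?thesis by simp
qed

text \<open>
Turns integrals over sequences of functions of the first \<open>n\<close> letters into sums over words.
\<close>

lemma distr_prefix:
  assumes "sets M = sets borel"
  shows "distr M (count_space (words n)) (prefix n) =
    density (count_space (words n)) (\<lambda>\<omega>. emeasure M (cylinder \<omega>))"
proof (rule measure_eqI_countable[where A="words n"])
  fix a assume a: "a \<in> words n"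
  have [measurable_cong]: "sets M = sets borel" by fact
  have "space M = UNIV" using sets_eq_imp_space_eq[OF assms] by simp
  then have "prefix n -` {a} \<inter> space M = cylinder a" using a
    by (auto simp: mem_cylinder_iff words_def)
  moreover have "prefix n \<in> M \<rightarrow>\<^sub>M count_space (words n)" by measurable
  ultimately have "emeasure (distr M (count_space (words n)) (prefix n)) {a} = emeasure M (cylinder a)"
    using a by (subst emeasure_distr) auto
  also have "\<dots> = emeasure (density (count_space (words n)) (\<lambda>\<omega>. emeasure M (cylinder \<omega>))) {a}"
    using a by (subst emeasure_density) (auto simp: nn_integral_count_space_indicator)
  finally show "emeasure (distr M (count_space (words n)) (prefix n)) {a} =
      emeasure (density (count_space (words n)) (\<lambda>\<omega>. emeasure M (cylinder \<omega>))) {a}" .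
qed auto

lemma nn_integral_prefix:
  assumes "sets M = sets borel"
  shows "(\<integral>\<^sup>+x. f (prefix n x) \<partial>M) = (\<integral>\<^sup>+\<omega>. emeasure M (cylinder \<omega>) * f \<omega> \<partial>count_space (words n))"
proof -
  have [measurable_cong]: "sets M = sets borel" by fact
  have "(\<integral>\<^sup>+x. f (prefix n x) \<partial>M) = (\<integral>\<^sup>+\<omega>. f \<omega> \<partial>distr M (count_space (words n)) (prefix n))"
    by (subst nn_integral_distr) auto
  then show ?thesis by (simp add: distr_prefix[OF assms] nn_integral_density)
qed

lemma emeasure_prefix:
  assumes "sets M = sets borel"
  shows "emeasure M {x. prefix n x \<in> W} =
    (\<integral>\<^sup>+\<omega>. emeasure M (cylinder \<omega>) * indicator W \<omega> \<partial>count_space (words n))"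
proof -
  have "emeasure M {x. prefix n x \<in> W} = (\<integral>\<^sup>+x. indicator {x. prefix n x \<in> W} x \<partial>M)"
    using assms prefix_set_measurable[of n W] by simp
  also have "\<dots> = (\<integral>\<^sup>+x. indicator W (prefix n x) \<partial>M)"
    by (intro nn_integral_cong) (auto split: split_indicator)
  finally show ?thesis by (simp add: nn_integral_prefix[OF assms])
qed

text \<open>
Outer regularity and Kolmogorov's extension theorem rest on completeness.  Both are transported from
the complete metric space of real sequences along the continuous embedding \<open>to_real_seq\<close> and its Borel
left inverse \<open>floor_seq\<close>.
\<close>

definition to_real_seq :: "(nat \<Rightarrow> nat) \<Rightarrow> nat \<Rightarrow> real" where
  "to_real_seq x = (\<lambda>i. real (x i))"

definition floor_seq :: "(nat \<Rightarrow> real) \<Rightarrow> nat \<Rightarrow> nat" where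
  "floor_seq y = (\<lambda>i. nat \<lfloor>y i\<rfloor>)"

lemma floor_seq_to_real_seq [simp]: "floor_seq (to_real_seq x) = x"
  by (simp add: floor_seq_def to_real_seq_def)

lemma continuous_on_to_real_seq: "continuous_on UNIV to_real_seq"
  unfolding to_real_seq_def
proof (rule continuous_on_coordinatewise_then_product)
  fix i
  have "continuous_on UNIV (\<lambda>n::nat. real n)" by simp
  then show "continuous_on UNIV (\<lambda>x::nat \<Rightarrow> nat. real (x i))"
    by (rule continuous_on_compose2[OF _ continuous_on_product_coordinates]) auto
qed

lemma to_real_seq_measurable [measurable]: "to_real_seq \<in> borel_measurable borel"
  by (rule borel_measurable_continuous_onI[OF continuous_on_to_real_seq])

lemma floor_seq_measurable [measurable]: "floor_seq \<in> borel_measurable borel"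
  unfolding floor_seq_def
proof (rule measurable_coordinatewise_then_product)
  fix i
  have "(\<lambda>y::nat \<Rightarrow> real. nat \<lfloor>y i\<rfloor>) \<in> borel \<rightarrow>\<^sub>M count_space UNIV"
    by (rule measurable_compose[OF measurable_product_coordinates]) measurable
  then show "(\<lambda>y::nat \<Rightarrow> real. nat \<lfloor>y i\<rfloor>) \<in> borel_measurable borel"
    by (rule measurable_compose) simp
qed

lemma outer_regular_nat_seq:
  fixes M :: "(nat \<Rightarrow> nat) measure"
  assumes M: "sets M = sets borel" "emeasure M (space M) \<noteq> \<infinity>" and A: "A \<in> sets borel"
  shows "emeasure M A = (INF U\<in>{U. A \<subseteq> U \<and> open U}. emeasure M U)"
proof (rule antisym)
  have [measurable_cong]: "sets M = sets borel" by fact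
  have space [simp]: "space M = UNIV" using sets_eq_imp_space_eq[OF M(1)] by simp
  show "emeasure M A \<le> (INF U\<in>{U. A \<subseteq> U \<and> open U}. emeasure M U)"
    using M by (auto intro!: INF_greatest emeasure_mono)
  let ?N = "distr M borel to_real_seq"
  have N: "emeasure ?N B = emeasure M (to_real_seq -` B)" if "B \<in> sets borel" for B
    using that by (subst emeasure_distr) auto
  let ?B = "floor_seq -` A"
  have B: "?B \<in> sets borel" using measurable_sets[OF floor_seq_measurable A] by simp
  have "(INF U\<in>{U. A \<subseteq> U \<and> open U}. emeasure M U) \<le> (INF V\<in>{V. ?B \<subseteq> V \<and> open V}. emeasure ?N V)"
  proof (rule INF_mono)
    fix V assume V: "V \<in> {V. ?B \<subseteq> V \<and> open V}"
    have "A \<subseteq> to_real_seq -` V"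
    proof
      fix x assume "x \<in> A"
      then have "to_real_seq x \<in> ?B" by simp
      then show "x \<in> to_real_seq -` V" using V by blast
    qed
    moreover have "open (to_real_seq -` V)"
      using V continuous_on_to_real_seq by (simp add: continuous_on_open_vimage)
    ultimately show "\<exists>U\<in>{U. A \<subseteq> U \<and> open U}. emeasure M U \<le> emeasure ?N V"
      using N[of V] V by (intro bexI[of _ "to_real_seq -` V"]) auto
  qed
  also have "\<dots> = emeasure ?N ?B"
    by (rule outer_regular[symmetric]) (use M B N[of UNIV] in auto)
  also have "\<dots> = emeasure M A"
    using B by (simp add: N vimage_def)
  finally show "(INF U\<in>{U. A \<subseteq> U \<and> open U}. emeasure M U) \<le> emeasure M A" .
qed

text \<open>
Open sets are increasing unions of disjoint unions of cylinders, and the larger measure is outer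
regular.
\<close>

lemma cylinder_le_imp_le:
  fixes M N :: "(nat \<Rightarrow> nat) measure"
  assumes M: "sets M = sets borel" "emeasure M (space M) \<noteq> \<infinity>"
    and N: "sets N = sets borel"
    and le: "\<And>\<omega>. emeasure N (cylinder \<omega>) \<le> emeasure M (cylinder \<omega>)"
    and A: "A \<in> sets borel"
  shows "emeasure N A \<le> emeasure M A"
proof -
  have le_open: "emeasure N U \<le> emeasure M U" if "open U" for U
  proof (rule LIMSEQ_le[OF open_emeasure_LIMSEQ[OF that N] open_emeasure_LIMSEQ[OF that M(1)]])
    show "\<exists>k. \<forall>n\<ge>k. emeasure N {x. prefix n x \<in> {\<omega>. cylinder \<omega> \<subseteq> U}}
        \<le> emeasure M {x. prefix n x \<in> {\<omega>. cylinder \<omega> \<subseteq> U}}"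
      unfolding emeasure_prefix[OF M(1)] emeasure_prefix[OF N]
      by (intro exI allI impI nn_integral_mono mult_right_mono le) auto
  qed
  have "emeasure N A \<le> emeasure M U" if "open U" "A \<subseteq> U" for U
  proof -
    have "emeasure N A \<le> emeasure N U" using that N by (intro emeasure_mono) auto
    also have "\<dots> \<le> emeasure M U" using le_open[OF that(1)] .
    finally show ?thesis .
  qed
  then show ?thesis
    unfolding outer_regular_nat_seq[OF M A] by (intro INF_greatest) auto
qed

lemma measure_eqI_cylinder:
  fixes M N :: "(nat \<Rightarrow> nat) measure"
  assumes M: "sets M = sets borel" "finite_measure M"
    and N: "sets N = sets borel" "finite_measure N"
    and eq: "\<And>\<omega>. emeasure M (cylinder \<omega>) = emeasure N (cylinder \<omega>)"
  shows "M = N"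
proof (rule measure_eqI)
  fix A assume A: "A \<in> sets M"
  have "emeasure M A \<le> emeasure N A"
    by (rule cylinder_le_imp_le)
      (use A M N finite_measure.emeasure_finite[OF N(2)] eq in auto)
  moreover have "emeasure N A \<le> emeasure M A"
    by (rule cylinder_le_imp_le)
      (use A M N finite_measure.emeasure_finite[OF M(2)] eq in auto)
  ultimately show "emeasure M A = emeasure N A" by (rule antisym)
qed (simp add: M N)

section \<open>Sums over words of a given length\<close>

definition word_sum :: "nat \<Rightarrow> (nat list \<Rightarrow> ennreal) \<Rightarrow> ennreal" where
  "word_sum n f = (\<integral>\<^sup>+\<omega>. f \<omega> \<partial>count_space (words n))"

lemma word_sum_mono: "(\<And>\<omega>. length \<omega> = n \<Longrightarrow> f \<omega> \<le> g \<omega>) \<Longrightarrow> word_sum n f \<le> word_sum n g"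
  unfolding word_sum_def by (intro nn_integral_mono) (auto simp: words_def)

lemma word_sum_cong: "(\<And>\<omega>. length \<omega> = n \<Longrightarrow> f \<omega> = g \<omega>) \<Longrightarrow> word_sum n f = word_sum n g"
  unfolding word_sum_def by (intro nn_integral_cong) (auto simp: words_def)

lemma word_sum_cmult: "word_sum n (\<lambda>\<omega>. a * f \<omega>) = a * word_sum n f"
  unfolding word_sum_def by (rule nn_integral_cmult) simp

lemma word_sum_multc: "word_sum n (\<lambda>\<omega>. f \<omega> * a) = word_sum n f * a"
  unfolding word_sum_def by (rule nn_integral_multc) simp

lemma word_sum_sum: "word_sum n (\<lambda>\<omega>. \<Sum>i\<in>I. f i \<omega>) = (\<Sum>i\<in>I. word_sum n (f i))"
  unfolding word_sum_def by (rule nn_integral_sum) simp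

lemma word_sum_0: "word_sum 0 f = f []"
proof -
  have "words 0 = {[]}" by (auto simp: words_def)
  then show ?thesis unfolding word_sum_def by (simp add: nn_integral_count_space_finite)
qed

lemma word_sum_ge: "f \<omega> \<le> word_sum (length \<omega>) f"
  unfolding word_sum_def by (rule nn_integral_ge_point) (simp add: words_def)

lemma word_sum_add: "word_sum (m + n) f = word_sum m (\<lambda>\<alpha>. word_sum n (\<lambda>\<beta>. f (\<alpha> @ \<beta>)))"
proof -
  have bij: "bij_betw (\<lambda>(\<omega>, \<tau>). \<omega> @ \<tau>) (words m \<times> words n) (words (m + n))"
    by (rule bij_betw_byWitness[where f' = "\<lambda>\<omega>. (take m \<omega>, drop m \<omega>)"])
       (auto simp: words_def)
  interpret sigma_finite_measure "count_space (words n)"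
    by (rule sigma_finite_measure_count_space_countable) simp
  have pair: "count_space (words m) \<Otimes>\<^sub>M count_space (words n) = count_space (words m \<times> words n)"
    by (rule pair_measure_countable) auto
  have m: "(\<lambda>x. f (fst x @ snd x)) \<in> borel_measurable (count_space (words m) \<Otimes>\<^sub>M count_space (words n))"
    unfolding pair by simp
  have "word_sum (m + n) f = (\<integral>\<^sup>+x. f (fst x @ snd x) \<partial>count_space (words m \<times> words n))"
    unfolding word_sum_def
    by (subst nn_integral_bij_count_space[OF bij, symmetric]) (simp add: case_prod_unfold)
  then show ?thesis
    using nn_integral_fst[OF m] by (simp add: pair word_sum_def)
qed

lemma word_sum_swap: "word_sum m (\<lambda>\<alpha>. word_sum n (\<lambda>\<beta>. f \<alpha> \<beta>)) = word_sum n (\<lambda>\<beta>. word_sum m (\<lambda>\<alpha>. f \<alpha> \<beta>))"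
  unfolding word_sum_def
  by (rule nn_integral_count_space_nn_integral[of "words n" "\<lambda>\<beta> \<alpha>. f \<alpha> \<beta>"]) auto

section \<open>Almost multiplicativity of partition sums\<close>

lemma ennreal_divide_le_divide:
  fixes a b y z :: ennreal
  assumes "a * z \<le> b * y" "y \<noteq> 0" "y \<noteq> top" "z \<noteq> 0" "z \<noteq> top"
  shows "a / y \<le> b / z"
proof -
  have "a / y = a * z / z / y" using assms by (simp add: ennreal_mult_divide_eq)
  also have "\<dots> \<le> b * y / z / y" by (intro divide_right_mono_ennreal assms(1))
  also have "b * y / z = b / z * y" by (metis ennreal_times_divide mult.commute)
  also have "b / z * y / y = b / z" using assms by (simp add: ennreal_mult_divide_eq)
  finally show ?thesis .
qed

text \<open>
A weight extends a quasi-multiplicative potential with finite sum over letters by the value 1 at the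
empty word, and may vanish on some words: this covers restrictions to a sub-alphabet.  The sum over
\<open>\<Gamma>\<close> bounds the term of whichever connecting word a given pair of words has.
\<close>

locale quasi_multiplicative_weight =
  fixes w :: "nat list \<Rightarrow> ennreal" and c :: ennreal and \<Gamma> :: "nat list set"
  assumes w_Nil: "w [] = 1"
    and w_append_le: "w (\<omega> @ \<tau>) \<le> w \<omega> * w \<tau>"
    and finite_connectors: "finite \<Gamma>"
    and const_finite: "c < \<infinity>"
    and w_connect: "w \<omega> * w \<tau> \<le> c * (\<Sum>\<kappa>\<in>\<Gamma>. w (\<omega> @ \<kappa> @ \<tau>))"
    and word_sum_1_finite: "word_sum 1 w < \<infinity>"
    and word_sum_1_pos: "0 < word_sum 1 w"
begin

abbreviation Z :: "nat \<Rightarrow> ennreal" where "Z n \<equiv> word_sum n w"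

text \<open>
The price for summing over a free word instead of a connecting word.
\<close>

definition G :: ennreal where "G = c * (\<Sum>\<kappa>\<in>\<Gamma>. Z (length \<kappa>))"

lemma Z_0 [simp]: "Z 0 = 1"
  by (simp add: word_sum_0 w_Nil)

lemma Z_add_le: "Z (m + n) \<le> Z m * Z n"
proof -
  have "Z (m + n) \<le> word_sum m (\<lambda>\<alpha>. word_sum n (\<lambda>\<beta>. w \<alpha> * w \<beta>))"
    unfolding word_sum_add by (intro word_sum_mono w_append_le)
  then show ?thesis by (simp add: word_sum_cmult word_sum_multc)
qed

lemma Z_finite: "Z n < \<infinity>"
proof (induction n)
  case (Suc n)
  have "Z (Suc n) \<le> Z n * Z 1" using Z_add_le[of n 1] by simp
  also have "\<dots> < \<infinity>" using Suc word_sum_1_finite by (simp add: ennreal_mult_less_top)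
  finally show ?case .
qed simp

lemma w_finite: "w \<omega> < \<infinity>"
  using word_sum_ge[of w \<omega>] Z_finite by (rule le_less_trans)

lemma G_finite: "G < \<infinity>"
  unfolding G_def using const_finite Z_finite finite_connectors
  by (auto simp: ennreal_mult_less_top ennreal_mult_eq_top_iff less_top[symmetric])

text \<open>
The connecting word \<open>\<kappa>\<close> sits between \<open>\<alpha>\<close> and \<open>\<omega>\<close>.  Letting it range over all words of its length
only increases the sum; then \<open>\<alpha> @ \<kappa>\<close> is an arbitrary word of length \<open>k + length \<kappa>\<close>, which is cut at
position \<open>length \<kappa>\<close> instead of \<open>k\<close>, and sub-multiplicativity splits off the first part.
\<close>

lemma Z_mult_w_le: "Z k * w \<omega> \<le> G * word_sum k (\<lambda>\<alpha>. w (\<alpha> @ \<omega>))"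
proof -
  let ?S = "word_sum k (\<lambda>\<alpha>. w (\<alpha> @ \<omega>))"
  have S: "word_sum k (\<lambda>\<alpha>. w (\<alpha> @ \<kappa> @ \<omega>)) \<le> Z (length \<kappa>) * ?S" for \<kappa>
  proof -
    let ?j = "length \<kappa>"
    have "word_sum k (\<lambda>\<alpha>. w (\<alpha> @ \<kappa> @ \<omega>)) \<le> word_sum k (\<lambda>\<alpha>. word_sum ?j (\<lambda>\<beta>. w (\<alpha> @ \<beta> @ \<omega>)))"
      by (intro word_sum_mono word_sum_ge[where f="\<lambda>\<beta>. w (_ @ \<beta> @ \<omega>)"])
    also have "\<dots> = word_sum (k + ?j) (\<lambda>\<gamma>. w (\<gamma> @ \<omega>))"
      by (simp add: word_sum_add)
    also have "\<dots> = word_sum (?j + k) (\<lambda>\<gamma>. w (\<gamma> @ \<omega>))" by (simp add: add.commute)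
    also have "\<dots> = word_sum ?j (\<lambda>\<delta>. word_sum k (\<lambda>\<alpha>. w (\<delta> @ \<alpha> @ \<omega>)))"
      by (simp add: word_sum_add)
    also have "\<dots> \<le> word_sum ?j (\<lambda>\<delta>. word_sum k (\<lambda>\<alpha>. w \<delta> * w (\<alpha> @ \<omega>)))"
      by (intro word_sum_mono w_append_le)
    finally show ?thesis by (simp add: word_sum_cmult word_sum_multc)
  qed
  \<comment> \<open>Insert a connecting word and apply \<open>S\<close> to each element of \<open>\<Gamma>\<close>.\<close>
  have "Z k * w \<omega> = word_sum k (\<lambda>\<alpha>. w \<alpha> * w \<omega>)" by (simp add: word_sum_multc)
  also have "\<dots> \<le> word_sum k (\<lambda>\<alpha>. c * (\<Sum>\<kappa>\<in>\<Gamma>. w (\<alpha> @ \<kappa> @ \<omega>)))"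
    by (intro word_sum_mono w_connect)
  also have "\<dots> = c * (\<Sum>\<kappa>\<in>\<Gamma>. word_sum k (\<lambda>\<alpha>. w (\<alpha> @ \<kappa> @ \<omega>)))"
    by (simp add: word_sum_cmult word_sum_sum)
  also have "\<dots> \<le> c * (\<Sum>\<kappa>\<in>\<Gamma>. Z (length \<kappa>) * ?S)"
    by (intro mult_left_mono sum_mono S) auto
  also have "\<dots> = G * ?S" by (simp add: G_def sum_distrib_right mult.assoc)
  finally show ?thesis .
qed

text \<open>
The mirror image of the preceding lemma.
\<close>

lemma w_mult_Z_le: "w \<omega> * Z l \<le> G * word_sum l (\<lambda>\<beta>. w (\<omega> @ \<beta>))"
proof -
  let ?S = "word_sum l (\<lambda>\<beta>. w (\<omega> @ \<beta>))"
  have S: "word_sum l (\<lambda>\<beta>. w (\<omega> @ \<kappa> @ \<beta>)) \<le> Z (length \<kappa>) * ?S" for \<kappa>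
  proof -
    let ?j = "length \<kappa>"
    have "word_sum l (\<lambda>\<beta>. w (\<omega> @ \<kappa> @ \<beta>)) \<le> word_sum ?j (\<lambda>\<alpha>. word_sum l (\<lambda>\<beta>. w (\<omega> @ \<alpha> @ \<beta>)))"
      by (rule word_sum_ge[where f="\<lambda>\<alpha>. word_sum l (\<lambda>\<beta>. w (\<omega> @ \<alpha> @ \<beta>))"])
    also have "\<dots> = word_sum (?j + l) (\<lambda>\<gamma>. w (\<omega> @ \<gamma>))"
      by (simp add: word_sum_add)
    also have "\<dots> = word_sum (l + ?j) (\<lambda>\<gamma>. w (\<omega> @ \<gamma>))" by (simp add: add.commute)
    also have "\<dots> = word_sum l (\<lambda>\<beta>. word_sum ?j (\<lambda>\<delta>. w ((\<omega> @ \<beta>) @ \<delta>)))"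
      by (simp add: word_sum_add)
    also have "\<dots> \<le> word_sum l (\<lambda>\<beta>. word_sum ?j (\<lambda>\<delta>. w (\<omega> @ \<beta>) * w \<delta>))"
      by (intro word_sum_mono w_append_le)
    finally show ?thesis by (simp add: word_sum_cmult word_sum_multc mult.commute)
  qed
  have "w \<omega> * Z l = word_sum l (\<lambda>\<beta>. w \<omega> * w \<beta>)" by (simp add: word_sum_cmult)
  also have "\<dots> \<le> word_sum l (\<lambda>\<beta>. c * (\<Sum>\<kappa>\<in>\<Gamma>. w (\<omega> @ \<kappa> @ \<beta>)))"
    by (intro word_sum_mono w_connect)
  also have "\<dots> = c * (\<Sum>\<kappa>\<in>\<Gamma>. word_sum l (\<lambda>\<beta>. w (\<omega> @ \<kappa> @ \<beta>)))"
    by (simp add: word_sum_cmult word_sum_sum)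
  also have "\<dots> \<le> c * (\<Sum>\<kappa>\<in>\<Gamma>. Z (length \<kappa>) * ?S)"
    by (intro mult_left_mono sum_mono S) auto
  also have "\<dots> = G * ?S" by (simp add: G_def sum_distrib_right mult.assoc)
  finally show ?thesis .
qed

lemma Z_mult_le: "Z m * Z n \<le> G * Z (m + n)"
proof -
  have "Z m * Z n = word_sum n (\<lambda>\<beta>. Z m * w \<beta>)" by (simp add: word_sum_cmult)
  also have "\<dots> \<le> word_sum n (\<lambda>\<beta>. G * word_sum m (\<lambda>\<alpha>. w (\<alpha> @ \<beta>)))"
    by (intro word_sum_mono Z_mult_w_le)
  also have "\<dots> = G * word_sum m (\<lambda>\<alpha>. word_sum n (\<lambda>\<beta>. w (\<alpha> @ \<beta>)))"
    by (simp add: word_sum_cmult word_sum_swap[of n m])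
  finally show ?thesis by (simp add: word_sum_add)
qed

lemma G_ge_1: "1 \<le> G"
  using Z_mult_le[of 0 0] by simp

lemma Z_pos: "0 < Z n"
proof (induction n)
  case (Suc n)
  have "0 < Z n * Z 1" using Suc word_sum_1_pos by (simp add: ennreal_zero_less_mult_iff)
  also have "\<dots> \<le> G * Z (Suc n)" using Z_mult_le[of n 1] by simp
  finally show ?case by (simp add: ennreal_zero_less_mult_iff)
qed simp

lemma Z_less_top [simp]: "Z n < top" and Z_neq_top [simp]: "Z n \<noteq> top" and Z_neq_0 [simp]: "Z n \<noteq> 0"
  using Z_finite[of n] Z_pos[of n] by auto

lemma G_less_top [simp]: "G < top" and G_neq_top [simp]: "G \<noteq> top"
  using G_finite by auto

text \<open>
The total weight of the words in which \<open>\<omega>\<close> is preceded by \<open>k\<close> and followed by \<open>l\<close> letters.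
\<close>

definition padded_sum :: "nat \<Rightarrow> nat \<Rightarrow> nat list \<Rightarrow> ennreal" where
  "padded_sum k l \<omega> = word_sum k (\<lambda>\<alpha>. word_sum l (\<lambda>\<beta>. w (\<alpha> @ \<omega> @ \<beta>)))"

lemma padded_sum_le: "padded_sum k l \<omega> \<le> Z k * w \<omega> * Z l"
proof -
  have "padded_sum k l \<omega> \<le> word_sum k (\<lambda>\<alpha>. word_sum l (\<lambda>\<beta>. w \<alpha> * w \<omega> * w \<beta>))"
    unfolding padded_sum_def
  proof (intro word_sum_mono)
    fix \<alpha> \<beta> :: "nat list"
    have "w (\<alpha> @ \<omega> @ \<beta>) \<le> w \<alpha> * w (\<omega> @ \<beta>)" by (rule w_append_le)
    also have "\<dots> \<le> w \<alpha> * (w \<omega> * w \<beta>)" by (intro mult_left_mono w_append_le) simp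
    finally show "w (\<alpha> @ \<omega> @ \<beta>) \<le> w \<alpha> * w \<omega> * w \<beta>" by (simp add: mult.assoc)
  qed
  then show ?thesis by (simp add: word_sum_cmult word_sum_multc)
qed

text \<open>
Removing the connecting words on the two sides of \<open>\<omega>\<close> costs one factor \<open>G\<close> each.
\<close>

lemma le_padded_sum: "Z k * w \<omega> * Z l \<le> G\<^sup>2 * padded_sum k l \<omega>"
proof -
  have "Z k * w \<omega> * Z l = Z k * (w \<omega> * Z l)" by (simp add: mult.assoc)
  also have "\<dots> \<le> Z k * (G * word_sum l (\<lambda>\<beta>. w (\<omega> @ \<beta>)))"
    by (intro mult_left_mono w_mult_Z_le) simp
  also have "\<dots> = G * word_sum l (\<lambda>\<beta>. Z k * w (\<omega> @ \<beta>))" by (simp add: word_sum_cmult ac_simps)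
  also have "\<dots> \<le> G * word_sum l (\<lambda>\<beta>. G * word_sum k (\<lambda>\<alpha>. w (\<alpha> @ \<omega> @ \<beta>)))"
    by (intro mult_left_mono word_sum_mono Z_mult_w_le) simp
  also have "\<dots> = G\<^sup>2 * padded_sum k l \<omega>"
    unfolding padded_sum_def by (simp add: word_sum_cmult word_sum_swap[of l k] power2_eq_square mult.assoc)
  finally show ?thesis .
qed

lemma word_sum_padded_sum_append: "word_sum 1 (\<lambda>\<iota>. padded_sum k l (\<omega> @ \<iota>)) = padded_sum k (Suc l) \<omega>"
  unfolding padded_sum_def word_sum_swap[of 1 k] using word_sum_add[of 1 l]
  by (intro word_sum_cong) simp

lemma word_sum_padded_sum_prepend: "word_sum 1 (\<lambda>\<iota>. padded_sum k l (\<iota> @ \<omega>)) = padded_sum (Suc k) l \<omega>"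
  unfolding padded_sum_def word_sum_swap[of 1 k] using word_sum_add[of k 1]
  by simp

lemma padded_sum_Nil: "padded_sum k l [] = Z (k + l)"
  by (simp add: padded_sum_def word_sum_add)

text \<open>
The probability to find \<open>\<omega>\<close> after \<open>k\<close> letters in a word of length \<open>M\<close> that is drawn with probability
proportional to its weight.  It has this meaning for \<open>k + length \<omega> \<le> M\<close> only.
\<close>

definition window_prob :: "nat \<Rightarrow> nat \<Rightarrow> nat list \<Rightarrow> ennreal" where
  "window_prob M k \<omega> = padded_sum k (M - k - length \<omega>) \<omega> / Z M"

definition gibbs_bound :: "nat list \<Rightarrow> ennreal" where
  "gibbs_bound \<omega> = G\<^sup>2 * w \<omega> / Z (length \<omega>)"

text \<open>
Up to \<open>G\<^sup>2\<close> the factors \<open>Z k\<close>, \<open>Z (length \<omega>)\<close> and \<open>Z l\<close> multiply to \<open>Z M\<close>, so that the padding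
cancels against the normalisation.
\<close>

lemma window_prob_le:
  assumes "k + length \<omega> \<le> M"
  shows "window_prob M k \<omega> \<le> gibbs_bound \<omega>"
proof -
  let ?n = "length \<omega>" and ?l = "M - k - length \<omega>"
  have "Z k * Z ?n * Z ?l \<le> G * Z (k + ?n) * Z ?l"
    by (intro mult_right_mono Z_mult_le) simp
  also have "\<dots> = G * (Z (k + ?n) * Z ?l)" by (simp add: mult.assoc)
  also have "\<dots> \<le> G * (G * Z (k + ?n + ?l))"
    by (intro mult_left_mono Z_mult_le) simp
  finally have *: "Z k * Z ?n * Z ?l \<le> G\<^sup>2 * Z M"
    using assms by (simp add: power2_eq_square mult.assoc)
  have "padded_sum k ?l \<omega> * Z ?n \<le> Z k * w \<omega> * Z ?l * Z ?n"
    by (intro mult_right_mono padded_sum_le) simp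
  also have "\<dots> = w \<omega> * (Z k * Z ?n * Z ?l)" by (simp add: ac_simps)
  also have "\<dots> \<le> w \<omega> * (G\<^sup>2 * Z M)" by (intro mult_left_mono *) simp
  finally show ?thesis
    unfolding window_prob_def gibbs_bound_def
    by (intro ennreal_divide_le_divide) (simp_all add: ac_simps)
qed

lemma le_window_prob:
  assumes "k + length \<omega> \<le> M"
  shows "w \<omega> \<le> G\<^sup>2 * Z (length \<omega>) * window_prob M k \<omega>"
proof -
  let ?n = "length \<omega>" and ?l = "M - k - length \<omega>"
  have "Z M = Z (k + ?n + ?l)" using assms by simp
  also have "\<dots> \<le> Z (k + ?n) * Z ?l" by (rule Z_add_le)
  also have "\<dots> \<le> Z k * Z ?n * Z ?l" by (intro mult_right_mono Z_add_le) simp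
  finally have "w \<omega> * Z M \<le> w \<omega> * (Z k * Z ?n * Z ?l)" by (intro mult_left_mono) simp_all
  also have "\<dots> = Z ?n * (Z k * w \<omega> * Z ?l)" by (simp add: ac_simps)
  also have "\<dots> \<le> Z ?n * (G\<^sup>2 * padded_sum k ?l \<omega>)" by (intro mult_left_mono le_padded_sum) simp
  finally have "w \<omega> * Z M / Z M \<le> Z ?n * (G\<^sup>2 * padded_sum k ?l \<omega>) / Z M"
    by (rule divide_right_mono_ennreal)
  then show ?thesis
    by (simp add: window_prob_def ennreal_mult_divide_eq ennreal_times_divide ac_simps)
qed

end

section \<open>Shift-invariant cylinder weights with Gibbs bounds\<close>

text \<open>
A countable power of \<open>[0, \<infinity>]\<close> is compact by Tychonoff's theorem and first countable, hence sequentially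
compact.
\<close>

lemma pointwise_convergent_subsequence:
  fixes f :: "nat \<Rightarrow> 'a::countable \<Rightarrow> ennreal"
  obtains r g where "strict_mono (r :: nat \<Rightarrow> nat)" "\<And>x. (\<lambda>n. f (r n) x) \<longlonglongrightarrow> g x"
proof -
  have "compactin (product_topology (\<lambda>_. euclidean) UNIV) (Pi\<^sub>E (UNIV :: 'a set) (\<lambda>_. UNIV :: ennreal set))"
    by (subst compactin_PiE) (simp add: compact_UNIV)
  then have "compact (UNIV :: ('a \<Rightarrow> ennreal) set)"
    by (simp add: euclidean_product_topology flip: compactin_euclidean_iff)
  then have "seq_compact (UNIV :: ('a \<Rightarrow> ennreal) set)" by (rule compact_imp_seq_compact)
  then obtain g and r :: "nat \<Rightarrow> nat" where r: "strict_mono r" and lim: "(f \<circ> r) \<longlonglongrightarrow> g"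
    by (rule seq_compactE[of _ f]) auto
  have "(\<lambda>n. f (r n) x) \<longlonglongrightarrow> g x" for x
    using continuous_on_tendsto_compose[OF continuous_on_product_coordinates[of x] lim]
    by (simp add: comp_def)
  with r that show ?thesis by blast
qed

lemma word_sum_dominated_convergence:
  assumes "\<And>j \<omega>. f j \<omega> \<le> b \<omega>" "word_sum n b < \<infinity>" "\<And>\<omega>. (\<lambda>j. f j \<omega>) \<longlonglongrightarrow> g \<omega>"
  shows "(\<lambda>j. word_sum n (f j)) \<longlonglongrightarrow> word_sum n g"
  unfolding word_sum_def
  by (rule nn_integral_dominated_convergence[where w=b]) (use assms in \<open>auto simp: word_sum_def\<close>)

context quasi_multiplicative_weight
begin

lemma gibbs_bound_finite: "gibbs_bound \<omega> < top"
  unfolding gibbs_bound_def using w_finite[of \<omega>]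
  by (simp add: ennreal_mult_less_top ennreal_divide_eq_top_iff less_top[symmetric] power_eq_top_ennreal
      ennreal_mult_eq_top_iff)

text \<open>
With \<open>dominating_sum_finite\<close>, and \<open>gibbs_bound_prepend_le\<close> for letters on the left, this provides the
summable function of the letter that dominates the weights of all one-letter extensions of \<open>\<omega>\<close>.
\<close>

lemma gibbs_bound_append_le: "gibbs_bound (\<omega> @ \<iota>) \<le> G\<^sup>2 * w \<omega> / Z (length \<omega> + length \<iota>) * w \<iota>"
proof -
  have "gibbs_bound (\<omega> @ \<iota>) \<le> G\<^sup>2 * (w \<omega> * w \<iota>) / Z (length \<omega> + length \<iota>)"
    unfolding gibbs_bound_def length_append
    by (intro divide_right_mono_ennreal mult_left_mono w_append_le) simp
  then show ?thesis by (simp add: divide_ennreal_def ac_simps)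
qed

lemma gibbs_bound_prepend_le: "gibbs_bound (\<iota> @ \<omega>) \<le> G\<^sup>2 * w \<omega> / Z (length \<omega> + length \<iota>) * w \<iota>"
proof -
  have "gibbs_bound (\<iota> @ \<omega>) \<le> G\<^sup>2 * (w \<iota> * w \<omega>) / Z (length \<iota> + length \<omega>)"
    unfolding gibbs_bound_def length_append
    by (intro divide_right_mono_ennreal mult_left_mono w_append_le) simp
  then show ?thesis by (simp add: divide_ennreal_def ac_simps)
qed

lemma dominating_sum_finite:
  "word_sum 1 (\<lambda>\<iota>. G\<^sup>2 * w \<omega> / Z (length \<omega> + length \<iota>) * w \<iota>) < \<infinity>"
proof -
  have "word_sum 1 (\<lambda>\<iota>. G\<^sup>2 * w \<omega> / Z (length \<omega> + length \<iota>) * w \<iota>) =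
      word_sum 1 (\<lambda>\<iota>. G\<^sup>2 * w \<omega> / Z (length \<omega> + 1) * w \<iota>)"
    by (rule word_sum_cong) simp
  also have "\<dots> = G\<^sup>2 * w \<omega> / Z (length \<omega> + 1) * Z 1" by (rule word_sum_cmult)
  also have "\<dots> < \<infinity>" using w_finite[of \<omega>]
    by (simp add: ennreal_mult_less_top ennreal_divide_eq_top_iff less_top[symmetric] power_eq_top_ennreal
      ennreal_mult_eq_top_iff)
  finally show ?thesis .
qed

text \<open>
The mean over the first \<open>N\<close> positions in words of length \<open>2 * N\<close>: a word of length at most \<open>N\<close>
starting at such a position fits.  Longer words get the value 0, which keeps the upper Gibbs bound.
\<close>

definition cesaro :: "nat \<Rightarrow> nat list \<Rightarrow> ennreal" where
  "cesaro N \<omega> = (if length \<omega> \<le> N then (\<Sum>k<N. window_prob (2 * N) k \<omega>) / of_nat N else 0)"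

lemma mean_const: "N > 0 \<Longrightarrow> of_nat N * a / (of_nat N :: ennreal) = a"
  by (metis ennreal_mult_divide_eq ennreal_of_nat_neq_top mult.commute of_nat_0_eq_iff less_numeral_extra(3))

lemma cesaro_le: "cesaro N \<omega> \<le> gibbs_bound \<omega>"
proof (cases "length \<omega> \<le> N \<and> N > 0")
  case True
  have "(\<Sum>k<N. window_prob (2 * N) k \<omega>) \<le> (\<Sum>k<N. gibbs_bound \<omega>)"
    using True by (intro sum_mono window_prob_le) auto
  then have "cesaro N \<omega> \<le> of_nat N * gibbs_bound \<omega> / of_nat N"
    using True by (auto simp: cesaro_def intro!: divide_right_mono_ennreal)
  then show ?thesis using True by (simp add: mean_const)
next
  case False
  then show ?thesis by (auto simp: cesaro_def)
qed

lemma le_cesaro: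
  assumes "length \<omega> \<le> N" "N > 0"
  shows "w \<omega> \<le> G\<^sup>2 * Z (length \<omega>) * cesaro N \<omega>"
proof -
  have "(\<Sum>k<N. w \<omega>) \<le> (\<Sum>k<N. G\<^sup>2 * Z (length \<omega>) * window_prob (2 * N) k \<omega>)"
    using assms by (intro sum_mono le_window_prob) auto
  then have "of_nat N * w \<omega> / of_nat N \<le> G\<^sup>2 * Z (length \<omega>) * (\<Sum>k<N. window_prob (2 * N) k \<omega>) / of_nat N"
    by (intro divide_right_mono_ennreal) (simp add: sum_distrib_left)
  then show ?thesis using assms by (simp add: mean_const cesaro_def ennreal_times_divide)
qed

lemma cesaro_Nil: "N > 0 \<Longrightarrow> cesaro N [] = 1"
proof -
  assume N: "N > 0"
  have "window_prob (2 * N) k [] = 1" if "k < N" for k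
    using that by (simp add: window_prob_def padded_sum_Nil ennreal_divide_self)
  then show "cesaro N [] = 1" using N mean_const[of N 1] by (simp add: cesaro_def)
qed

lemma word_sum_divide: "word_sum n (\<lambda>\<omega>. f \<omega> / a) = word_sum n f / a"
  by (simp add: divide_ennreal_def word_sum_multc)

lemma word_sum_window_prob_append:
  assumes "k + length \<omega> < M"
  shows "word_sum 1 (\<lambda>\<iota>. window_prob M k (\<omega> @ \<iota>)) = window_prob M k \<omega>"
proof -
  have "word_sum 1 (\<lambda>\<iota>. window_prob M k (\<omega> @ \<iota>)) = word_sum 1 (\<lambda>\<iota>. padded_sum k (M - k - length \<omega> - 1) (\<omega> @ \<iota>) / Z M)"
    unfolding window_prob_def by (rule word_sum_cong) simp
  also have "\<dots> = padded_sum k (Suc (M - k - length \<omega> - 1)) \<omega> / Z M"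
    by (simp only: word_sum_divide word_sum_padded_sum_append)
  also have "Suc (M - k - length \<omega> - 1) = M - k - length \<omega>" using assms by simp
  finally show ?thesis by (simp only: window_prob_def)
qed

lemma word_sum_window_prob_prepend:
  assumes "k + length \<omega> < M"
  shows "word_sum 1 (\<lambda>\<iota>. window_prob M k (\<iota> @ \<omega>)) = window_prob M (Suc k) \<omega>"
proof -
  have "word_sum 1 (\<lambda>\<iota>. window_prob M k (\<iota> @ \<omega>)) = word_sum 1 (\<lambda>\<iota>. padded_sum k (M - Suc k - length \<omega>) (\<iota> @ \<omega>) / Z M)"
    unfolding window_prob_def by (rule word_sum_cong) simp
  also have "\<dots> = padded_sum (Suc k) (M - Suc k - length \<omega>) \<omega> / Z M"
    by (simp only: word_sum_divide word_sum_padded_sum_prepend)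
  finally show ?thesis by (simp only: window_prob_def)
qed

lemma word_sum_cesaro_append:
  assumes "length \<omega> < N"
  shows "word_sum 1 (\<lambda>\<iota>. cesaro N (\<omega> @ \<iota>)) = cesaro N \<omega>"
proof -
  have "word_sum 1 (\<lambda>\<iota>. cesaro N (\<omega> @ \<iota>)) = word_sum 1 (\<lambda>\<iota>. (\<Sum>k<N. window_prob (2 * N) k (\<omega> @ \<iota>)) / of_nat N)"
    using assms by (intro word_sum_cong) (simp add: cesaro_def)
  also have "\<dots> = (\<Sum>k<N. word_sum 1 (\<lambda>\<iota>. window_prob (2 * N) k (\<omega> @ \<iota>))) / of_nat N"
    by (simp only: word_sum_divide word_sum_sum)
  also have "(\<Sum>k<N. word_sum 1 (\<lambda>\<iota>. window_prob (2 * N) k (\<omega> @ \<iota>))) = (\<Sum>k<N. window_prob (2 * N) k \<omega>)"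
    using assms by (intro sum.cong refl word_sum_window_prob_append) auto
  finally show ?thesis using assms by (simp add: cesaro_def)
qed

text \<open>
Prepending a letter moves the window by one position, so that the two means differ by two boundary terms
of order \<open>1 / N\<close>.
\<close>

lemma word_sum_cesaro_prepend:
  assumes "length \<omega> < N"
  shows "word_sum 1 (\<lambda>\<iota>. cesaro N (\<iota> @ \<omega>)) + window_prob (2 * N) 0 \<omega> / of_nat N =
    cesaro N \<omega> + window_prob (2 * N) N \<omega> / of_nat N"
proof -
  have "word_sum 1 (\<lambda>\<iota>. cesaro N (\<iota> @ \<omega>)) = word_sum 1 (\<lambda>\<iota>. (\<Sum>k<N. window_prob (2 * N) k (\<iota> @ \<omega>)) / of_nat N)"
    using assms by (intro word_sum_cong) (simp add: cesaro_def)
  also have "\<dots> = (\<Sum>k<N. word_sum 1 (\<lambda>\<iota>. window_prob (2 * N) k (\<iota> @ \<omega>))) / of_nat N"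
    by (simp only: word_sum_divide word_sum_sum)
  also have "(\<Sum>k<N. word_sum 1 (\<lambda>\<iota>. window_prob (2 * N) k (\<iota> @ \<omega>))) = (\<Sum>k<N. window_prob (2 * N) (Suc k) \<omega>)"
    using assms by (intro sum.cong refl word_sum_window_prob_prepend) auto
  finally have "word_sum 1 (\<lambda>\<iota>. cesaro N (\<iota> @ \<omega>)) + window_prob (2 * N) 0 \<omega> / of_nat N =
      (window_prob (2 * N) 0 \<omega> + (\<Sum>k<N. window_prob (2 * N) (Suc k) \<omega>)) / of_nat N"
    by (simp add: divide_ennreal_def algebra_simps)
  also have "window_prob (2 * N) 0 \<omega> + (\<Sum>k<N. window_prob (2 * N) (Suc k) \<omega>) = (\<Sum>k<Suc N. window_prob (2 * N) k \<omega>)"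
    by (rule sum.lessThan_Suc_shift[symmetric])
  also have "\<dots> / of_nat N = cesaro N \<omega> + window_prob (2 * N) N \<omega> / of_nat N"
    using assms by (simp add: cesaro_def divide_ennreal_def algebra_simps)
  finally show ?thesis .
qed

text \<open>
A pointwise limit of the means along a subsequence.  The Gibbs bound dominates all of them, so the sums over
one-letter extensions converge to the right value and no mass is lost in the limit although the
alphabet is infinite.
\<close>

theorem gibbs_weights:
  obtains m :: "nat list \<Rightarrow> ennreal"
  where "m [] = 1"
    and "\<And>\<omega>. word_sum 1 (\<lambda>\<iota>. m (\<omega> @ \<iota>)) = m \<omega>"
    and "\<And>\<omega>. word_sum 1 (\<lambda>\<iota>. m (\<iota> @ \<omega>)) = m \<omega>"
    and "\<And>\<omega>. m \<omega> \<le> gibbs_bound \<omega>"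
    and "\<And>\<omega>. w \<omega> \<le> G\<^sup>2 * Z (length \<omega>) * m \<omega>"
proof -
  obtain r :: "nat \<Rightarrow> nat" and m where r: "strict_mono r" and lim: "\<And>\<omega>. (\<lambda>j. cesaro (r j) \<omega>) \<longlonglongrightarrow> m \<omega>"
    using pointwise_convergent_subsequence[of cesaro] by blast
  have large: "\<forall>\<^sub>F j in sequentially. n < r j" for n
    using filterlim_subseq[OF r] unfolding filterlim_at_top by (auto simp: Suc_le_eq dest: spec[of _ "Suc n"])
  have "m [] = 1"
  proof (rule LIMSEQ_unique[OF lim])
    show "(\<lambda>j. cesaro (r j) []) \<longlonglongrightarrow> 1"
      by (rule tendsto_eventually) (use large[of 0] in eventually_elim, rule cesaro_Nil)
  qed
  moreover have "word_sum 1 (\<lambda>\<iota>. m (\<omega> @ \<iota>)) = m \<omega>" for \<omega>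
  proof (rule LIMSEQ_unique)
    show "(\<lambda>j. word_sum 1 (\<lambda>\<iota>. cesaro (r j) (\<omega> @ \<iota>))) \<longlonglongrightarrow> word_sum 1 (\<lambda>\<iota>. m (\<omega> @ \<iota>))"
      by (rule word_sum_dominated_convergence[OF order_trans[OF cesaro_le gibbs_bound_append_le]
            dominating_sum_finite lim])
    show "(\<lambda>j. word_sum 1 (\<lambda>\<iota>. cesaro (r j) (\<omega> @ \<iota>))) \<longlonglongrightarrow> m \<omega>"
      by (rule Lim_transform_eventually[OF lim])
        (use large[of "length \<omega>"] in eventually_elim, rule word_sum_cesaro_append[symmetric])
  qed
  moreover have "word_sum 1 (\<lambda>\<iota>. m (\<iota> @ \<omega>)) = m \<omega>" for \<omega>
  proof -
    have inv: "(\<lambda>j. gibbs_bound \<omega> / of_nat (r j)) \<longlonglongrightarrow> 0"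
    proof -
      have "(\<lambda>j. ennreal (enn2real (gibbs_bound \<omega>) / real (r j))) \<longlonglongrightarrow> ennreal 0"
        by (intro tendsto_ennrealI LIMSEQ_subseq_LIMSEQ[OF lim_const_over_n r, unfolded comp_def])
      moreover have "\<forall>\<^sub>F j in sequentially. ennreal (enn2real (gibbs_bound \<omega>) / real (r j)) =
          gibbs_bound \<omega> / of_nat (r j)"
        using large[of 0]
      proof eventually_elim
        case (elim j)
        then show ?case
          using gibbs_bound_finite[of \<omega>]
          by (simp add: divide_ennreal[symmetric] ennreal_of_nat_eq_real_of_nat)
      qed
      ultimately show ?thesis by (auto intro: Lim_transform_eventually)
    qed
    have q0: "(\<lambda>j. window_prob (2 * r j) (k j) \<omega> / of_nat (r j)) \<longlonglongrightarrow> 0" if "\<And>j. k j \<le> r j" for k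
    proof (rule tendsto_sandwich[OF _ _ tendsto_const inv])
      show "\<forall>\<^sub>F j in sequentially. window_prob (2 * r j) (k j) \<omega> / of_nat (r j) \<le> gibbs_bound \<omega> / of_nat (r j)"
        using large[of "length \<omega>"]
        by eventually_elim (use that in \<open>auto intro!: divide_right_mono_ennreal window_prob_le add_mono simp: mult_2\<close>)
    qed simp
    have "(\<lambda>j. word_sum 1 (\<lambda>\<iota>. cesaro (r j) (\<iota> @ \<omega>))) \<longlonglongrightarrow> word_sum 1 (\<lambda>\<iota>. m (\<iota> @ \<omega>))"
      by (rule word_sum_dominated_convergence[OF order_trans[OF cesaro_le gibbs_bound_prepend_le]
            dominating_sum_finite lim])
    then have 1: "(\<lambda>j. word_sum 1 (\<lambda>\<iota>. cesaro (r j) (\<iota> @ \<omega>)) + window_prob (2 * r j) 0 \<omega> / of_nat (r j))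
        \<longlonglongrightarrow> word_sum 1 (\<lambda>\<iota>. m (\<iota> @ \<omega>)) + 0"
      by (intro tendsto_add q0) auto
    have "(\<lambda>j. cesaro (r j) \<omega> + window_prob (2 * r j) (r j) \<omega> / of_nat (r j)) \<longlonglongrightarrow> m \<omega> + 0"
      by (intro tendsto_add q0 lim) auto
    then have 2: "(\<lambda>j. word_sum 1 (\<lambda>\<iota>. cesaro (r j) (\<iota> @ \<omega>)) + window_prob (2 * r j) 0 \<omega> / of_nat (r j))
        \<longlonglongrightarrow> m \<omega> + 0"
      by (rule Lim_transform_eventually)
        (use large[of "length \<omega>"] in eventually_elim, rule word_sum_cesaro_prepend[symmetric])
    show ?thesis using LIMSEQ_unique[OF 1 2] by simp
  qed
  moreover have "m \<omega> \<le> gibbs_bound \<omega>" for \<omega>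
    by (rule LIMSEQ_le_const2[OF lim]) (use cesaro_le in blast)
  moreover have "w \<omega> \<le> G\<^sup>2 * Z (length \<omega>) * m \<omega>" for \<omega>
  proof (rule tendsto_lowerbound)
    show "(\<lambda>j. G\<^sup>2 * Z (length \<omega>) * cesaro (r j) \<omega>) \<longlonglongrightarrow> G\<^sup>2 * Z (length \<omega>) * m \<omega>"
      by (intro ennreal_tendsto_cmult lim)
         (simp add: ennreal_mult_less_top power_less_top_ennreal)
    show "\<forall>\<^sub>F j in sequentially. w \<omega> \<le> G\<^sup>2 * Z (length \<omega>) * cesaro (r j) \<omega>"
      using large[of "length \<omega>"] by eventually_elim (rule le_cesaro, auto)
  qed simp
  ultimately show ?thesis using that by blast
qed

end

section \<open>Invariant measures from cylinder weights\<close>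

lemma word_sum_consistent:
  assumes "\<And>\<omega>. word_sum 1 (\<lambda>\<iota>. m (\<omega> @ \<iota>)) = m \<omega>"
  shows "word_sum n (\<lambda>\<beta>. m (\<omega> @ \<beta>)) = m \<omega>"
proof (induction n arbitrary: \<omega>)
  case (Suc n)
  have "word_sum (1 + n) (\<lambda>\<beta>. m (\<omega> @ \<beta>)) = word_sum 1 (\<lambda>\<iota>. word_sum n (\<lambda>\<beta>. m ((\<omega> @ \<iota>) @ \<beta>)))"
    unfolding word_sum_add by simp
  also have "\<dots> = m \<omega>" by (simp only: Suc assms)
  finally show ?case by simp
qed (simp add: word_sum_0)

lemma distr_take_density:
  assumes "\<And>\<omega>. word_sum 1 (\<lambda>\<iota>. m (\<omega> @ \<iota>)) = m \<omega>"
  shows "distr (density (count_space (words (n + k))) m) (count_space (words n)) (take n) =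
    density (count_space (words n)) m"
proof (rule measure_eqI_countable[where A="words n"])
  fix a assume a: "a \<in> words n"
  have t: "take n \<in> count_space (words (n + k)) \<rightarrow>\<^sub>M count_space (words n)" by (auto simp: words_def)
  have "emeasure (distr (density (count_space (words (n + k))) m) (count_space (words n)) (take n)) {a} =
      (\<integral>\<^sup>+\<omega>. m \<omega> * indicator (take n -` {a} \<inter> words (n + k)) \<omega> \<partial>count_space (words (n + k)))"
    using a t by (subst emeasure_distr) (auto simp: emeasure_density)
  also have "\<dots> = word_sum (n + k) (\<lambda>\<omega>. m \<omega> * indicator {a} (take n \<omega>))"
    unfolding word_sum_def by (intro nn_integral_cong) (auto split: split_indicator)
  also have "\<dots> = word_sum n (\<lambda>\<alpha>. word_sum k (\<lambda>\<beta>. m (\<alpha> @ \<beta>) * indicator {a} \<alpha>))"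
    unfolding word_sum_add by (intro word_sum_cong) simp
  also have "\<dots> = word_sum n (\<lambda>\<alpha>. m \<alpha> * indicator {a} \<alpha>)"
    by (simp add: word_sum_multc word_sum_consistent[of m, OF assms])
  also have "\<dots> = emeasure (density (count_space (words n)) m) {a}"
    using a by (simp add: emeasure_density word_sum_def)
  finally show "emeasure (distr (density (count_space (words (n + k))) m) (count_space (words n)) (take n)) {a} =
      emeasure (density (count_space (words n)) m) {a}" .
qed auto

text \<open>
Kolmogorov's extension theorem.  The marginal on a finite set \<open>J\<close> of coordinates is read off from the
distribution of the first \<open>bound J\<close> letters; consistency of \<open>m\<close> says that a longer block gives the
same marginal.
\<close>

theorem measure_of_cylinder_weights:
  fixes m :: "nat list \<Rightarrow> ennreal"
  assumes m_Nil: "m [] = 1"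
    and cons: "\<And>\<omega>. word_sum 1 (\<lambda>\<iota>. m (\<omega> @ \<iota>)) = m \<omega>"
  obtains \<mu> where "sets \<mu> = sets borel" "prob_space \<mu>" "\<And>\<omega>. emeasure \<mu> (cylinder \<omega>) = m \<omega>"
proof -
  define D where "D n = density (count_space (words n)) m" for n
  define bound where "bound J = Max (insert 0 (Suc ` J))" for J :: "nat set"
  define proj :: "nat set \<Rightarrow> nat list \<Rightarrow> nat \<Rightarrow> real" where
    "proj J \<omega> = (\<lambda>i\<in>J. real (\<omega> ! i))" for J \<omega>
  define P where "P J = distr (D (bound J)) (PiM J (\<lambda>_. borel)) (proj J)" for J
  have proj_meas: "proj J \<in> D n \<rightarrow>\<^sub>M PiM J (\<lambda>_. borel)" for J n
    by (auto simp: D_def proj_def space_PiM measurable_def)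
  have prob_D: "prob_space (D n)" for n
  proof
    have "emeasure (D n) (space (D n)) = word_sum n (\<lambda>\<beta>. m ([] @ \<beta>))"
      by (auto simp: D_def emeasure_density word_sum_def intro!: nn_integral_cong)
    also have "\<dots> = 1" by (simp only: word_sum_consistent[of m, OF cons] m_Nil)
    finally show "emeasure (D n) (space (D n)) = 1" .
  qed
  have bound: "i < bound J" if "finite J" "i \<in> J" for i J
    using that by (auto simp: bound_def Max_gr_iff)
  have P_eq: "P J = distr (D n) (PiM J (\<lambda>_. borel)) (proj J)" if "finite J" "bound J \<le> n" for J n
  proof -
    obtain k where n: "n = bound J + k" using \<open>bound J \<le> n\<close> le_Suc_ex by blast
    have t: "take (bound J) \<in> D n \<rightarrow>\<^sub>M count_space (words (bound J))"
      unfolding n D_def by (auto simp: words_def)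
    have "D (bound J) = distr (D n) (count_space (words (bound J))) (take (bound J))"
      unfolding n D_def by (rule distr_take_density[OF cons, symmetric])
    moreover have "proj J \<in> count_space (words (bound J)) \<rightarrow>\<^sub>M PiM J (\<lambda>_. borel)"
      by (auto simp: proj_def space_PiM measurable_def)
    moreover have "proj J \<circ> take (bound J) = proj J"
      using bound[OF \<open>finite J\<close>] by (auto simp: proj_def fun_eq_iff)
    ultimately show ?thesis
      unfolding P_def using t by (simp add: distr_distr)
  qed
  interpret polish_projective UNIV P
  proof (intro polish_projective.intro projective_family.intro)
    fix J H :: "nat set" assume JH: "J \<subseteq> H" "finite H" 
    then have J: "finite J" by (rule finite_subset)
    have "bound J \<le> bound H" unfolding bound_def using JH by (intro Max_mono) auto
    from P_eq[OF J this] have "P J = distr (D (bound H)) (PiM J (\<lambda>_. borel)) (proj J)" .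
    also have "proj J = (\<lambda>f. restrict f J) \<circ> proj H"
      using JH by (auto simp: proj_def fun_eq_iff)
    also have "distr (D (bound H)) (PiM J (\<lambda>_. borel)) ((\<lambda>f. restrict f J) \<circ> proj H) =
        distr (P H) (PiM J (\<lambda>_. borel)) (\<lambda>f. restrict f J)"
      unfolding P_def using JH
      by (intro distr_distr[symmetric] measurable_restrict_subset proj_meas)
    finally show "P J = distr (P H) (PiM J (\<lambda>_. borel)) (\<lambda>f. restrict f J)" .
  next
    fix J :: "nat set" assume "finite J"
    show "prob_space (P J)"
      unfolding P_def by (intro prob_space.prob_space_distr prob_D proj_meas)
  qed
  have sets_lim_borel [measurable_cong]: "sets lim = sets borel"
    using sets_lim sets_PiM_equal_borel by simp
  define \<mu> where "\<mu> = distr lim borel floor_seq"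
  have "sets \<mu> = sets borel" by (simp add: \<mu>_def)
  moreover have "prob_space \<mu>" unfolding \<mu>_def
    by (rule P.prob_space_distr) measurable
  moreover have "emeasure \<mu> (cylinder \<omega>) = m \<omega>" for \<omega>
  proof -
    let ?n = "length \<omega>" let ?J = "{..<?n}"
    let ?X = "Pi\<^sub>E ?J (\<lambda>i. {r::real. nat \<lfloor>r\<rfloor> = \<omega> ! i})"
    have X: "?X \<in> sets (PiM ?J (\<lambda>_. borel))"
      by (rule sets_PiM_I_finite) measurable
    have "emeasure \<mu> (cylinder \<omega>) = emeasure lim (floor_seq -` cylinder \<omega> \<inter> space lim)"
      unfolding \<mu>_def by (subst emeasure_distr) auto
    also have "floor_seq -` cylinder \<omega> \<inter> space lim = emb UNIV ?J ?X"
    proof (intro set_eqI)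
      fix y :: "nat \<Rightarrow> real"
      have "y \<in> emb UNIV ?J ?X \<longleftrightarrow> (\<forall>i<?n. nat \<lfloor>y i\<rfloor> = \<omega> ! i)"
        unfolding prod_emb_def space_PiM by (simp add: PiE_iff Ball_def)
      moreover have "floor_seq y \<in> cylinder \<omega> \<longleftrightarrow> (\<forall>i<?n. nat \<lfloor>y i\<rfloor> = \<omega> ! i)"
        unfolding mem_cylinder_iff list_eq_iff_nth_eq by (simp add: floor_seq_def)
      moreover have "y \<in> space lim" by (simp add: space_PiM)
      ultimately show "y \<in> floor_seq -` cylinder \<omega> \<inter> space lim \<longleftrightarrow> y \<in> emb UNIV ?J ?X" by simp
    qed
    also have "emeasure lim (emb UNIV ?J ?X) = emeasure (P ?J) ?X"
      by (rule emeasure_lim_emb[OF _ _ X]) auto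
    also have "P ?J = distr (D ?n) (PiM ?J (\<lambda>_. borel)) (proj ?J)"
      by (rule P_eq) (auto simp: bound_def)
    also have "emeasure \<dots> ?X = emeasure (D ?n) (proj ?J -` ?X \<inter> space (D ?n))"
      by (rule emeasure_distr[OF proj_meas X])
    also have "proj ?J -` ?X \<inter> space (D ?n) = {\<omega>}"
    proof (intro set_eqI)
      fix \<tau>
      have "proj ?J \<tau> \<in> ?X \<longleftrightarrow> (\<forall>i<?n. \<tau> ! i = \<omega> ! i)"
        unfolding PiE_iff proj_def by (simp add: Ball_def)
      then show "\<tau> \<in> proj ?J -` ?X \<inter> space (D ?n) \<longleftrightarrow> \<tau> \<in> {\<omega>}"
        by (auto simp: D_def words_def intro!: nth_equalityI)
    qed
    also have "emeasure (D ?n) {\<omega>} = m \<omega>"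
      by (simp add: D_def emeasure_density words_def nn_integral_count_space_indicator)
    finally show ?thesis .
  qed
  ultimately show ?thesis using that by blast
qed

lemma mem_cylinder_append_iff: "x \<in> cylinder (\<alpha> @ \<omega>) \<longleftrightarrow> x \<in> cylinder \<alpha> \<and> suffix (length \<alpha>) x \<in> cylinder \<omega>"
proof -
  have "prefix (length \<alpha> + length \<omega>) x = prefix (length \<alpha>) x @ prefix (length \<omega>) (suffix (length \<alpha>) x)"
    by (simp add: subsequence_append)
  then show ?thesis by (simp add: mem_cylinder_iff)
qed

lemma mem_cylinder_words: "\<alpha> \<in> words k \<Longrightarrow> x \<in> cylinder \<alpha> \<longleftrightarrow> \<alpha> = prefix k x"
  by (auto simp: mem_cylinder_iff words_def)

lemma emeasure_suffix_vimage_cylinder: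
  assumes "sets \<mu> = sets borel"
  shows "emeasure \<mu> (suffix k -` cylinder \<omega>) = word_sum k (\<lambda>\<alpha>. emeasure \<mu> (cylinder (\<alpha> @ \<omega>)))"
proof -
  have *: "x \<in> cylinder (\<alpha> @ \<omega>) \<longleftrightarrow> \<alpha> = prefix k x \<and> suffix k x \<in> cylinder \<omega>" if "\<alpha> \<in> words k" for x \<alpha>
    using that mem_cylinder_words[OF that] by (auto simp: mem_cylinder_append_iff words_def)
  have "prefix k x \<in> words k" for x :: "nat \<Rightarrow> nat" by (simp add: words_def)
  then have "suffix k -` cylinder \<omega> = (\<Union>\<alpha>\<in>words k. cylinder (\<alpha> @ \<omega>))"
    using * by blast
  also have "emeasure \<mu> \<dots> = (\<integral>\<^sup>+\<alpha>. emeasure \<mu> (cylinder (\<alpha> @ \<omega>)) \<partial>count_space (words k))"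
  proof (rule emeasure_UN_countable)
    show "disjoint_family_on (\<lambda>\<alpha>. cylinder (\<alpha> @ \<omega>)) (words k)"
      unfolding disjoint_family_on_def by (auto simp: *)
  qed (auto simp: assms)
  finally show ?thesis by (simp add: word_sum_def)
qed

lemma shift_measurable [measurable]: "shift \<in> borel_measurable borel"
  unfolding shift_def by measurable

lemma invariant_measuresI:
  assumes "sets \<mu> = sets borel" "prob_space \<mu>"
    and "\<And>\<omega>. word_sum 1 (\<lambda>\<iota>. emeasure \<mu> (cylinder (\<iota> @ \<omega>))) = emeasure \<mu> (cylinder \<omega>)"
  shows "\<mu> \<in> invariant_measures"
proof -
  have [measurable_cong]: "sets \<mu> = sets borel" by fact
  have sp: "space \<mu> = UNIV" using sets_eq_imp_space_eq[OF assms(1)] by simp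
  interpret prob_space \<mu> by fact
  have shift: "shift \<in> borel_measurable \<mu>" by measurable
  interpret D: prob_space "distr \<mu> borel shift" by (rule prob_space_distr[OF shift])
  have "distr \<mu> borel shift = \<mu>"
  proof (rule measure_eqI_cylinder)
    fix \<omega>
    have "emeasure (distr \<mu> borel shift) (cylinder \<omega>) = emeasure \<mu> (suffix 1 -` cylinder \<omega>)"
      by (subst emeasure_distr[OF shift]) (simp_all add: sp shift_def)
    then show "emeasure (distr \<mu> borel shift) (cylinder \<omega>) = emeasure \<mu> (cylinder \<omega>)"
      by (simp only: emeasure_suffix_vimage_cylinder assms(1,3))
  qed (auto simp: assms(1) finite_measure_axioms D.finite_measure_axioms)
  then show ?thesis by (simp add: invariant_measures_def assms)
qed

lemma distr_suffix_invariant: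
  assumes "\<mu> \<in> invariant_measures"
  shows "distr \<mu> borel (suffix k) = \<mu>"
proof (induction k)
  case 0
  have "suffix 0 = (\<lambda>x::nat \<Rightarrow> nat. x)" by (simp add: fun_eq_iff)
  then show ?case using assms by (simp add: invariant_measures_def distr_id2)
next
  case (Suc k)
  have s [measurable_cong]: "sets \<mu> = sets borel" using assms by (simp add: invariant_measures_def)
  have "distr \<mu> borel (suffix (Suc k)) = distr \<mu> borel (suffix k \<circ> shift)"
    by (simp add: shift_def comp_def)
  also have "\<dots> = distr (distr \<mu> borel shift) borel (suffix k)"
    by (rule distr_distr[symmetric]) measurable
  also have "distr \<mu> borel shift = \<mu>" using assms by (simp add: invariant_measures_def)
  finally show ?case using Suc by simp
qed

section \<open>Ergodicity and absolute continuity\<close>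

lemma invariant_measuresD:
  assumes "\<mu> \<in> invariant_measures"
  shows "sets \<mu> = sets borel" "prob_space \<mu>" "distr \<mu> borel shift = \<mu>" "space \<mu> = UNIV"
  using assms sets_eq_imp_space_eq[of \<mu> borel] by (auto simp: invariant_measures_def)

lemma emeasure_suffix_vimage:
  assumes "\<mu> \<in> invariant_measures" "A \<in> sets borel"
  shows "emeasure \<mu> (suffix k -` A) = emeasure \<mu> A"
proof -
  note [measurable_cong] = invariant_measuresD(1)[OF assms(1)]
  have "emeasure \<mu> A = emeasure (distr \<mu> borel (suffix k)) A" by (simp only: distr_suffix_invariant[OF assms(1)])
  also have "\<dots> = emeasure \<mu> (suffix k -` A)"
    using assms by (subst emeasure_distr) (auto simp: invariant_measuresD)
  finally show ?thesis by simp
qed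

lemma AE_suffix_imp:
  assumes \<mu>: "\<mu> \<in> invariant_measures" and A: "A \<in> sets borel"
    and AE: "AE x in \<mu>. shift x \<in> A \<longrightarrow> x \<in> A"
  shows "AE x in \<mu>. suffix n x \<in> A \<longrightarrow> x \<in> A"
proof (induction n)
  case (Suc n)
  note [measurable_cong] = invariant_measuresD(1)[OF \<mu>]
  note A[measurable]
  have "AE x in distr \<mu> borel (suffix n). shift x \<in> A \<longrightarrow> x \<in> A"
    by (subst distr_suffix_invariant[OF \<mu>]) (rule AE)
  then have "AE x in \<mu>. shift (suffix n x) \<in> A \<longrightarrow> suffix n x \<in> A"
    by (rule AE_distrD[rotated]) measurable
  moreover have "shift (suffix n x) = suffix (Suc n) x" for x by (simp add: shift_def)
  ultimately have "AE x in \<mu>. suffix (Suc n) x \<in> A \<longrightarrow> suffix n x \<in> A" by (simp only:)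
  with Suc show ?case by eventually_elim blast
qed simp

text \<open>
For fixed \<open>\<omega>\<close> both sides are finite measures as functions of \<open>A\<close>, so it suffices to compare them on
cylinders.  The sum over \<open>\<Gamma>\<close> on the right is realised as the mixture \<open>S\<close> of the kernel \<open>N\<close>.
\<close>

lemma word_mixing_imp_mixing:
  fixes K :: ennreal
  assumes \<mu>: "\<mu> \<in> invariant_measures" and \<Gamma>: "finite \<Gamma>" "\<Gamma> \<noteq> {}" and K: "K < top"
    and mix: "\<And>\<omega> \<tau>. emeasure \<mu> (cylinder \<omega>) * emeasure \<mu> (cylinder \<tau>) \<le>
      K * (\<Sum>\<kappa>\<in>\<Gamma>. emeasure \<mu> (cylinder (\<omega> @ \<kappa> @ \<tau>)))"
    and A: "A \<in> sets borel"
  shows "emeasure \<mu> (cylinder \<omega>) * emeasure \<mu> A \<le>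
    K * (\<Sum>\<kappa>\<in>\<Gamma>. emeasure \<mu> (cylinder \<omega> \<inter> suffix (length \<omega> + length \<kappa>) -` A))"
proof -
  note [measurable_cong] = invariant_measuresD(1)[OF \<mu>] and [simp] = invariant_measuresD(1,4)[OF \<mu>]
  interpret prob_space \<mu> by (rule invariant_measuresD[OF \<mu>])
  define N where "N \<kappa> = distr (density \<mu> (indicator (cylinder \<omega>))) borel (suffix (length \<omega> + length \<kappa>))" for \<kappa> :: "nat list"
  have N: "emeasure (N \<kappa>) B = emeasure \<mu> (cylinder \<omega> \<inter> suffix (length \<omega> + length \<kappa>) -` B)"
    if [measurable]: "B \<in> sets borel" for B \<kappa>
  proof -
    have m: "suffix (length \<omega> + length \<kappa>) -` B \<in> sets borel"
      using measurable_sets[OF suffix_measurable that] by simp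
    have "emeasure (N \<kappa>) B = emeasure (density \<mu> (indicator (cylinder \<omega>))) (suffix (length \<omega> + length \<kappa>) -` B)"
      unfolding N_def by (subst emeasure_distr) auto
    also have "\<dots> = (\<integral>\<^sup>+x. indicator (cylinder \<omega>) x * indicator (suffix (length \<omega> + length \<kappa>) -` B) x \<partial>\<mu>)"
      using m by (intro emeasure_density) auto
    also have "\<dots> = (\<integral>\<^sup>+x. indicator (cylinder \<omega> \<inter> suffix (length \<omega> + length \<kappa>) -` B) x \<partial>\<mu>)"
      by (intro nn_integral_cong) (auto split: split_indicator)
    also have "\<dots> = emeasure \<mu> (cylinder \<omega> \<inter> suffix (length \<omega> + length \<kappa>) -` B)"
      using m by (intro nn_integral_indicator) auto
    finally show ?thesis .
  qed
  have sub: "subprob_space (N \<kappa>)" for \<kappa>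
    by (rule subprob_spaceI) (use N[of UNIV \<kappa>] emeasure_le_1 in \<open>auto simp: N_def\<close>)
  have kernel: "N \<in> count_space \<Gamma> \<rightarrow>\<^sub>M subprob_algebra borel"
    using sub by (auto simp: space_subprob_algebra N_def)
  define S where "S = count_space \<Gamma> \<bind> N"
  have S: "emeasure S B = (\<Sum>\<kappa>\<in>\<Gamma>. emeasure (N \<kappa>) B)" if "B \<in> sets borel" for B
    unfolding S_def using \<Gamma> that
    by (subst emeasure_bind[OF _ kernel]) (simp_all add: nn_integral_count_space_finite)
  have sets_S: "sets S = sets borel"
    unfolding S_def using \<Gamma> by (subst sets_bind[where N=borel]) (auto simp: N_def)
  have "emeasure (scale_measure (emeasure \<mu> (cylinder \<omega>)) \<mu>) A \<le> emeasure (scale_measure K S) A"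
  proof (rule cylinder_le_imp_le)
    have "emeasure S (space S) < top"
      using S[of UNIV] sets_eq_imp_space_eq[OF sets_S] N
      by (simp add: ennreal_mult_eq_top_iff less_top[symmetric])
    then show "emeasure (scale_measure K S) (space (scale_measure K S)) \<noteq> \<infinity>"
      using K by (auto simp: space_scale_measure ennreal_mult_eq_top_iff)
    fix \<tau>
    have eq: "cylinder (\<omega> @ \<kappa> @ \<tau>) = cylinder (\<omega> @ \<kappa>) \<inter> suffix (length \<omega> + length \<kappa>) -` cylinder \<tau>" for \<kappa>
      using mem_cylinder_append_iff[of _ "\<omega> @ \<kappa>" \<tau>] by auto
    have "K * (\<Sum>\<kappa>\<in>\<Gamma>. emeasure \<mu> (cylinder (\<omega> @ \<kappa> @ \<tau>))) \<le> K * (\<Sum>\<kappa>\<in>\<Gamma>. emeasure (N \<kappa>) (cylinder \<tau>))"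
    proof (intro mult_left_mono sum_mono)
      fix \<kappa>
      have "cylinder (\<omega> @ \<kappa> @ \<tau>) \<subseteq> cylinder \<omega> \<inter> suffix (length \<omega> + length \<kappa>) -` cylinder \<tau>"
        unfolding eq by (auto simp: mem_cylinder_append_iff)
      moreover have "suffix (length \<omega> + length \<kappa>) -` cylinder \<tau> \<in> sets borel"
        using measurable_sets[OF suffix_measurable borel_cylinder] by simp
      ultimately show "emeasure \<mu> (cylinder (\<omega> @ \<kappa> @ \<tau>)) \<le> emeasure (N \<kappa>) (cylinder \<tau>)"
        by (simp add: N emeasure_mono)
    qed simp
    with mix[of \<omega> \<tau>] show "emeasure (scale_measure (emeasure \<mu> (cylinder \<omega>)) \<mu>) (cylinder \<tau>) \<le>
        emeasure (scale_measure K S) (cylinder \<tau>)"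
      by (simp add: S)
  qed (simp_all add: sets_S A)
  then show ?thesis using A by (simp add: S N)
qed

text \<open>
If \<open>A\<close> contains its preimage modulo null sets, the mixing inequality gives
\<open>\<mu> [\<omega>] * \<mu> A \<le> K * card \<Gamma> * \<mu> (A \<inter> [\<omega>])\<close>.  This extends from cylinders to all Borel sets in place
of \<open>[\<omega>]\<close>, in particular to the complement of \<open>A\<close>.
\<close>

lemma word_mixing_imp_zero_one:
  fixes K :: ennreal
  assumes \<mu>: "\<mu> \<in> invariant_measures" and \<Gamma>: "finite \<Gamma>" "\<Gamma> \<noteq> {}" and K: "K < top"
    and mix: "\<And>\<omega> \<tau>. emeasure \<mu> (cylinder \<omega>) * emeasure \<mu> (cylinder \<tau>) \<le>
      K * (\<Sum>\<kappa>\<in>\<Gamma>. emeasure \<mu> (cylinder (\<omega> @ \<kappa> @ \<tau>)))"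
    and A: "A \<in> sets borel" and AE: "AE x in \<mu>. shift x \<in> A \<longrightarrow> x \<in> A"
  shows "emeasure \<mu> A = 0 \<or> emeasure \<mu> (- A) = 0"
proof -
  note [measurable_cong] = invariant_measuresD(1)[OF \<mu>] and [simp] = invariant_measuresD(1,4)[OF \<mu>]
  interpret prob_space \<mu> by (rule invariant_measuresD[OF \<mu>])
  have dens: "emeasure (density \<mu> (indicator A)) B = emeasure \<mu> (A \<inter> B)" if "B \<in> sets borel" for B
    using A that by (intro emeasure_restricted) auto
  have "emeasure (scale_measure (emeasure \<mu> A) \<mu>) (- A) \<le>
      emeasure (scale_measure (K * of_nat (card \<Gamma>)) (density \<mu> (indicator A))) (- A)"
  proof (rule cylinder_le_imp_le)
    have "emeasure (density \<mu> (indicator A)) (space (density \<mu> (indicator A))) \<le> 1"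
      using dens[of UNIV] emeasure_le_1 by simp
    then have "emeasure (density \<mu> (indicator A)) (space (density \<mu> (indicator A))) < top"
      using le_less_trans by fastforce
    then show "emeasure (scale_measure (K * of_nat (card \<Gamma>)) (density \<mu> (indicator A)))
        (space (scale_measure (K * of_nat (card \<Gamma>)) (density \<mu> (indicator A)))) \<noteq> \<infinity>"
      using K by (simp add: space_scale_measure ennreal_mult_eq_top_iff)
    fix \<omega>
    have "emeasure \<mu> (cylinder \<omega> \<inter> suffix n -` A) \<le> emeasure \<mu> (A \<inter> cylinder \<omega>)" for n
    proof (rule emeasure_mono_AE)
      show "AE x in \<mu>. x \<in> cylinder \<omega> \<inter> suffix n -` A \<longrightarrow> x \<in> A \<inter> cylinder \<omega>"
        using AE_suffix_imp[OF \<mu> A AE, of n] by eventually_elim auto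
    qed (use A in auto)
    then have "K * (\<Sum>\<kappa>\<in>\<Gamma>. emeasure \<mu> (cylinder \<omega> \<inter> suffix (length \<omega> + length \<kappa>) -` A)) \<le>
        K * (\<Sum>\<kappa>\<in>\<Gamma>. emeasure \<mu> (A \<inter> cylinder \<omega>))"
      by (intro mult_left_mono sum_mono) auto
    with word_mixing_imp_mixing[OF \<mu> \<Gamma> K mix A, of \<omega>]
    show "emeasure (scale_measure (emeasure \<mu> A) \<mu>) (cylinder \<omega>) \<le>
        emeasure (scale_measure (K * of_nat (card \<Gamma>)) (density \<mu> (indicator A))) (cylinder \<omega>)"
      by (simp add: dens mult.commute[of "emeasure \<mu> A"] mult.assoc)
  qed (use A in auto)
  also have "\<dots> = 0" using A dens[of "- A"] by simp
  finally show ?thesis by simp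
qed

text \<open>
Let \<open>f\<close> be the density of \<open>\<nu>\<close> and \<open>D = {f > 1}\<close>.  By invariance, \<open>D\<close> minus its preimage and the
preimage minus \<open>D\<close> have equal measure, both for \<open>\<mu>\<close> and for \<open>\<nu>\<close>.  But \<open>\<nu>\<close> exceeds \<open>\<mu>\<close> on the first
set and does not on the second, so both are \<open>\<mu>\<close>-null and \<open>D\<close> is trivial.  It cannot have
full measure since \<open>\<nu>\<close> has total mass 1; hence \<open>f \<le> 1\<close> almost everywhere and \<open>\<nu> \<le> \<mu>\<close>.
\<close>

lemma abs_cont_invariant_unique:
  assumes \<mu>: "\<mu> \<in> invariant_measures" and \<nu>: "\<nu> \<in> invariant_measures"
    and ac: "\<And>A. A \<in> sets borel \<Longrightarrow> emeasure \<mu> A = 0 \<Longrightarrow> emeasure \<nu> A = 0"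
    and zero_one: "\<And>A. A \<in> sets borel \<Longrightarrow> AE x in \<mu>. shift x \<in> A \<longrightarrow> x \<in> A \<Longrightarrow>
      emeasure \<mu> A = 0 \<or> emeasure \<mu> (- A) = 0"
  shows "\<nu> = \<mu>"
proof -
  note [measurable_cong] = invariant_measuresD(1)[OF \<mu>] invariant_measuresD(1)[OF \<nu>]
    and [simp] = invariant_measuresD(1,4)[OF \<mu>] invariant_measuresD(1,4)[OF \<nu>]
  interpret M: prob_space \<mu> by (rule invariant_measuresD[OF \<mu>])
  interpret N: prob_space \<nu> by (rule invariant_measuresD[OF \<nu>])
  define f where "f = RN_deriv \<mu> \<nu>"
  have f [measurable]: "f \<in> borel_measurable \<mu>" unfolding f_def by simp
  have "absolutely_continuous \<mu> \<nu>"
    using ac by (auto simp: absolutely_continuous_def null_sets_def)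
  then have "density \<mu> f = \<nu>" unfolding f_def by (intro M.density_RN_deriv) simp_all
  then have \<nu>_eq: "emeasure \<nu> A = (\<integral>\<^sup>+x. f x * indicator A x \<partial>\<mu>)" if "A \<in> sets borel" for A
    using emeasure_density[OF f, of A] that by simp
  \<comment> \<open>Where the density exceeds 1, \<open>\<nu> F\<close> is larger than \<open>\<mu> F\<close> unless \<open>F\<close> is null.\<close>
  have null: "emeasure \<mu> F = 0"
    if F [measurable]: "F \<in> sets borel" and gt: "\<And>x. x \<in> F \<Longrightarrow> f x > 1" and le: "emeasure \<nu> F \<le> emeasure \<mu> F" for F
  proof -
    have "emeasure \<nu> F = (\<integral>\<^sup>+x. indicator F x + (f x - 1) * indicator F x \<partial>\<mu>)"
      unfolding \<nu>_eq[OF F]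
    proof (rule nn_integral_cong)
      fix x
      have "f x = 1 + (f x - 1)" if "x \<in> F"
        using gt[OF that] by (simp add: add_diff_inverse_ennreal less_imp_le)
      then show "f x * indicator F x = indicator F x + (f x - 1) * indicator F x"
        by (auto split: split_indicator)
    qed
    also have "\<dots> = emeasure \<mu> F + (\<integral>\<^sup>+x. (f x - 1) * indicator F x \<partial>\<mu>)"
      by (subst nn_integral_add) auto
    finally have "emeasure \<mu> F + (\<integral>\<^sup>+x. (f x - 1) * indicator F x \<partial>\<mu>) \<le> emeasure \<mu> F + 0"
      using le by simp
    then have "(\<integral>\<^sup>+x. (f x - 1) * indicator F x \<partial>\<mu>) = 0"
      by (subst (asm) ennreal_add_left_cancel_le) auto
    then have "AE x in \<mu>. (f x - 1) * indicator F x = 0"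
      by (subst (asm) nn_integral_0_iff_AE) auto
    then have "AE x in \<mu>. x \<notin> F"
    proof eventually_elim
      case (elim x)
      show ?case
      proof
        assume "x \<in> F"
        with elim have "f x - 1 = 0" by simp
        with gt[OF \<open>x \<in> F\<close>] show False by (auto simp: diff_eq_0_iff_ennreal)
      qed
    qed
    then show ?thesis by (subst (asm) AE_iff_measurable[OF _ refl]) auto
  qed
  define D where "D = {x. f x > 1}"
  have D [measurable]: "D \<in> sets borel"
  proof -
    have "{x \<in> space \<mu>. f x > 1} \<in> sets \<mu>" by measurable
    then show ?thesis by (simp add: D_def)
  qed
  have D': "shift -` D \<in> sets borel" using measurable_sets[OF shift_measurable D] by simp
  have inv: "emeasure M (D - shift -` D) = emeasure M (shift -` D - D)" if M: "M \<in> invariant_measures" for M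
  proof -
    interpret prob_space M by (rule invariant_measuresD[OF M])
    have [simp]: "sets M = sets borel" by (rule invariant_measuresD[OF M])
    have "emeasure M (D - shift -` D) = emeasure M (D - (D \<inter> shift -` D))"
      by (rule arg_cong[where f="emeasure M"]) blast
    also have "\<dots> = emeasure M D - emeasure M (D \<inter> shift -` D)"
      using D D' by (intro emeasure_Diff) auto
    also have "emeasure M D = emeasure M (shift -` D)"
      using emeasure_suffix_vimage[OF M D, of 1] by (simp add: shift_def)
    also have "emeasure M (shift -` D) - emeasure M (D \<inter> shift -` D) = emeasure M (shift -` D - (D \<inter> shift -` D))"
      using D D' by (intro emeasure_Diff[symmetric]) auto
    also have "\<dots> = emeasure M (shift -` D - D)"
      by (rule arg_cong[where f="emeasure M"]) blast
    finally show ?thesis .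
  qed
  have le1: "emeasure \<nu> A \<le> emeasure \<mu> A" if [measurable]: "A \<in> sets borel" and "AE x in \<mu>. x \<in> A \<longrightarrow> f x \<le> 1" for A
  proof -
    have "emeasure \<nu> A \<le> (\<integral>\<^sup>+x. indicator A x \<partial>\<mu>)"
      unfolding \<nu>_eq[OF that(1)]
    proof (rule nn_integral_mono_AE)
      show "AE x in \<mu>. f x * indicator A x \<le> indicator A x"
        using that(2) by eventually_elim (auto split: split_indicator)
    qed
    then show ?thesis by simp
  qed
  have "emeasure \<mu> (D - shift -` D) = 0"
  proof (rule null)
    show "D - shift -` D \<in> sets borel" using D D' by auto
    have "emeasure \<nu> (shift -` D - D) \<le> emeasure \<mu> (shift -` D - D)"
      using D D' by (intro le1) (auto simp: D_def)
    then show "emeasure \<nu> (D - shift -` D) \<le> emeasure \<mu> (D - shift -` D)"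
      by (simp only: inv[OF \<mu>] inv[OF \<nu>])
  qed (simp add: D_def)
  then have "emeasure \<mu> (shift -` D - D) = 0" by (simp only: inv[OF \<mu>])
  then have "AE x in \<mu>. x \<notin> shift -` D - D"
    using D D' by (intro AE_not_in) (auto simp: null_sets_def)
  then have "AE x in \<mu>. shift x \<in> D \<longrightarrow> x \<in> D" by eventually_elim auto
  then consider "emeasure \<mu> D = 0" | "emeasure \<mu> (- D) = 0" using zero_one[OF D] by blast
  then have "emeasure \<mu> D = 0"
  proof cases
    case 2
    have "emeasure \<mu> D + emeasure \<mu> (- D) = emeasure \<mu> (D \<union> - D)"
      using D by (intro plus_emeasure) auto
    also have "D \<union> - D = space \<mu>" by simp
    finally have "emeasure \<mu> D = 1" using 2 M.emeasure_space_1 by simp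
    then show ?thesis
      by (intro null D) (use N.emeasure_le_1 in \<open>auto simp: D_def\<close>)
  qed
  then have "AE x in \<mu>. x \<notin> D"
    using D by (intro AE_not_in) (auto simp: null_sets_def)
  then have AE: "AE x in \<mu>. f x \<le> 1" by eventually_elim (simp add: D_def not_less)
  have le: "emeasure \<nu> A \<le> emeasure \<mu> A" if "A \<in> sets borel" for A
    by (rule le1[OF that]) (use AE in eventually_elim, simp)
  show ?thesis
  proof (rule measure_eqI)
    fix A assume "A \<in> sets \<nu>"
    then have A: "A \<in> sets borel" by simp
    have "measure \<nu> A \<le> measure \<mu> A" using le[OF A] by (simp add: M.emeasure_eq_measure N.emeasure_eq_measure)
    moreover have "measure \<nu> (- A) \<le> measure \<mu> (- A)"
      using le[of "- A"] A by (simp add: M.emeasure_eq_measure N.emeasure_eq_measure)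
    moreover have "measure \<nu> (- A) = 1 - measure \<nu> A" "measure \<mu> (- A) = 1 - measure \<mu> A"
      using A M.prob_compl[of A] N.prob_compl[of A] by (auto simp: Compl_eq_Diff_UNIV)
    ultimately show "emeasure \<nu> A = emeasure \<mu> A"
      by (simp add: M.emeasure_eq_measure N.emeasure_eq_measure)
  qed simp
qed

section \<open>Gibbs measures\<close>

context quasi_multiplicative_weight
begin

definition gibbs_measure :: "(nat \<Rightarrow> nat) measure \<Rightarrow> bool" where
  "gibbs_measure \<mu> \<longleftrightarrow> \<mu> \<in> invariant_measures \<and>
    (\<forall>\<omega>. emeasure \<mu> (cylinder \<omega>) \<le> gibbs_bound \<omega>) \<and>
    (\<forall>\<omega>. w \<omega> \<le> G\<^sup>2 * Z (length \<omega>) * emeasure \<mu> (cylinder \<omega>))"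

theorem ex_gibbs_measure: "\<exists>\<mu>. gibbs_measure \<mu>"
proof -
  obtain m where m: "m [] = 1" "\<And>\<omega>. word_sum 1 (\<lambda>\<iota>. m (\<omega> @ \<iota>)) = m \<omega>"
    "\<And>\<omega>. word_sum 1 (\<lambda>\<iota>. m (\<iota> @ \<omega>)) = m \<omega>" "\<And>\<omega>. m \<omega> \<le> gibbs_bound \<omega>"
    "\<And>\<omega>. w \<omega> \<le> G\<^sup>2 * Z (length \<omega>) * m \<omega>"
    by (rule gibbs_weights) blast
  obtain \<mu> where \<mu>: "sets \<mu> = sets borel" "prob_space \<mu>" "\<And>\<omega>. emeasure \<mu> (cylinder \<omega>) = m \<omega>"
    by (rule measure_of_cylinder_weights[OF m(1,2)]) blast
  have "\<mu> \<in> invariant_measures"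
    by (rule invariant_measuresI[OF \<mu>(1,2)]) (simp only: \<mu>(3) m(3))
  then show ?thesis unfolding gibbs_measure_def using m \<mu> by auto
qed

text \<open>
Quasi-multiplicativity of the weight, carried over to the measure by the Gibbs bounds; the exponent
counts the constants lost on the way.
\<close>

lemma gibbs_measure_word_mixing:
  assumes "gibbs_measure \<mu>"
  shows "emeasure \<mu> (cylinder \<omega>) * emeasure \<mu> (cylinder \<tau>) \<le>
    G ^ 7 * (\<Sum>\<kappa>\<in>\<Gamma>. emeasure \<mu> (cylinder (\<omega> @ \<kappa> @ \<tau>)))"
proof -
  let ?m = "\<lambda>\<omega>. emeasure \<mu> (cylinder \<omega>)" and ?p = "length \<omega>" and ?q = "length \<tau>"
  have up: "?m \<alpha> * Z (length \<alpha>) \<le> G\<^sup>2 * w \<alpha>" for \<alpha>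
  proof -
    have "?m \<alpha> * Z (length \<alpha>) \<le> gibbs_bound \<alpha> * Z (length \<alpha>)"
      using assms by (intro mult_right_mono) (auto simp: gibbs_measure_def)
    also have "\<dots> = G\<^sup>2 * w \<alpha>" 
      unfolding gibbs_bound_def ennreal_divide_times by simp
    finally show ?thesis .
  qed
  have one: "c * w (\<omega> @ \<kappa> @ \<tau>) \<le> G ^ 3 * ?m (\<omega> @ \<kappa> @ \<tau>) * (Z ?p * Z ?q)" if "\<kappa> \<in> \<Gamma>" for \<kappa>
  proof -
    let ?k = "length \<kappa>"
    have "Z (?p + ?k + ?q) \<le> Z (?p + ?k) * Z ?q" by (rule Z_add_le)
    also have "\<dots> \<le> Z ?p * Z ?k * Z ?q" by (intro mult_right_mono Z_add_le) simp
    finally have *: "Z (length (\<omega> @ \<kappa> @ \<tau>)) \<le> Z ?p * Z ?k * Z ?q" by (simp add: add.assoc)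
    have k: "c * Z ?k \<le> G"
      unfolding G_def using that finite_connectors by (intro mult_left_mono member_le_sum) auto
    have low: "w \<alpha> \<le> G\<^sup>2 * Z (length \<alpha>) * ?m \<alpha>" for \<alpha>
      using assms unfolding gibbs_measure_def by blast
    have "c * w (\<omega> @ \<kappa> @ \<tau>) \<le> c * (G\<^sup>2 * Z (length (\<omega> @ \<kappa> @ \<tau>)) * ?m (\<omega> @ \<kappa> @ \<tau>))"
      by (intro mult_left_mono low) simp
    also have "\<dots> \<le> c * (G\<^sup>2 * (Z ?p * Z ?k * Z ?q) * ?m (\<omega> @ \<kappa> @ \<tau>))"
      by (intro mult_left_mono mult_right_mono *) simp_all
    also have "\<dots> = (c * Z ?k) * (G\<^sup>2 * (Z ?p * Z ?q) * ?m (\<omega> @ \<kappa> @ \<tau>))" by (simp only: ac_simps)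
    also have "\<dots> \<le> G * (G\<^sup>2 * (Z ?p * Z ?q) * ?m (\<omega> @ \<kappa> @ \<tau>))"
      by (intro mult_right_mono k) simp
    also have "\<dots> = G ^ 3 * ?m (\<omega> @ \<kappa> @ \<tau>) * (Z ?p * Z ?q)"
      by (simp add: power3_eq_cube power2_eq_square ac_simps)
    finally show ?thesis .
  qed
  have "?m \<omega> * ?m \<tau> * (Z ?p * Z ?q) = (?m \<omega> * Z ?p) * (?m \<tau> * Z ?q)" by (simp add: ac_simps)
  also have "\<dots> \<le> (G\<^sup>2 * w \<omega>) * (G\<^sup>2 * w \<tau>)" by (intro mult_mono up) simp_all
  also have "\<dots> = G ^ 4 * (w \<omega> * w \<tau>)" by (simp add: power4_eq_xxxx power2_eq_square ac_simps)
  also have "\<dots> \<le> G ^ 4 * (c * (\<Sum>\<kappa>\<in>\<Gamma>. w (\<omega> @ \<kappa> @ \<tau>)))" by (intro mult_left_mono w_connect) simp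
  also have "c * (\<Sum>\<kappa>\<in>\<Gamma>. w (\<omega> @ \<kappa> @ \<tau>)) \<le> (\<Sum>\<kappa>\<in>\<Gamma>. G ^ 3 * ?m (\<omega> @ \<kappa> @ \<tau>) * (Z ?p * Z ?q))"
    unfolding sum_distrib_left by (intro sum_mono one)
  finally have "?m \<omega> * ?m \<tau> * (Z ?p * Z ?q) \<le> G ^ 4 * (\<Sum>\<kappa>\<in>\<Gamma>. G ^ 3 * ?m (\<omega> @ \<kappa> @ \<tau>) * (Z ?p * Z ?q))"
    by (simp add: mult_left_mono)
  also have "\<dots> = (G ^ 4 * G ^ 3) * (\<Sum>\<kappa>\<in>\<Gamma>. ?m (\<omega> @ \<kappa> @ \<tau>)) * (Z ?p * Z ?q)"
    by (simp only: sum_distrib_left sum_distrib_right ac_simps)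
  also have "G ^ 4 * G ^ 3 = G ^ 7" by (simp flip: power_add)
  finally have "?m \<omega> * ?m \<tau> * (Z ?p * Z ?q) / (Z ?p * Z ?q) \<le>
      G ^ 7 * (\<Sum>\<kappa>\<in>\<Gamma>. ?m (\<omega> @ \<kappa> @ \<tau>)) * (Z ?p * Z ?q) / (Z ?p * Z ?q)"
    by (rule divide_right_mono_ennreal)
  then show ?thesis
    by (simp add: ennreal_mult_divide_eq ennreal_mult_eq_top_iff)
qed

lemma connectors_nonempty: "\<Gamma> \<noteq> {}"
  using w_connect[of "[]" "[]"] by (auto simp: w_Nil)

theorem gibbs_measure_zero_one:
  assumes "gibbs_measure \<mu>" "A \<in> sets borel" "AE x in \<mu>. shift x \<in> A \<longrightarrow> x \<in> A"
  shows "emeasure \<mu> A = 0 \<or> emeasure \<mu> (- A) = 0"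
proof (rule word_mixing_imp_zero_one[OF _ finite_connectors connectors_nonempty _ gibbs_measure_word_mixing[OF assms(1)] assms(2,3)])
  show "\<mu> \<in> invariant_measures" using assms(1) by (simp add: gibbs_measure_def)
  show "G ^ 7 < top" by (simp add: power_less_top_ennreal)
qed

end

section \<open>Extended sums and integrals over words\<close>

lemma extended_sum_integrable:
  assumes "integrable (count_space A) f"
  shows "extended_sum f A = ereal (\<integral>x. f x \<partial>count_space A)"
proof -
  obtain r q where "0 \<le> r" "0 \<le> q" "(\<integral>\<^sup>+x. ennreal (f x) \<partial>count_space A) = ennreal r"
    "(\<integral>\<^sup>+x. ennreal (- f x) \<partial>count_space A) = ennreal q" "(\<integral>x. f x \<partial>count_space A) = r - q"
    using real_lebesgue_integral_def[OF assms] assms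
    by (elim integrableE) blast
  then show ?thesis by (simp add: extended_sum_def)
qed

lemma extended_sum_mono:
  assumes g: "integrable (count_space A) g" and le: "\<And>x. x \<in> A \<Longrightarrow> f x \<le> g x"
  shows "extended_sum f A \<le> ereal (\<integral>x. g x \<partial>count_space A)"
proof -
  have p: "(\<integral>\<^sup>+x. ennreal (f x) \<partial>count_space A) \<le> (\<integral>\<^sup>+x. ennreal (g x) \<partial>count_space A)"
    using le by (intro nn_integral_mono ennreal_leI) auto
  have q: "(\<integral>\<^sup>+x. ennreal (- g x) \<partial>count_space A) \<le> (\<integral>\<^sup>+x. ennreal (- f x) \<partial>count_space A)"
    using le by (intro nn_integral_mono ennreal_leI) auto
  have fin: "(\<integral>\<^sup>+x. ennreal (g x) \<partial>count_space A) \<noteq> \<infinity>" "(\<integral>\<^sup>+x. ennreal (f x) \<partial>count_space A) \<noteq> \<infinity>"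
    using g p by (auto simp: real_integrable_def top_unique)
  have "extended_sum f A \<le> extended_sum g A"
    using p q fin by (auto simp: extended_sum_def Let_def simp flip: less_eq_ennreal.rep_eq intro!: ereal_minus_mono)
  then show ?thesis by (simp add: extended_sum_integrable[OF g])
qed

text \<open>
A majorant excludes an infinite positive part, and a real lower bound then excludes an infinite negative
part.
\<close>

lemma extended_sum_lower_bound:
  assumes g: "integrable (count_space A) g" and le: "\<And>x. x \<in> A \<Longrightarrow> f x \<le> g x"
    and r: "ereal r \<le> extended_sum f A"
  shows "integrable (count_space A) f" "r \<le> (\<integral>x. f x \<partial>count_space A)"
proof -
  have p: "(\<integral>\<^sup>+x. ennreal (f x) \<partial>count_space A) \<le> (\<integral>\<^sup>+x. ennreal (g x) \<partial>count_space A)"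
    using le by (intro nn_integral_mono ennreal_leI) auto
  have fin: "(\<integral>\<^sup>+x. ennreal (f x) \<partial>count_space A) \<noteq> \<infinity>"
    using g p by (auto simp: real_integrable_def top_unique)
  have "(\<integral>\<^sup>+x. ennreal (- f x) \<partial>count_space A) \<noteq> \<infinity>"
  proof
    assume q: "(\<integral>\<^sup>+x. ennreal (- f x) \<partial>count_space A) = \<infinity>"
    have "extended_sum f A = -\<infinity>"
      using fin by (cases "\<integral>\<^sup>+x. ennreal (f x) \<partial>count_space A") (auto simp: extended_sum_def q)
    with r show False by simp
  qed
  with fin show f: "integrable (count_space A) f" by (simp add: real_integrable_def)
  show "r \<le> (\<integral>x. f x \<partial>count_space A)" using r by (simp add: extended_sum_integrable[OF f])
qed

lemma
  fixes \<mu> :: "(nat \<Rightarrow> nat) measure" and f :: "nat list \<Rightarrow> real"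
  assumes "sets \<mu> = sets borel" "prob_space \<mu>"
  shows integrable_prefix_iff: "integrable \<mu> (\<lambda>x. f (prefix n x)) \<longleftrightarrow>
      integrable (count_space (words n)) (\<lambda>\<omega>. measure \<mu> (cylinder \<omega>) * f \<omega>)"
    and integral_prefix: "(\<integral>x. f (prefix n x) \<partial>\<mu>) =
      (\<integral>\<omega>. measure \<mu> (cylinder \<omega>) * f \<omega> \<partial>count_space (words n))"
proof -
  note [measurable_cong] = assms(1)
  interpret prob_space \<mu> by fact
  have D: "distr \<mu> (count_space (words n)) (prefix n) =
      density (count_space (words n)) (\<lambda>\<omega>. ennreal (measure \<mu> (cylinder \<omega>)))"
    by (simp add: distr_prefix[OF assms(1)] emeasure_eq_measure)
  have "integrable \<mu> (\<lambda>x. f (prefix n x)) \<longleftrightarrow> integrable (distr \<mu> (count_space (words n)) (prefix n)) f"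
    by (rule integrable_distr_eq[symmetric]) auto
  also have "\<dots> \<longleftrightarrow> integrable (count_space (words n)) (\<lambda>\<omega>. measure \<mu> (cylinder \<omega>) * f \<omega>)"
    unfolding D by (subst integrable_density) auto
  finally show "integrable \<mu> (\<lambda>x. f (prefix n x)) \<longleftrightarrow>
      integrable (count_space (words n)) (\<lambda>\<omega>. measure \<mu> (cylinder \<omega>) * f \<omega>)" .
  have "(\<integral>x. f (prefix n x) \<partial>\<mu>) = integral\<^sup>L (distr \<mu> (count_space (words n)) (prefix n)) f"
    by (rule integral_distr[symmetric]) auto
  also have "\<dots> = (\<integral>\<omega>. measure \<mu> (cylinder \<omega>) * f \<omega> \<partial>count_space (words n))"
    unfolding D by (subst integral_density) auto
  finally show "(\<integral>x. f (prefix n x) \<partial>\<mu>) =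
      (\<integral>\<omega>. measure \<mu> (cylinder \<omega>) * f \<omega> \<partial>count_space (words n))" .
qed

lemma
  assumes "sets \<mu> = sets borel" "prob_space \<mu>"
  shows integrable_measure_cylinder: "integrable (count_space (words n)) (\<lambda>\<omega>. measure \<mu> (cylinder \<omega>))"
    and integral_measure_cylinder: "(\<integral>\<omega>. measure \<mu> (cylinder \<omega>) \<partial>count_space (words n)) = 1"
proof -
  interpret prob_space \<mu> by fact
  show "integrable (count_space (words n)) (\<lambda>\<omega>. measure \<mu> (cylinder \<omega>))"
    using integrable_prefix_iff[OF assms, of "\<lambda>_. 1" n] by simp
  show "(\<integral>\<omega>. measure \<mu> (cylinder \<omega>) \<partial>count_space (words n)) = 1"
    using integral_prefix[OF assms, of "\<lambda>_. 1" n] by (simp add: prob_space)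
qed

lemma
  assumes "sets \<mu> = sets borel" "prob_space \<mu>"
  shows integrable_measure_cylinder_indicator:
      "integrable (count_space (words n)) (\<lambda>\<omega>. measure \<mu> (cylinder \<omega>) * indicator W \<omega>)"
    and measure_prefix: "measure \<mu> {x. prefix n x \<in> W} =
      (\<integral>\<omega>. measure \<mu> (cylinder \<omega>) * indicator W \<omega> \<partial>count_space (words n))"
proof -
  interpret prob_space \<mu> by fact
  have eq: "(\<lambda>x. indicator W (prefix n x) :: real) = indicator {x. prefix n x \<in> W}"
    by (auto split: split_indicator)
  have m: "{x. prefix n x \<in> W} \<in> sets \<mu>" using prefix_set_measurable[of n W] by (simp add: assms)
  show "integrable (count_space (words n)) (\<lambda>\<omega>. measure \<mu> (cylinder \<omega>) * indicator W \<omega>)"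
    unfolding integrable_prefix_iff[OF assms, symmetric] eq
    using m by (intro integrable_real_indicator) (simp_all add: less_top[symmetric])
  show "measure \<mu> {x. prefix n x \<in> W} =
      (\<integral>\<omega>. measure \<mu> (cylinder \<omega>) * indicator W \<omega> \<partial>count_space (words n))"
    unfolding integral_prefix[OF assms, symmetric] eq using m by simp
qed

section \<open>Almost additive sequences\<close>

text \<open>
The number \<open>p\<close> separates the two families \<open>(a n - K) / n\<close> and \<open>a m / m\<close>: comparing \<open>a (m * n)\<close>
with \<open>m * a n\<close> and with \<open>n * a m\<close> shows that each member of the first is below each of the second.
\<close>

lemma almost_additive_bounds:
  fixes a :: "nat \<Rightarrow> real"
  assumes sub: "\<And>m n. m \<ge> 1 \<Longrightarrow> n \<ge> 1 \<Longrightarrow> a (m + n) \<le> a m + a n"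
    and super: "\<And>m n. m \<ge> 1 \<Longrightarrow> n \<ge> 1 \<Longrightarrow> a m + a n \<le> a (m + n) + K"
  obtains p where "\<And>n. n \<ge> 1 \<Longrightarrow> real n * p \<le> a n" "\<And>n. n \<ge> 1 \<Longrightarrow> a n \<le> real n * p + K"
    "(INF n\<in>{1..}. ereal (a n / real n)) = ereal p"
proof -
  have mult_le: "a (k * n) \<le> real k * a n" if "n \<ge> 1" "k \<ge> 1" for k n
    using \<open>k \<ge> 1\<close>
  proof (induction k rule: dec_induct)
    case (step k)
    have "a (n + k * n) \<le> a n + a (k * n)" using step that by (intro sub) auto
    with step show ?case by (simp add: algebra_simps)
  qed simp
  have mult_ge: "real k * a n \<le> a (k * n) + real (k - 1) * K" if "n \<ge> 1" "k \<ge> 1" for k n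
    using \<open>k \<ge> 1\<close>
  proof (induction k rule: dec_induct)
    case (step k)
    have "a n + a (k * n) \<le> a (n + k * n) + K" using step that by (intro super) auto
    with step show ?case by (simp add: algebra_simps of_nat_diff)
  qed simp
  have K: "0 \<le> K" using sub[of 1 1] super[of 1 1] by simp
  have cross: "(a n - K) / real n \<le> a m / real m" if "m \<ge> 1" "n \<ge> 1" for m n
  proof -
    have "real m * a n \<le> real n * a m + real (m - 1) * K"
      using mult_ge[OF that(2,1)] mult_le[OF that] by (simp add: mult.commute)
    also have "\<dots> \<le> real n * a m + real m * K" using K by (intro add_left_mono mult_right_mono) auto
    finally show ?thesis using that by (simp add: field_simps)
  qed
  define p where "p = (INF n\<in>{1..}. a n / real n)"
  have bdd: "bdd_below ((\<lambda>n. a n / real n) ` {1..})"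
    using cross[of _ 1] by (intro bdd_belowI2[of _ "(a 1 - K) / real 1"]) auto
  have le: "p \<le> a n / real n" if "n \<ge> 1" for n
    unfolding p_def using that by (intro cINF_lower bdd) auto
  have ge: "(a n - K) / real n \<le> p" if "n \<ge> 1" for n
    unfolding p_def using cross[OF _ that] by (intro cINF_greatest) auto
  show ?thesis
  proof (rule that)
    fix n :: nat assume n: "n \<ge> 1"
    show "real n * p \<le> a n" using le[OF n] n by (simp add: field_simps)
    show "a n \<le> real n * p + K" using ge[OF n] n by (simp add: field_simps)
  next
    show "(INF n\<in>{1..}. ereal (a n / real n)) = ereal p"
    proof (rule INF_eqI)
      fix y assume y: "\<And>n. n \<in> {1..} \<Longrightarrow> y \<le> ereal (a n / real n)"
      show "y \<le> ereal p"
      proof (cases y)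
        case (real r)
        then have "r \<le> p" unfolding p_def using y by (intro cINF_greatest) auto
        then show ?thesis using real by simp
      next
        case PInf
        then show ?thesis using y[of 1] by simp
      qed simp
    qed (use le in auto)
  qed
qed

section \<open>Block sums of an invariant measure\<close>

text \<open>
The pointwise inequality behind \<open>\<Sum>\<omega>. u \<omega> * ln (v \<omega> / u \<omega>) \<le> ln z\<close> for a probability vector \<open>u\<close> and
\<open>z = \<Sum>\<omega>. v \<omega>\<close>: the right-hand sides sum to \<open>ln z\<close>.
\<close>

lemma entropy_term_le:
  fixes u v z :: real
  assumes "0 \<le> u" "0 \<le> v" "0 < z" "v = 0 \<Longrightarrow> u = 0"
  shows "u * ln (v / u) \<le> v / z - u + u * ln z"
proof (cases "u = 0")
  case False
  then have "v \<noteq> 0" using assms(4) by blast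
  with False have uv: "0 < u" "0 < v" using assms(1,2) by simp_all
  have "ln (v / u) = ln (v / (u * z)) + ln z" using uv assms by (simp add: ln_div ln_mult)
  also have "\<dots> \<le> v / (u * z) - 1 + ln z"
    using ln_le_minus_one[of "v / (u * z)"] uv assms by simp
  finally have "u * ln (v / u) \<le> u * (v / (u * z) - 1 + ln z)" using uv by (intro mult_left_mono) auto
  also have "\<dots> = v / z - u + u * ln z" using uv by (simp add: algebra_simps)
  finally show ?thesis .
qed (use assms in auto)

lemma integral_compose_suffix:
  fixes f :: "(nat \<Rightarrow> nat) \<Rightarrow> real"
  assumes \<mu>: "\<mu> \<in> invariant_measures" and f: "integrable \<mu> f"
  shows "integrable \<mu> (\<lambda>x. f (suffix k x))" "(\<integral>x. f (suffix k x) \<partial>\<mu>) = (\<integral>x. f x \<partial>\<mu>)"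
proof -
  note [measurable_cong] = invariant_measuresD(1)[OF \<mu>]
  have d: "distr \<mu> borel (suffix k) = \<mu>" by (rule distr_suffix_invariant[OF \<mu>])
  have m: "suffix k \<in> \<mu> \<rightarrow>\<^sub>M borel" by measurable
  have fm: "f \<in> borel_measurable borel" using f by measurable
  show "integrable \<mu> (\<lambda>x. f (suffix k x))"
    using integrable_distr_eq[OF m fm] f by (simp add: d)
  show "(\<integral>x. f (suffix k x) \<partial>\<mu>) = (\<integral>x. f x \<partial>\<mu>)"
    using integral_distr[OF m fm] by (simp add: d)
qed

lemma measure_cylinder_append_le:
  assumes \<mu>: "\<mu> \<in> invariant_measures"
  shows "measure \<mu> (cylinder (\<alpha> @ \<beta>)) \<le> measure \<mu> (cylinder \<alpha>)"
    "measure \<mu> (cylinder (\<alpha> @ \<beta>)) \<le> measure \<mu> (cylinder \<beta>)"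
proof -
  interpret prob_space \<mu> by (rule invariant_measuresD[OF \<mu>])
  have [simp]: "sets \<mu> = sets borel" by (rule invariant_measuresD[OF \<mu>])
  show "measure \<mu> (cylinder (\<alpha> @ \<beta>)) \<le> measure \<mu> (cylinder \<alpha>)"
    by (intro finite_measure_mono) (auto simp: mem_cylinder_append_iff)
  have "measure \<mu> (cylinder (\<alpha> @ \<beta>)) \<le> measure \<mu> (suffix (length \<alpha>) -` cylinder \<beta>)"
    using measurable_sets[OF suffix_measurable borel_cylinder]
    by (intro finite_measure_mono) (auto simp: mem_cylinder_append_iff)
  also have "\<dots> = measure \<mu> (cylinder \<beta>)"
    by (simp add: measure_def emeasure_suffix_vimage[OF \<mu>])
  finally show "measure \<mu> (cylinder (\<alpha> @ \<beta>)) \<le> measure \<mu> (cylinder \<beta>)" .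
qed

text \<open>
The summands in the measure-theoretical pressure, and their sum over words of length \<open>n\<close> as a Bochner
integral, which has its intended meaning for absolutely summable families.
\<close>

definition block_term :: "(nat list \<Rightarrow> real) \<Rightarrow> (nat \<Rightarrow> nat) measure \<Rightarrow> nat list \<Rightarrow> real" where
  "block_term v \<mu> \<omega> = measure \<mu> (cylinder \<omega>) * ln (v \<omega> / measure \<mu> (cylinder \<omega>))"

definition block_sum :: "(nat list \<Rightarrow> real) \<Rightarrow> (nat \<Rightarrow> nat) measure \<Rightarrow> nat \<Rightarrow> real" where
  "block_sum v \<mu> n = (\<integral>\<omega>. block_term v \<mu> \<omega> \<partial>count_space (words n))"

text \<open>
Cutting a word \<open>\<omega>\<close> into \<open>\<alpha>\<close> and \<open>\<beta>\<close> gives, up to the sub-multiplicativity of \<open>v\<close>, the terms of \<open>\<alpha>\<close>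
and \<open>\<beta>\<close> plus \<open>ln (\<mu> [\<alpha>] * \<mu> [\<beta>] / \<mu> [\<omega>])\<close>.  The last one is at most \<open>\<mu> [\<alpha>] * \<mu> [\<beta>] / \<mu> [\<omega>] - 1\<close>,
which has mean at most 0.  By invariance the terms of the suffix \<open>\<beta>\<close> have mean \<open>block_sum v \<mu> n\<close>.
\<close>

lemma block_sum_add_le:
  fixes v :: "nat list \<Rightarrow> real"
  assumes \<mu>: "\<mu> \<in> invariant_measures"
    and v_nonneg: "\<And>\<omega>. 0 \<le> v \<omega>" and v_append: "\<And>\<omega> \<tau>. v (\<omega> @ \<tau>) \<le> v \<omega> * v \<tau>"
    and v_0: "\<And>\<omega>. v \<omega> = 0 \<Longrightarrow> measure \<mu> (cylinder \<omega>) = 0"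
    and int: "\<And>n. integrable (count_space (words n)) (block_term v \<mu>)"
  shows "block_sum v \<mu> (m + n) \<le> block_sum v \<mu> m + block_sum v \<mu> n"
proof -
  interpret prob_space \<mu> by (rule invariant_measuresD[OF \<mu>])
  note s = invariant_measuresD(1,2)[OF \<mu>]
  let ?u = "\<lambda>\<omega>. measure \<mu> (cylinder \<omega>)"
  let ?L = "\<lambda>\<omega>. ln (v \<omega> / ?u \<omega>)"
  let ?W = "count_space (words (m + n))"
  have L: "integrable \<mu> (\<lambda>x. ?L (prefix k x))" "(\<integral>x. ?L (prefix k x) \<partial>\<mu>) = block_sum v \<mu> k" for k
    using int[of k] integrable_prefix_iff[OF s, of ?L k] integral_prefix[OF s, of ?L k]
    by (simp_all add: block_sum_def block_term_def[abs_def])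
  have take: "integrable ?W (\<lambda>\<omega>. ?u \<omega> * ?L (take m \<omega>))"
    "(\<integral>\<omega>. ?u \<omega> * ?L (take m \<omega>) \<partial>?W) = block_sum v \<mu> m"
    using L[of m] integrable_prefix_iff[OF s, of "\<lambda>\<omega>. ?L (take m \<omega>)" "m + n"]
      integral_prefix[OF s, of "\<lambda>\<omega>. ?L (take m \<omega>)" "m + n"] by simp_all
  have drop: "integrable ?W (\<lambda>\<omega>. ?u \<omega> * ?L (drop m \<omega>))"
    "(\<integral>\<omega>. ?u \<omega> * ?L (drop m \<omega>) \<partial>?W) = block_sum v \<mu> n"
    using integral_compose_suffix[OF \<mu> L(1)[of n], of m] L(2)[of n]
      integrable_prefix_iff[OF s, of "\<lambda>\<omega>. ?L (drop m \<omega>)" "m + n"]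
      integral_prefix[OF s, of "\<lambda>\<omega>. ?L (drop m \<omega>)" "m + n"] by simp_all
  have nn1: "word_sum k (\<lambda>\<omega>. ennreal (?u \<omega>)) = 1" for k
    unfolding word_sum_def
    by (subst nn_integral_eq_integral[OF integrable_measure_cylinder[OF s]])
      (simp_all add: integral_measure_cylinder[OF s])
  have "(\<integral>\<^sup>+\<omega>. ennreal (?u (take m \<omega>) * ?u (drop m \<omega>)) \<partial>?W) =
      word_sum m (\<lambda>\<alpha>. word_sum n (\<lambda>\<beta>. ennreal (?u \<alpha>) * ennreal (?u \<beta>)))"
    unfolding word_sum_def[of "m + n", symmetric] word_sum_add
    by (intro word_sum_cong) (simp add: ennreal_mult)
  also have "\<dots> = 1" by (simp add: word_sum_cmult word_sum_multc nn1)
  finally have nn: "(\<integral>\<^sup>+\<omega>. ennreal (?u (take m \<omega>) * ?u (drop m \<omega>)) \<partial>?W) = 1" .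
  have prod: "integrable ?W (\<lambda>\<omega>. ?u (take m \<omega>) * ?u (drop m \<omega>))"
    by (rule integrableI_nonneg) (simp_all add: nn)
  have prod_int: "(\<integral>\<omega>. ?u (take m \<omega>) * ?u (drop m \<omega>) \<partial>?W) = 1"
    by (subst integral_eq_nn_integral) (simp_all add: nn)
  have pointwise: "block_term v \<mu> \<omega> \<le> ?u \<omega> * ?L (take m \<omega>) + ?u \<omega> * ?L (drop m \<omega>) +
      ?u (take m \<omega>) * ?u (drop m \<omega>) - ?u \<omega>" for \<omega>
  proof (cases "?u \<omega> = 0")
    case True
    then show ?thesis by (simp add: block_term_def)
  next
    case False
    let ?a = "take m \<omega>" and ?b = "drop m \<omega>"
    have u: "0 < ?u \<omega>" using False measure_nonneg[of \<mu> "cylinder \<omega>"] by linarith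
    have ua: "0 < ?u ?a" and ub: "0 < ?u ?b"
      using u measure_cylinder_append_le[OF \<mu>, of ?a ?b] by simp_all
    have v: "0 < v \<omega>" "0 < v ?a" "0 < v ?b"
      using u ua ub v_0 v_nonneg by (metis less_irrefl order_le_less)+
    have "v \<omega> \<le> v ?a * v ?b" using v_append[of ?a ?b] by simp
    then have "v \<omega> / ?u \<omega> \<le> (v ?a / ?u ?a) * (v ?b / ?u ?b) * (?u ?a * ?u ?b / ?u \<omega>)"
      using u ua ub by (simp add: divide_right_mono)
    then have "ln (v \<omega> / ?u \<omega>) \<le> ln ((v ?a / ?u ?a) * (v ?b / ?u ?b) * (?u ?a * ?u ?b / ?u \<omega>))"
      using u v by (intro ln_mono) simp_all
    also have "\<dots> = ?L ?a + ?L ?b + ln (?u ?a * ?u ?b / ?u \<omega>)"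
      using u ua ub v by (subst ln_mult_pos, simp, simp)+ simp
    also have "\<dots> \<le> ?L ?a + ?L ?b + (?u ?a * ?u ?b / ?u \<omega> - 1)"
      using u ua ub by (intro add_left_mono ln_le_minus_one) simp
    finally have "?u \<omega> * ln (v \<omega> / ?u \<omega>) \<le> ?u \<omega> * (?L ?a + ?L ?b + (?u ?a * ?u ?b / ?u \<omega> - 1))"
      using u by (intro mult_left_mono) auto
    also have "\<dots> = ?u \<omega> * ?L ?a + ?u \<omega> * ?L ?b + ?u ?a * ?u ?b - ?u \<omega>"
      using u by (simp add: algebra_simps)
    finally show ?thesis by (simp only: block_term_def)
  qed
  have "block_sum v \<mu> (m + n) \<le> (\<integral>\<omega>. ?u \<omega> * ?L (take m \<omega>) + ?u \<omega> * ?L (drop m \<omega>) +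
      ?u (take m \<omega>) * ?u (drop m \<omega>) - ?u \<omega> \<partial>?W)"
    unfolding block_sum_def
    by (rule integral_mono)
      (use int take(1) drop(1) prod integrable_measure_cylinder[OF s] pointwise in auto)
  also have "\<dots> = block_sum v \<mu> m + block_sum v \<mu> n + 1 - 1"
    using take drop prod prod_int integrable_measure_cylinder[OF s] integral_measure_cylinder[OF s]
    by simp
  finally show ?thesis by simp
qed

lemma block_sum_mult_le:
  fixes v :: "nat list \<Rightarrow> real"
  assumes sub: "\<And>m n. block_sum v \<mu> (m + n) \<le> block_sum v \<mu> m + block_sum v \<mu> n" and "k \<ge> 1"
  shows "block_sum v \<mu> (k * n) \<le> real k * block_sum v \<mu> n"
  using \<open>k \<ge> 1\<close>
proof (induction k rule: dec_induct)
  case (step k)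
  have "block_sum v \<mu> (n + k * n) \<le> block_sum v \<mu> n + block_sum v \<mu> (k * n)" by (rule sub)
  with step show ?case by (simp add: algebra_simps)
qed simp

section \<open>Equilibrium measures\<close>

context quasi_multiplicative_weight
begin

text \<open>
Entropies involve logarithms and differences, hence these real-valued copies.
\<close>

definition v :: "nat list \<Rightarrow> real" where "v \<omega> = enn2real (w \<omega>)"
definition z :: "nat \<Rightarrow> real" where "z n = enn2real (Z n)"
definition g :: real where "g = enn2real G"

lemma ennreal_v: "ennreal (v \<omega>) = w \<omega>" and ennreal_z: "ennreal (z n) = Z n" and ennreal_g: "ennreal g = G"
  using w_finite[of \<omega>] by (simp_all add: v_def z_def g_def)

lemma v_nonneg: "0 \<le> v \<omega>" and z_pos: "0 < z n" and g_ge_1: "1 \<le> g"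
proof -
  show "0 \<le> v \<omega>" by (simp add: v_def)
  show "0 < z n" using Z_pos[of n] by (simp add: z_def enn2real_positive_iff)
  have "ennreal 1 \<le> ennreal g" using G_ge_1 by (simp add: ennreal_g)
  then show "1 \<le> g" by (subst (asm) ennreal_le_iff) (simp_all add: g_def)
qed

lemma g_pos: "0 < g" and ln_g_nonneg: "0 \<le> ln g"
  using g_ge_1 by auto

lemma v_append_le: "v (\<omega> @ \<tau>) \<le> v \<omega> * v \<tau>"
proof -
  have "ennreal (v (\<omega> @ \<tau>)) \<le> ennreal (v \<omega> * v \<tau>)"
    using w_append_le[of \<omega> \<tau>] by (simp add: ennreal_v ennreal_mult v_nonneg)
  then show ?thesis by (simp add: v_nonneg)
qed

lemma z_add_le: "z (m + n) \<le> z m * z n" and z_mult_le: "z m * z n \<le> g * z (m + n)"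
proof -
  have z0: "0 \<le> z n" for n using z_pos[of n] by simp
  have "ennreal (z (m + n)) \<le> ennreal (z m * z n)"
    using Z_add_le[of m n] by (simp add: ennreal_z ennreal_mult z0)
  then show "z (m + n) \<le> z m * z n" by (simp add: z0)
  have "ennreal (z m * z n) \<le> ennreal (g * z (m + n))"
    using Z_mult_le[of m n] g_pos by (simp add: ennreal_z ennreal_g ennreal_mult z0)
  then show "z m * z n \<le> g * z (m + n)" using g_pos z0 by simp
qed

lemma integrable_v: "integrable (count_space (words n)) v"
  and integral_v: "(\<integral>\<omega>. v \<omega> \<partial>count_space (words n)) = z n"
proof -
  have nn: "(\<integral>\<^sup>+\<omega>. ennreal (v \<omega>) \<partial>count_space (words n)) = Z n"
    by (simp add: ennreal_v word_sum_def)
  show "integrable (count_space (words n)) v"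
    by (rule integrableI_nonneg) (simp_all add: nn v_nonneg)
  show "(\<integral>\<omega>. v \<omega> \<partial>count_space (words n)) = z n"
    by (subst integral_eq_nn_integral) (simp_all add: nn v_nonneg z_def)
qed

definition entropy_majorant :: "(nat \<Rightarrow> nat) measure \<Rightarrow> nat \<Rightarrow> nat list \<Rightarrow> real" where
  "entropy_majorant \<mu> n \<omega> =
    v \<omega> / z n - measure \<mu> (cylinder \<omega>) + measure \<mu> (cylinder \<omega>) * ln (z n)"

lemma block_term_le_majorant:
  assumes "\<And>\<omega>. v \<omega> = 0 \<Longrightarrow> measure \<mu> (cylinder \<omega>) = 0"
  shows "block_term v \<mu> \<omega> \<le> entropy_majorant \<mu> n \<omega>"
  unfolding block_term_def entropy_majorant_def
  by (rule entropy_term_le) (use assms v_nonneg z_pos in auto)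

lemma
  assumes "\<mu> \<in> invariant_measures"
  shows integrable_entropy_majorant: "integrable (count_space (words n)) (entropy_majorant \<mu> n)"
    and integral_entropy_majorant: "(\<integral>\<omega>. entropy_majorant \<mu> n \<omega> \<partial>count_space (words n)) = ln (z n)"
proof -
  note s = invariant_measuresD(1,2)[OF assms]
  note [simp] = integrable_v integrable_measure_cylinder[OF s] integral_measure_cylinder[OF s] integral_v
  show "integrable (count_space (words n)) (entropy_majorant \<mu> n)"
    unfolding entropy_majorant_def by simp
  show "(\<integral>\<omega>. entropy_majorant \<mu> n \<omega> \<partial>count_space (words n)) = ln (z n)"
    unfolding entropy_majorant_def using z_pos[of n] by simp
qed

lemma gibbs_measure_bounds:
  assumes "gibbs_measure \<mu>"
  shows "measure \<mu> (cylinder \<omega>) * z (length \<omega>) \<le> g\<^sup>2 * v \<omega>"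
    and "v \<omega> \<le> g\<^sup>2 * z (length \<omega>) * measure \<mu> (cylinder \<omega>)"
proof -
  interpret prob_space \<mu> using assms by (intro invariant_measuresD) (simp add: gibbs_measure_def)
  have z0: "0 \<le> z n" for n using z_pos[of n] by simp
  have g0: "0 \<le> g" using g_pos by simp
  have "emeasure \<mu> (cylinder \<omega>) * Z (length \<omega>) \<le> gibbs_bound \<omega> * Z (length \<omega>)"
    using assms by (intro mult_right_mono) (auto simp: gibbs_measure_def)
  also have "\<dots> = G\<^sup>2 * w \<omega>" unfolding gibbs_bound_def ennreal_divide_times by simp
  finally have "ennreal (measure \<mu> (cylinder \<omega>) * z (length \<omega>)) \<le> ennreal (g\<^sup>2 * v \<omega>)"
    by (simp add: emeasure_eq_measure ennreal_mult ennreal_z ennreal_g ennreal_v z0 g0 v_nonneg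
        flip: ennreal_power)
  then show "measure \<mu> (cylinder \<omega>) * z (length \<omega>) \<le> g\<^sup>2 * v \<omega>" by (simp add: v_nonneg)
  have "w \<omega> \<le> G\<^sup>2 * Z (length \<omega>) * emeasure \<mu> (cylinder \<omega>)"
    using assms by (auto simp: gibbs_measure_def)
  then have "ennreal (v \<omega>) \<le> ennreal (g\<^sup>2 * z (length \<omega>) * measure \<mu> (cylinder \<omega>))"
    by (simp add: emeasure_eq_measure ennreal_mult ennreal_z ennreal_g ennreal_v z0 g0
        flip: ennreal_power)
  then show "v \<omega> \<le> g\<^sup>2 * z (length \<omega>) * measure \<mu> (cylinder \<omega>)"
    by (simp add: z0)
qed

lemma gibbs_measure_0:
  assumes "gibbs_measure \<mu>" "v \<omega> = 0"
  shows "measure \<mu> (cylinder \<omega>) = 0"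
  using gibbs_measure_bounds(1)[OF assms(1), of \<omega>] assms(2) z_pos[of "length \<omega>"]
    measure_nonneg[of \<mu> "cylinder \<omega>"]
  by (simp add: mult_le_0_iff)

lemma gibbs_block_term_ge:
  assumes "gibbs_measure \<mu>" "\<omega> \<in> words n"
  shows "measure \<mu> (cylinder \<omega>) * (ln (z n) - 2 * ln g) \<le> block_term v \<mu> \<omega>"
proof (cases "measure \<mu> (cylinder \<omega>) = 0")
  case False
  let ?u = "measure \<mu> (cylinder \<omega>)"
  have u: "0 < ?u" using False measure_nonneg[of \<mu> "cylinder \<omega>"] by linarith
  have v: "0 < v \<omega>" using gibbs_measure_0[OF assms(1), of \<omega>] False v_nonneg[of \<omega>] by fastforce
  have "z n / g\<^sup>2 \<le> v \<omega> / ?u"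
    using gibbs_measure_bounds(1)[OF assms(1), of \<omega>] assms(2) u g_pos
    by (simp add: field_simps words_def)
  then have "ln (z n / g\<^sup>2) \<le> ln (v \<omega> / ?u)"
    using z_pos g_pos by (intro ln_mono) simp_all
  moreover have "ln (z n / g\<^sup>2) = ln (z n) - 2 * ln g"
    using z_pos[of n] g_pos by (simp add: ln_div ln_realpow)
  ultimately show ?thesis using u by (simp add: block_term_def mult_left_mono)
qed (simp add: block_term_def)

lemma gibbs_block_sum:
  assumes "gibbs_measure \<mu>"
  shows "integrable (count_space (words n)) (block_term v \<mu>)"
    and "ln (z n) - 2 * ln g \<le> block_sum v \<mu> n"
proof -
  have \<mu>: "\<mu> \<in> invariant_measures" using assms by (simp add: gibbs_measure_def)
  note s = invariant_measuresD(1,2)[OF \<mu>]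
  let ?h = "\<lambda>\<omega>. measure \<mu> (cylinder \<omega>) * (ln (z n) - 2 * ln g)"
  have h: "integrable (count_space (words n)) ?h" "(\<integral>\<omega>. ?h \<omega> \<partial>count_space (words n)) = ln (z n) - 2 * ln g"
    using integrable_measure_cylinder[OF s] integral_measure_cylinder[OF s] by simp_all
  show int: "integrable (count_space (words n)) (block_term v \<mu>)"
  proof (rule Bochner_Integration.integrable_bound)
    show "integrable (count_space (words n)) (\<lambda>\<omega>. \<bar>entropy_majorant \<mu> n \<omega>\<bar> + \<bar>?h \<omega>\<bar>)"
      using h(1) integrable_entropy_majorant[OF \<mu>] by (intro Bochner_Integration.integrable_add integrable_abs)
    show "AE \<omega> in count_space (words n). norm (block_term v \<mu> \<omega>) \<le> norm (\<bar>entropy_majorant \<mu> n \<omega>\<bar> + \<bar>?h \<omega>\<bar>)"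
    proof (rule AE_I2)
      fix \<omega> assume "\<omega> \<in> space (count_space (words n))"
      then have "?h \<omega> \<le> block_term v \<mu> \<omega>" using gibbs_block_term_ge[OF assms] by simp
      moreover have "block_term v \<mu> \<omega> \<le> entropy_majorant \<mu> n \<omega>"
        by (rule block_term_le_majorant[OF gibbs_measure_0[OF assms]])
      ultimately show "norm (block_term v \<mu> \<omega>) \<le> norm (\<bar>entropy_majorant \<mu> n \<omega>\<bar> + \<bar>?h \<omega>\<bar>)"
        unfolding real_norm_def by linarith
    qed
  qed simp
  show "ln (z n) - 2 * ln g \<le> block_sum v \<mu> n"
  proof -
    have "(\<integral>\<omega>. ?h \<omega> \<partial>count_space (words n)) \<le> block_sum v \<mu> n"
      unfolding block_sum_def
      by (rule integral_mono[OF h(1) int]) (use gibbs_block_term_ge[OF assms] in simp)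
    then show ?thesis by (simp only: h(2))
  qed
qed

text \<open>
For each \<open>k\<close>, sub-additivity gives \<open>k * S n \<ge> S (k * n) \<ge> k * n * p - 2 * ln g\<close>.  A deficit of \<open>S n\<close>
would be multiplied by \<open>k\<close>, whereas the error stays bounded.
\<close>

lemma gibbs_block_sum_ge:
  assumes \<mu>: "gibbs_measure \<mu>" and p: "\<And>n. n \<ge> 1 \<Longrightarrow> real n * p \<le> ln (z n)" and n: "n \<ge> 1"
  shows "real n * p \<le> block_sum v \<mu> n"
proof (rule ccontr)
  assume "\<not> real n * p \<le> block_sum v \<mu> n"
  then have pos: "0 < real n * p - block_sum v \<mu> n" by simp
  then obtain k :: nat where k: "2 * ln g < real k * (real n * p - block_sum v \<mu> n)"
    using reals_Archimedean3 by blast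
  have "k \<noteq> 0" using k ln_g_nonneg by (intro notI) simp
  then have k1: "k \<ge> 1" by simp
  have inv: "\<mu> \<in> invariant_measures" using \<mu> by (simp add: gibbs_measure_def)
  have "real (k * n) * p \<le> ln (z (k * n))" using k1 n by (intro p) simp
  also have "\<dots> \<le> block_sum v \<mu> (k * n) + 2 * ln g" using gibbs_block_sum(2)[OF \<mu>, of "k * n"] by simp
  also have "block_sum v \<mu> (k * n) \<le> real k * block_sum v \<mu> n"
    by (intro block_sum_mult_le[OF _ k1] block_sum_add_le[OF inv v_nonneg v_append_le gibbs_measure_0[OF \<mu>]
          gibbs_block_sum(1)[OF \<mu>]])
  finally show False using k by (simp add: algebra_simps)
qed

text \<open>
The entropy inequality.  Summing \<open>ln x \<le> x - 1\<close> with \<open>x = exp (t * indicator W \<omega>) * \<mu> [\<omega>] / \<nu> [\<omega>]\<close>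
against \<open>\<nu>\<close> bounds \<open>t * \<nu> W\<close> by the relative entropy of \<open>\<nu>\<close> with respect to \<open>\<mu>\<close> on words of length \<open>n\<close>
plus \<open>exp t * \<mu> W\<close>.  The relative entropy is at most \<open>3 * ln g\<close>: the Gibbs bound for \<open>\<mu>\<close>
contributes \<open>2 * ln g\<close> and the assumption on the block sum of \<open>\<nu>\<close> contributes \<open>ln g\<close>.  It is essential
that the bound does not depend on \<open>n\<close>.
\<close>

lemma equilibrium_measure_bound:
  assumes \<mu>: "gibbs_measure \<mu>" and \<nu>: "\<nu> \<in> invariant_measures"
    and v_pos: "\<And>\<omega>. 0 < v \<omega>"
    and int: "integrable (count_space (words n)) (block_term v \<nu>)"
    and ge: "ln (z n) - ln g \<le> block_sum v \<nu> n"
  shows "t * measure \<nu> {x. prefix n x \<in> W} \<le> 3 * ln g + exp t * measure \<mu> {x. prefix n x \<in> W}"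
proof -
  have inv: "\<mu> \<in> invariant_measures" using \<mu> by (simp add: gibbs_measure_def)
  note s = invariant_measuresD(1,2)[OF inv] and s' = invariant_measuresD(1,2)[OF \<nu>]
  let ?u = "\<lambda>\<omega>. measure \<nu> (cylinder \<omega>)" and ?m = "\<lambda>\<omega>. measure \<mu> (cylinder \<omega>)"
  let ?C = "count_space (words n)"
  have pointwise: "t * (?u \<omega> * indicator W \<omega>) + block_term v \<nu> \<omega> \<le>
      ?u \<omega> * (2 * ln g + ln (z n)) + (?m \<omega> + exp t * (?m \<omega> * indicator W \<omega>)) - ?u \<omega>"
    if "\<omega> \<in> words n" for \<omega>
  proof -
    let ?a = "t * indicator W \<omega>"
    have e: "exp ?a * ?m \<omega> \<le> ?m \<omega> + exp t * (?m \<omega> * indicator W \<omega>)"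
      by (auto split: split_indicator simp: algebra_simps)
    have "?u \<omega> * (?a + ln (v \<omega> / ?u \<omega>)) \<le> ?u \<omega> * (2 * ln g + ln (z n)) + exp ?a * ?m \<omega> - ?u \<omega>"
    proof (cases "?u \<omega> = 0")
      case False
      then have u: "0 < ?u \<omega>" using measure_nonneg[of \<nu> "cylinder \<omega>"] by linarith
      have vm: "v \<omega> \<le> g\<^sup>2 * z n * ?m \<omega>"
        using gibbs_measure_bounds(2)[OF \<mu>, of \<omega>] that by (simp add: words_def)
      have m: "0 < ?m \<omega>"
      proof (rule ccontr)
        assume "\<not> 0 < ?m \<omega>"
        then have "?m \<omega> = 0" using measure_nonneg[of \<mu> "cylinder \<omega>"] by linarith
        with vm v_pos[of \<omega>] show False by simp
      qed
      have "?a + ln (v \<omega> / ?u \<omega>) \<le> ?a + ln (g\<^sup>2 * z n * (?m \<omega> / ?u \<omega>))"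
        using vm u v_pos[of \<omega>] by (intro add_left_mono ln_mono) (simp_all add: divide_right_mono)
      also have "\<dots> = 2 * ln g + ln (z n) + (?a + ln (?m \<omega> / ?u \<omega>))"
        using g_pos z_pos[of n] divide_pos_pos[OF m u]
        by (simp add: ln_mult_pos ln_realpow del: times_divide_eq_right)
      also have "?a + ln (?m \<omega> / ?u \<omega>) = ln (exp ?a * ?m \<omega> / ?u \<omega>)"
        using m u by (simp add: ln_mult_pos ln_div)
      also have "\<dots> \<le> exp ?a * ?m \<omega> / ?u \<omega> - 1"
        using m u by (intro ln_le_minus_one) simp
      finally have "?u \<omega> * (?a + ln (v \<omega> / ?u \<omega>)) \<le>
          ?u \<omega> * (2 * ln g + ln (z n) + (exp ?a * ?m \<omega> / ?u \<omega> - 1))"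
        using u by (intro mult_left_mono) auto
      also have "\<dots> = ?u \<omega> * (2 * ln g + ln (z n)) + exp ?a * ?m \<omega> - ?u \<omega>"
        using u by (simp add: algebra_simps)
      finally show ?thesis .
    qed simp
    with e show ?thesis unfolding block_term_def by (simp add: algebra_simps)
  qed
  note [simp] = integrable_measure_cylinder[OF s] integrable_measure_cylinder[OF s']
    integrable_measure_cylinder_indicator[OF s] integrable_measure_cylinder_indicator[OF s']
    integral_measure_cylinder[OF s] integral_measure_cylinder[OF s']
  have "(\<integral>\<omega>. t * (?u \<omega> * indicator W \<omega>) + block_term v \<nu> \<omega> \<partial>?C) \<le>
      (\<integral>\<omega>. ?u \<omega> * (2 * ln g + ln (z n)) + (?m \<omega> + exp t * (?m \<omega> * indicator W \<omega>)) - ?u \<omega> \<partial>?C)"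
    by (rule integral_mono) (use int pointwise in \<open>auto simp del: Bochner_Integration.integrable_mult_right_iff intro!: Bochner_Integration.integrable_mult_right\<close>)
  moreover have "(\<integral>\<omega>. t * (?u \<omega> * indicator W \<omega>) + block_term v \<nu> \<omega> \<partial>?C) =
      t * measure \<nu> {x. prefix n x \<in> W} + block_sum v \<nu> n"
    unfolding measure_prefix[OF s'] block_sum_def using int
    by (subst Bochner_Integration.integral_add) simp_all
  moreover have "(\<integral>\<omega>. ?u \<omega> * (2 * ln g + ln (z n)) + (?m \<omega> + exp t * (?m \<omega> * indicator W \<omega>)) - ?u \<omega> \<partial>?C) =
      2 * ln g + ln (z n) + (1 + exp t * measure \<mu> {x. prefix n x \<in> W}) - 1"
    unfolding measure_prefix[OF s] by simp
  ultimately show ?thesis using ge by simp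
qed

text \<open>
The entropy inequality extends to open sets.  For a \<open>\<mu>\<close>-null set \<open>A\<close> it is applied to
neighbourhoods of measure less than \<open>exp (- t)\<close>; this gives \<open>t * \<nu> A \<le> 3 * ln g + 1\<close> for all \<open>t > 0\<close>.
\<close>

theorem equilibrium_measure_unique:
  assumes \<mu>: "gibbs_measure \<mu>" and \<nu>: "\<nu> \<in> invariant_measures"
    and v_pos: "\<And>\<omega>. 0 < v \<omega>"
    and int: "\<And>n. n \<ge> 1 \<Longrightarrow> integrable (count_space (words n)) (block_term v \<nu>)"
    and ge: "\<And>n. n \<ge> 1 \<Longrightarrow> ln (z n) - ln g \<le> block_sum v \<nu> n"
  shows "\<nu> = \<mu>"
proof (rule abs_cont_invariant_unique[OF _ \<nu>])
  show inv: "\<mu> \<in> invariant_measures" using \<mu> by (simp add: gibbs_measure_def)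
  note s = invariant_measuresD(1,2)[OF inv] and s' = invariant_measuresD(1,2)[OF \<nu>]
  interpret M: prob_space \<mu> by (rule s)
  interpret N: prob_space \<nu> by (rule s')
  have open_bound: "t * measure \<nu> U \<le> 3 * ln g + exp t * measure \<mu> U" if U: "open U" for t U
  proof (rule LIMSEQ_le)
    let ?U = "\<lambda>n. {x. prefix n x \<in> {\<omega>. cylinder \<omega> \<subseteq> U}}"
    have lim: "(\<lambda>n. measure M (?U n)) \<longlonglongrightarrow> measure M U" if "sets M = sets borel" "prob_space M" for M
    proof -
      interpret prob_space M by fact
      from open_emeasure_LIMSEQ[OF U that(1)] show ?thesis by (simp add: emeasure_eq_measure)
    qed
    show "(\<lambda>n. t * measure \<nu> (?U n)) \<longlonglongrightarrow> t * measure \<nu> U"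
      by (intro tendsto_intros lim s')
    show "(\<lambda>n. 3 * ln g + exp t * measure \<mu> (?U n)) \<longlonglongrightarrow> 3 * ln g + exp t * measure \<mu> U"
      by (intro tendsto_intros lim s)
    show "\<exists>N. \<forall>n\<ge>N. t * measure \<nu> (?U n) \<le> 3 * ln g + exp t * measure \<mu> (?U n)"
      using equilibrium_measure_bound[OF \<mu> \<nu> v_pos int ge] by (intro exI[of _ 1]) blast
  qed
  fix A :: "(nat \<Rightarrow> nat) set" assume A: "A \<in> sets borel" and null: "emeasure \<mu> A = 0"
  have bound: "t * measure \<nu> A \<le> 3 * ln g + 1" if "0 < t" for t
  proof -
    have "(INF U\<in>{U. A \<subseteq> U \<and> open U}. emeasure \<mu> U) < ennreal (1 / exp t)"
      using outer_regular_nat_seq[OF s(1) _ A] null M.emeasure_finite[of "space \<mu>"] by simp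
    then obtain U where U: "A \<subseteq> U" "open U" "emeasure \<mu> U < ennreal (1 / exp t)"
      by (auto simp: INF_less_iff)
    have "t * measure \<nu> A \<le> t * measure \<nu> U"
      using U that by (intro mult_left_mono N.finite_measure_mono) (auto simp: s')
    also have "\<dots> \<le> 3 * ln g + exp t * measure \<mu> U" by (rule open_bound[OF U(2)])
    also have "exp t * measure \<mu> U \<le> exp t * (1 / exp t)"
      using U(3) by (intro mult_left_mono) (auto simp: M.emeasure_eq_measure ennreal_less_iff)
    finally show ?thesis by simp
  qed
  have "measure \<nu> A = 0"
  proof (rule ccontr)
    assume "measure \<nu> A \<noteq> 0"
    then have pos: "0 < measure \<nu> A" using measure_nonneg[of \<nu> A] by linarith
    then have "(3 * ln g + 2) / measure \<nu> A * measure \<nu> A \<le> 3 * ln g + 1"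
      using ln_g_nonneg by (intro bound divide_pos_pos) auto
    with pos show False by simp
  qed
  then show "emeasure \<nu> A = 0" by (simp add: N.emeasure_eq_measure)
qed (rule gibbs_measure_zero_one[OF \<mu>])

lemma pressure_bounds:
  obtains p where "\<And>n. n \<ge> 1 \<Longrightarrow> real n * p \<le> ln (z n)" "\<And>n. n \<ge> 1 \<Longrightarrow> ln (z n) \<le> real n * p + ln g"
    "(INF n\<in>{1..}. ereal (ln (z n) / real n)) = ereal p"
proof (rule almost_additive_bounds[of "\<lambda>n. ln (z n)" "ln g"])
  fix m n
  have "ln (z (m + n)) \<le> ln (z m * z n)" using z_add_le z_pos by (intro ln_mono) auto
  then show "ln (z (m + n)) \<le> ln (z m) + ln (z n)" using z_pos by (simp add: ln_mult_pos)
  have "ln (z m * z n) \<le> ln (g * z (m + n))" using z_mult_le z_pos by (intro ln_mono) auto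
  then show "ln (z m) + ln (z n) \<le> ln (z (m + n)) + ln g" using z_pos g_pos by (simp add: ln_mult_pos)
qed (rule that)

text \<open>
The essential point is that the bound involves the weight only through \<open>p\<close>, \<open>c\<close> and \<open>\<Gamma>\<close>; in
particular it does not involve \<open>g\<close>, which is not controlled when the alphabet grows.  Let \<open>S\<close> be the supremum
of \<open>z m / exp (m * p)\<close>, which is finite by \<open>upper\<close>.  Connecting a letter to a word of length \<open>m\<close>
gives \<open>z 1 * z m \<le> c * (\<Sum>\<kappa>\<in>\<Gamma>. z (1 + length \<kappa> + m))\<close>; dividing by \<open>exp (m * p)\<close> and taking suprema,
the factor \<open>S\<close> cancels.
\<close>

lemma z_1_le:
  assumes lower: "\<And>n. n \<ge> 1 \<Longrightarrow> real n * p \<le> ln (z n)"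
    and upper: "\<And>n. n \<ge> 1 \<Longrightarrow> ln (z n) \<le> real n * p + ln g"
  shows "z 1 \<le> enn2real c * (\<Sum>\<kappa>\<in>\<Gamma>. exp (real (length \<kappa> + 1) * p))"
proof -
  let ?r = "\<lambda>m. z m / exp (real m * p)"
  have r_le: "?r m \<le> g" for m
  proof (cases "m = 0")
    case False
    then have "ln (z m) \<le> real m * p + ln g" by (intro upper) simp
    then have "z m \<le> exp (real m * p + ln g)" using z_pos[of m] by (simp add: ln_le_cancel_iff flip: ln_le_cancel_iff[of "z m"])
    then show ?thesis using g_pos by (simp add: exp_add field_simps)
  qed (simp add: z_def g_ge_1)
  define S where "S = (SUP m. ?r m)"
  have bdd: "bdd_above (range ?r)" using r_le by (intro bdd_aboveI2)
  have r_S: "?r m \<le> S" for m unfolding S_def by (intro cSUP_upper bdd) simp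
  have S_pos: "0 < S" using r_S[of 0] by (simp add: z_def)
  let ?c = "enn2real c" and ?E = "\<Sum>\<kappa>\<in>\<Gamma>. exp (real (length \<kappa> + 1) * p)"
  have split: "z 1 * z m \<le> ?c * (\<Sum>\<kappa>\<in>\<Gamma>. z (1 + (length \<kappa> + m)))" for m
  proof -
    have "Z 1 * Z m = word_sum 1 (\<lambda>\<alpha>. word_sum m (\<lambda>\<beta>. w \<alpha> * w \<beta>))"
      by (simp add: word_sum_cmult word_sum_multc)
    also have "\<dots> \<le> word_sum 1 (\<lambda>\<alpha>. word_sum m (\<lambda>\<beta>. c * (\<Sum>\<kappa>\<in>\<Gamma>. w (\<alpha> @ \<kappa> @ \<beta>))))"
      by (intro word_sum_mono w_connect)
    also have "\<dots> = c * (\<Sum>\<kappa>\<in>\<Gamma>. word_sum 1 (\<lambda>\<alpha>. word_sum m (\<lambda>\<beta>. w (\<alpha> @ \<kappa> @ \<beta>))))"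
      by (simp add: word_sum_cmult word_sum_sum)
    also have "\<dots> \<le> c * (\<Sum>\<kappa>\<in>\<Gamma>. word_sum 1 (\<lambda>\<alpha>. word_sum (length \<kappa>) (\<lambda>\<delta>. word_sum m (\<lambda>\<beta>. w (\<alpha> @ \<delta> @ \<beta>)))))"
      by (intro mult_left_mono sum_mono word_sum_mono
          word_sum_ge[where f="\<lambda>\<delta>. word_sum m (\<lambda>\<beta>. w (_ @ \<delta> @ \<beta>))"]) simp
    also have "\<dots> = c * (\<Sum>\<kappa>\<in>\<Gamma>. Z (1 + (length \<kappa> + m)))"
      by (simp only: word_sum_add append_assoc)
    finally have le: "Z 1 * Z m \<le> c * (\<Sum>\<kappa>\<in>\<Gamma>. Z (1 + (length \<kappa> + m)))" .
    have c: "ennreal ?c = c" using const_finite by simp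
    have z0: "0 \<le> z n" for n using z_pos[of n] by simp
    have "ennreal (z 1 * z m) \<le> ennreal (?c * (\<Sum>\<kappa>\<in>\<Gamma>. z (1 + (length \<kappa> + m))))"
      using le by (simp add: ennreal_mult z0 sum_nonneg ennreal_z c flip: sum_ennreal)
    then show ?thesis by (subst (asm) ennreal_le_iff) (simp_all add: z0 sum_nonneg)
  qed
  have "z 1 * ?r m \<le> ?c * S * ?E" for m
  proof -
    have "z 1 * z m \<le> ?c * (\<Sum>\<kappa>\<in>\<Gamma>. z (1 + (length \<kappa> + m)))" by (rule split)
    also have "\<dots> \<le> ?c * (\<Sum>\<kappa>\<in>\<Gamma>. S * (exp (real (length \<kappa> + 1) * p) * exp (real m * p)))"
    proof (intro mult_left_mono sum_mono)
      fix \<kappa>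
      have "z (1 + (length \<kappa> + m)) \<le> S * exp (real (1 + (length \<kappa> + m)) * p)"
        using r_S[of "1 + (length \<kappa> + m)"] by (simp add: field_simps)
      also have "exp (real (1 + (length \<kappa> + m)) * p) = exp (real (length \<kappa> + 1) * p) * exp (real m * p)"
        by (simp add: algebra_simps flip: exp_add)
      finally show "z (1 + (length \<kappa> + m)) \<le> S * (exp (real (length \<kappa> + 1) * p) * exp (real m * p))" .
    qed simp
    also have "\<dots> = ?c * S * ?E * exp (real m * p)"
      by (simp add: sum_distrib_left sum_distrib_right mult.assoc)
    finally show ?thesis by (simp add: field_simps)
  qed
  then have "?r m \<le> ?c * S * ?E / z 1" for m
    using z_pos[of 1] by (simp add: field_simps)
  then have "S \<le> ?c * S * ?E / z 1" unfolding S_def by (intro cSUP_least) auto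
  then have "S * z 1 \<le> S * (?c * ?E)" using z_pos[of 1] by (simp add: field_simps)
  then show ?thesis using S_pos by simp
qed

end

section \<open>The variational principle\<close>

lemma extended_sum_cong: "(\<And>x. x \<in> A \<Longrightarrow> f x = h x) \<Longrightarrow> extended_sum f A = extended_sum h A"
  unfolding extended_sum_def by (simp cong: nn_integral_cong_simp)

lemma le_INF_mean_iff:
  fixes E :: "nat \<Rightarrow> ereal"
  shows "ereal p \<le> (INF n\<in>{1..}. ereal (1 / real n) * E n) \<longleftrightarrow> (\<forall>n\<ge>1. ereal (real n * p) \<le> E n)"
proof -
  have "ereal p \<le> ereal (1 / real n) * E n \<longleftrightarrow> ereal (real n * p) \<le> E n" if "n \<ge> 1" for n
    using that by (cases "E n") (auto simp: field_simps)
  then show ?thesis by (auto simp: le_INF_iff)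
qed

lemma word_sum_1: "word_sum 1 f = (\<integral>\<^sup>+i. f [i] \<partial>count_space UNIV)"
proof -
  have bij: "bij_betw (\<lambda>i. [i]) UNIV (words 1)"
    by (auto simp: bij_betw_def inj_on_def words_def length_Suc_conv)
  show ?thesis unfolding word_sum_def by (rule nn_integral_bij_count_space[OF bij, symmetric])
qed

lemma extended_sum_block_term:
  assumes agree: "\<And>\<omega>. \<omega> \<noteq> [] \<Longrightarrow> measure \<nu> (cylinder \<omega>) \<noteq> 0 \<Longrightarrow> v \<omega> = \<phi> \<omega>" and n: "n \<ge> 1"
  shows "extended_sum (\<lambda>\<omega>. measure \<nu> (cylinder \<omega>) * ln (\<phi> \<omega> / measure \<nu> (cylinder \<omega>))) (words n) =
    extended_sum (block_term v \<nu>) (words n)"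
proof (rule extended_sum_cong)
  fix \<omega> assume "\<omega> \<in> words n"
  then have "\<omega> \<noteq> []" using n by (auto simp: words_def)
  from agree[OF this] show "measure \<nu> (cylinder \<omega>) * ln (\<phi> \<omega> / measure \<nu> (cylinder \<omega>)) = block_term v \<nu> \<omega>"
    by (cases "measure \<nu> (cylinder \<omega>) = 0") (simp_all add: block_term_def)
qed

context quasi_multiplicative_weight
begin

lemma measure_pressure_le:
  assumes \<nu>: "\<nu> \<in> invariant_measures" and v_pos: "\<And>\<omega>. 0 < v \<omega>"
    and agree: "\<And>\<omega>. \<omega> \<noteq> [] \<Longrightarrow> v \<omega> = \<phi> \<omega>"
  shows "measure_pressure \<nu> \<phi> \<le> (INF n\<in>{1..}. ereal (ln (z n) / real n))"
  unfolding measure_pressure_def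
proof (rule INF_mono)
  fix n :: nat assume n: "n \<in> {1..}"
  let ?E = "extended_sum (\<lambda>\<omega>. measure \<nu> (cylinder \<omega>) * ln (\<phi> \<omega> / measure \<nu> (cylinder \<omega>))) (words n)"
  have "?E = extended_sum (block_term v \<nu>) (words n)"
    using n agree by (intro extended_sum_block_term) auto
  also have "\<dots> \<le> ereal (ln (z n))"
    unfolding integral_entropy_majorant[OF \<nu>, symmetric]
    by (intro extended_sum_mono integrable_entropy_majorant[OF \<nu>] block_term_le_majorant)
      (use v_pos in \<open>metis less_irrefl\<close>)
  finally have "ereal (1 / real n) * ?E \<le> ereal (1 / real n) * ereal (ln (z n))"
    by (intro ereal_mult_left_mono) auto
  then show "\<exists>m\<in>{1..}. ereal (1 / real m) * extended_sum (\<lambda>\<omega>. measure \<nu> (cylinder \<omega>) *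
      ln (\<phi> \<omega> / measure \<nu> (cylinder \<omega>))) (words m) \<le> ereal (ln (z n) / real n)"
    using n by (intro bexI[of _ n]) auto
qed

lemma gibbs_measure_pressure_ge:
  assumes \<mu>: "gibbs_measure \<mu>" and p: "\<And>n. n \<ge> 1 \<Longrightarrow> real n * p \<le> ln (z n)"
    and agree: "\<And>\<omega>. \<omega> \<noteq> [] \<Longrightarrow> v \<omega> \<noteq> 0 \<Longrightarrow> v \<omega> = \<phi> \<omega>"
  shows "ereal p \<le> measure_pressure \<mu> \<phi>"
  unfolding measure_pressure_def le_INF_mean_iff
proof (intro allI impI)
  fix n :: nat assume n: "n \<ge> 1"
  have "extended_sum (\<lambda>\<omega>. measure \<mu> (cylinder \<omega>) * ln (\<phi> \<omega> / measure \<mu> (cylinder \<omega>))) (words n) =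
      extended_sum (block_term v \<mu>) (words n)"
    using gibbs_measure_0[OF \<mu>] agree n by (intro extended_sum_block_term) auto
  also have "\<dots> = ereal (block_sum v \<mu> n)"
    unfolding block_sum_def by (rule extended_sum_integrable[OF gibbs_block_sum(1)[OF \<mu>]])
  finally show "ereal (real n * p) \<le>
      extended_sum (\<lambda>\<omega>. measure \<mu> (cylinder \<omega>) * ln (\<phi> \<omega> / measure \<mu> (cylinder \<omega>))) (words n)"
    using gibbs_block_sum_ge[OF \<mu> p n] by simp
qed

lemma measure_pressure_maximal_unique:
  assumes \<mu>: "gibbs_measure \<mu>" and \<nu>: "\<nu> \<in> invariant_measures" and v_pos: "\<And>\<omega>. 0 < v \<omega>"
    and agree: "\<And>\<omega>. \<omega> \<noteq> [] \<Longrightarrow> v \<omega> = \<phi> \<omega>"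
    and upper: "\<And>n. n \<ge> 1 \<Longrightarrow> ln (z n) \<le> real n * p + ln g"
    and max: "ereal p \<le> measure_pressure \<nu> \<phi>"
  shows "\<nu> = \<mu>"
proof (rule equilibrium_measure_unique[OF \<mu> \<nu> v_pos])
  fix n :: nat assume n: "n \<ge> 1"
  have "ereal (real n * p) \<le>
      extended_sum (\<lambda>\<omega>. measure \<nu> (cylinder \<omega>) * ln (\<phi> \<omega> / measure \<nu> (cylinder \<omega>))) (words n)"
    using max n unfolding measure_pressure_def le_INF_mean_iff by blast
  also have "\<dots> = extended_sum (block_term v \<nu>) (words n)"
    using n agree by (intro extended_sum_block_term) auto
  finally have le: "ereal (real n * p) \<le> extended_sum (block_term v \<nu>) (words n)" .
  have maj: "block_term v \<nu> \<omega> \<le> entropy_majorant \<nu> n \<omega>" for \<omega>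
    by (rule block_term_le_majorant) (use v_pos in \<open>metis less_irrefl\<close>)
  note bound = extended_sum_lower_bound[OF integrable_entropy_majorant[OF \<nu>] maj le]
  show "integrable (count_space (words n)) (block_term v \<nu>)" by (rule bound(1))
  show "ln (z n) - ln g \<le> block_sum v \<nu> n"
    using bound(2) upper[OF n] by (simp add: block_sum_def)
qed

end

definition restricted_weight :: "(nat list \<Rightarrow> real) \<Rightarrow> nat set \<Rightarrow> nat list \<Rightarrow> ennreal" where
  "restricted_weight \<phi> I \<omega> =
    (if \<omega> = [] then 1 else if set \<omega> \<subseteq> I then ennreal (\<phi> \<omega>) else 0)"

text \<open>
The connecting inequality extends to the empty word: for \<open>\<omega> = []\<close> or \<open>\<tau> = []\<close> a letter is
attached at the outer end, the inequality for non-empty words is applied, and the letter is split off again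
by sub-multiplicativity and cancelled.
\<close>

lemma quasi_multiplicative_weight_restricted:
  fixes \<phi> :: "nat list \<Rightarrow> real"
  assumes sm: "sub_multiplicative \<phi>" and c: "c \<ge> 1" and \<Gamma>: "finite \<Gamma>" "[] \<notin> \<Gamma>"
    and q: "\<And>\<omega> \<tau>. \<omega> \<noteq> [] \<Longrightarrow> \<tau> \<noteq> [] \<Longrightarrow> \<exists>\<kappa>\<in>\<Gamma>. \<phi> \<omega> * \<phi> \<tau> \<le> c * \<phi> (\<omega> @ \<kappa> @ \<tau>)"
    and I: "0 \<in> I" "\<And>\<kappa>. \<kappa> \<in> \<Gamma> \<Longrightarrow> set \<kappa> \<subseteq> I"
    and fin: "word_sum 1 (restricted_weight \<phi> I) < \<infinity>"
  shows "quasi_multiplicative_weight (restricted_weight \<phi> I) (ennreal c) \<Gamma>"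
proof
  let ?w = "restricted_weight \<phi> I"
  define \<psi> where "\<psi> \<omega> = (if \<omega> = [] then 1 else \<phi> \<omega>)" for \<omega>
  have pos: "0 < \<phi> \<omega>" if "\<omega> \<noteq> []" for \<omega>
    using sm that by (auto simp: sub_multiplicative_def potential_def)
  have sub: "\<phi> (\<omega> @ \<tau>) \<le> \<phi> \<omega> * \<phi> \<tau>" if "\<omega> \<noteq> []" "\<tau> \<noteq> []" for \<omega> \<tau>
    using sm that by (auto simp: sub_multiplicative_def)
  have \<psi>_pos: "0 < \<psi> \<omega>" for \<omega> by (simp add: \<psi>_def pos)
  have \<psi>_append: "\<psi> (\<omega> @ \<tau>) \<le> \<psi> \<omega> * \<psi> \<tau>" for \<omega> \<tau>
    using sub[of \<omega> \<tau>] by (auto simp: \<psi>_def)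
  have w_eq: "?w \<omega> = (if set \<omega> \<subseteq> I then ennreal (\<psi> \<omega>) else 0)" for \<omega>
    by (simp add: restricted_weight_def \<psi>_def)
  have \<psi>_connect: "\<exists>\<kappa>\<in>\<Gamma>. \<psi> \<omega> * \<psi> \<tau> \<le> c * \<psi> (\<omega> @ \<kappa> @ \<tau>)" for \<omega> \<tau>
  proof -
    \<comment> \<open>Any letter serves, as its value is positive and can be cancelled.\<close>
    let ?\<alpha> = "if \<omega> = [] then [0] else []" and ?\<beta> = "if \<tau> = [] then [0] else []"
    have "?\<alpha> @ \<omega> \<noteq> []" "\<tau> @ ?\<beta> \<noteq> []" by auto
    from q[OF this] obtain \<kappa> where \<kappa>: "\<kappa> \<in> \<Gamma>" "\<phi> (?\<alpha> @ \<omega>) * \<phi> (\<tau> @ ?\<beta>) \<le> c * \<phi> ((?\<alpha> @ \<omega>) @ \<kappa> @ \<tau> @ ?\<beta>)" by blast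
    have "\<psi> (?\<alpha> @ \<omega> @ \<kappa> @ \<tau> @ ?\<beta>) \<le> \<psi> ?\<alpha> * (\<psi> (\<omega> @ \<kappa> @ \<tau>) * \<psi> ?\<beta>)"
    proof -
      have "\<psi> (?\<alpha> @ \<omega> @ \<kappa> @ \<tau> @ ?\<beta>) \<le> \<psi> ?\<alpha> * \<psi> ((\<omega> @ \<kappa> @ \<tau>) @ ?\<beta>)"
        using \<psi>_append[of ?\<alpha> "(\<omega> @ \<kappa> @ \<tau>) @ ?\<beta>"] by (simp only: append_assoc)
      also have "\<dots> \<le> \<psi> ?\<alpha> * (\<psi> (\<omega> @ \<kappa> @ \<tau>) * \<psi> ?\<beta>)"
        by (intro mult_left_mono \<psi>_append less_imp_le \<psi>_pos)
      finally show ?thesis .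
    qed
    then have "c * \<psi> (?\<alpha> @ \<omega> @ \<kappa> @ \<tau> @ ?\<beta>) \<le> c * (\<psi> ?\<alpha> * (\<psi> (\<omega> @ \<kappa> @ \<tau>) * \<psi> ?\<beta>))"
      using c by (intro mult_left_mono) auto
    moreover have "\<psi> ?\<alpha> * \<psi> \<omega> * (\<psi> \<tau> * \<psi> ?\<beta>) = \<phi> (?\<alpha> @ \<omega>) * \<phi> (\<tau> @ ?\<beta>)"
      by (auto simp: \<psi>_def)
    moreover have "\<psi> (?\<alpha> @ \<omega> @ \<kappa> @ \<tau> @ ?\<beta>) = \<phi> ((?\<alpha> @ \<omega>) @ \<kappa> @ \<tau> @ ?\<beta>)"
      by (auto simp: \<psi>_def)
    ultimately have "(\<psi> \<omega> * \<psi> \<tau>) * (\<psi> ?\<alpha> * \<psi> ?\<beta>) \<le> (c * \<psi> (\<omega> @ \<kappa> @ \<tau>)) * (\<psi> ?\<alpha> * \<psi> ?\<beta>)"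
      using \<kappa>(2) by (simp only: ac_simps)
    then have "\<psi> \<omega> * \<psi> \<tau> \<le> c * \<psi> (\<omega> @ \<kappa> @ \<tau>)"
      by (rule mult_right_le_imp_le) (intro mult_pos_pos \<psi>_pos)
    with \<kappa>(1) show ?thesis by blast
  qed
  show "?w [] = 1" by (simp add: restricted_weight_def)
  show "?w (\<omega> @ \<tau>) \<le> ?w \<omega> * ?w \<tau>" for \<omega> \<tau>
  proof -
    have "ennreal (\<psi> (\<omega> @ \<tau>)) \<le> ennreal (\<psi> \<omega>) * ennreal (\<psi> \<tau>)"
      using ennreal_leI[OF \<psi>_append[of \<omega> \<tau>]] less_imp_le[OF \<psi>_pos] by (simp add: ennreal_mult)
    then show ?thesis by (auto simp: w_eq)
  qed
  show "finite \<Gamma>" "ennreal c < \<infinity>" by (simp_all add: \<Gamma>)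
  show "?w \<omega> * ?w \<tau> \<le> ennreal c * (\<Sum>\<kappa>\<in>\<Gamma>. ?w (\<omega> @ \<kappa> @ \<tau>))" for \<omega> \<tau>
  proof (cases "set \<omega> \<subseteq> I \<and> set \<tau> \<subseteq> I")
    case True
    obtain \<kappa> where \<kappa>: "\<kappa> \<in> \<Gamma>" "\<psi> \<omega> * \<psi> \<tau> \<le> c * \<psi> (\<omega> @ \<kappa> @ \<tau>)" using \<psi>_connect by blast
    have "?w \<omega> * ?w \<tau> = ennreal (\<psi> \<omega> * \<psi> \<tau>)"
      using True less_imp_le[OF \<psi>_pos] by (simp add: w_eq ennreal_mult)
    also have "\<dots> \<le> ennreal (c * \<psi> (\<omega> @ \<kappa> @ \<tau>))" by (rule ennreal_leI[OF \<kappa>(2)])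
    also have "\<dots> = ennreal c * ?w (\<omega> @ \<kappa> @ \<tau>)"
      using True I(2)[OF \<kappa>(1)] c less_imp_le[OF \<psi>_pos] by (simp add: w_eq ennreal_mult)
    also have "\<dots> \<le> ennreal c * (\<Sum>\<kappa>\<in>\<Gamma>. ?w (\<omega> @ \<kappa> @ \<tau>))"
      using \<kappa>(1) \<Gamma>(1) by (intro mult_left_mono member_le_sum) auto
    finally show ?thesis .
  qed (auto simp: w_eq)
  show "word_sum 1 ?w < \<infinity>" by (rule fin)
  have "0 < ?w [0]" using I(1) pos[of "[0]"] by (simp add: restricted_weight_def)
  also have "?w [0] \<le> word_sum 1 ?w" using word_sum_ge[of ?w "[0]"] by simp
  finally show "0 < word_sum 1 ?w" .
qed

theorem theorem1:
  fixes \<phi> :: "nat list \<Rightarrow> real"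
  assumes "quasi_multiplicative \<phi>"
  shows "pressure \<phi> = (SUP \<mu>\<in>invariant_measures. measure_pressure \<mu> \<phi>) \<and>
    (pressure \<phi> < \<infinity> \<longrightarrow>
      (\<exists>!\<mu>. \<mu> \<in> invariant_measures \<and> pressure \<phi> = measure_pressure \<mu> \<phi>))"
proof -
  obtain c \<Gamma> where c: "c \<ge> (1::real)" and \<Gamma>: "finite \<Gamma>" "[] \<notin> \<Gamma>"
    and q: "\<And>\<omega> \<tau>. \<omega> \<noteq> [] \<Longrightarrow> \<tau> \<noteq> [] \<Longrightarrow> \<exists>\<kappa>\<in>\<Gamma>. \<phi> \<omega> * \<phi> \<tau> \<le> c * \<phi> (\<omega> @ \<kappa> @ \<tau>)"
    using assms unfolding quasi_multiplicative_def by (metis in_finite_words_iff subset_iff)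
  have sm: "sub_multiplicative \<phi>" using assms by (simp add: quasi_multiplicative_def)
  have pos: "0 < \<phi> \<omega>" if "\<omega> \<noteq> []" for \<omega>
    using sm that by (auto simp: sub_multiplicative_def potential_def)
  have partition_sum: "partition_sum \<phi> n = word_sum n (restricted_weight \<phi> UNIV)" if "n \<ge> 1" for n
    using that unfolding partition_sum_def word_sum_def
    by (intro nn_integral_cong) (auto simp: restricted_weight_def words_def)
  show ?thesis
  proof (cases "partition_sum \<phi> 1 < \<infinity>")
    case True
    interpret quasi_multiplicative_weight "restricted_weight \<phi> UNIV" "ennreal c" \<Gamma>
      by (rule quasi_multiplicative_weight_restricted[OF sm c \<Gamma> q]) (use True partition_sum[of 1] in auto)
    have agree: "v \<omega> = \<phi> \<omega>" if "\<omega> \<noteq> []" for \<omega>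
      using that pos[OF that] by (simp add: v_def restricted_weight_def)
    have v_pos: "0 < v \<omega>" for \<omega>
      using agree[of \<omega>] pos[of \<omega>] by (cases "\<omega> = []") (simp_all add: v_def w_Nil)
    obtain p where lower: "\<And>n. n \<ge> 1 \<Longrightarrow> real n * p \<le> ln (z n)"
      and upper: "\<And>n. n \<ge> 1 \<Longrightarrow> ln (z n) \<le> real n * p + ln g"
      and p: "(INF n\<in>{1..}. ereal (ln (z n) / real n)) = ereal p"
      by (rule pressure_bounds) blast
    have "ereal (1 / real n) * log_ennreal (partition_sum \<phi> n) = ereal (ln (z n) / real n)" if "n \<in> {1..}" for n
      using partition_sum[of n] that by (simp add: log_ennreal_def z_def)
    then have pressure: "pressure \<phi> = ereal p"
      unfolding pressure_def p[symmetric] by (intro INF_cong refl)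
    have le: "measure_pressure \<nu> \<phi> \<le> ereal p" if "\<nu> \<in> invariant_measures" for \<nu>
      unfolding p[symmetric] by (rule measure_pressure_le[OF that v_pos agree])
    obtain \<mu> where \<mu>: "gibbs_measure \<mu>" using ex_gibbs_measure by blast
    then have inv: "\<mu> \<in> invariant_measures" by (simp add: gibbs_measure_def)
    have eq: "measure_pressure \<mu> \<phi> = ereal p"
      using le[OF inv] gibbs_measure_pressure_ge[OF \<mu> lower agree] by (intro antisym) auto
    have "(SUP \<mu>\<in>invariant_measures. measure_pressure \<mu> \<phi>) = ereal p"
      by (intro antisym SUP_least le) (auto intro: SUP_upper2[OF inv] simp: eq)
    moreover have "\<exists>!\<mu>. \<mu> \<in> invariant_measures \<and> pressure \<phi> = measure_pressure \<mu> \<phi>"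
    proof (rule ex1I[of _ \<mu>])
      fix \<nu> assume \<nu>: "\<nu> \<in> invariant_measures \<and> pressure \<phi> = measure_pressure \<nu> \<phi>"
      show "\<nu> = \<mu>"
        by (rule measure_pressure_maximal_unique[OF \<mu> _ v_pos agree upper])
          (use \<nu> in \<open>auto simp: pressure\<close>)
    qed (simp add: inv eq pressure)
    ultimately show ?thesis by (simp add: pressure)
  next
    case False
    have "ereal (1 / real n) * log_ennreal (partition_sum \<phi> n) = \<infinity>" if "n \<in> {1..}" for n
      using partition_sum_1_finite[OF assms, of n] False that
      by (auto simp: log_ennreal_def less_top[symmetric])
    then have pressure: "pressure \<phi> = \<infinity>" unfolding pressure_def by simp
    have "(SUP \<mu>\<in>invariant_measures. measure_pressure \<mu> \<phi>) = \<infinity>"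
    proof (rule SUP_PInfty)
      fix n :: nat
      show "\<exists>\<mu>\<in>invariant_measures. ereal (real n) \<le> measure_pressure \<mu> \<phi>"
      proof (rule ccontr)
        assume "\<not> ?thesis"
        then have small: "measure_pressure \<mu> \<phi> < ereal (real n)" if "\<mu> \<in> invariant_measures" for \<mu>
          using that by (auto simp: not_le)
        \<comment> \<open>An upper bound for \<open>\<Sum>i\<in>I. \<phi> [i]\<close>, for all finite alphabets \<open>I\<close> as below, if all pressures are below \<open>n\<close>.\<close>
        define R where "R = c * (\<Sum>\<kappa>\<in>\<Gamma>. exp (real (length \<kappa> + 1) * real n))"
        have "(\<Sum>i<N. ennreal (\<phi> [i])) \<le> ennreal R" for N
        proof -
          define I where "I = insert 0 ({..<N} \<union> (\<Union>\<kappa>\<in>\<Gamma>. set \<kappa>))"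
          have I: "finite I" "0 \<in> I" "\<And>\<kappa>. \<kappa> \<in> \<Gamma> \<Longrightarrow> set \<kappa> \<subseteq> I" "{..<N} \<subseteq> I"
            using \<Gamma>(1) by (auto simp: I_def)
          let ?w = "restricted_weight \<phi> I"
          have sum: "word_sum 1 ?w = (\<Sum>i\<in>I. ennreal (\<phi> [i]))"
          proof -
            have "word_sum 1 ?w = (\<integral>\<^sup>+i. ennreal (\<phi> [i]) * indicator I i \<partial>count_space UNIV)"
              unfolding word_sum_1 by (intro nn_integral_cong) (simp add: restricted_weight_def)
            also have "\<dots> = (\<integral>\<^sup>+i. ennreal (\<phi> [i]) \<partial>count_space I)"
              by (simp add: nn_integral_count_space_indicator)
            finally show ?thesis using I(1) by (simp add: nn_integral_count_space_finite)
          qed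
          have fin: "word_sum 1 ?w < \<infinity>" unfolding sum using I(1) by simp
          interpret quasi_multiplicative_weight ?w "ennreal c" \<Gamma>
            by (rule quasi_multiplicative_weight_restricted[OF sm c \<Gamma> q I(2,3)]) (use fin in auto)
          obtain p where lower: "\<And>n. n \<ge> 1 \<Longrightarrow> real n * p \<le> ln (z n)"
            and upper: "\<And>n. n \<ge> 1 \<Longrightarrow> ln (z n) \<le> real n * p + ln g"
            by (rule pressure_bounds) blast
          obtain \<mu> where \<mu>: "gibbs_measure \<mu>" using ex_gibbs_measure by blast
          have agree: "v \<omega> = \<phi> \<omega>" if "\<omega> \<noteq> []" "v \<omega> \<noteq> 0" for \<omega>
            using that pos[OF that(1)] by (auto simp: v_def restricted_weight_def split: if_splits)
          have "ereal p \<le> measure_pressure \<mu> \<phi>"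
            by (rule gibbs_measure_pressure_ge[OF \<mu> lower agree])
          also have "\<dots> < ereal (real n)" using \<mu> by (intro small) (simp add: gibbs_measure_def)
          finally have "p \<le> real n" by simp
          have "z 1 \<le> c * (\<Sum>\<kappa>\<in>\<Gamma>. exp (real (length \<kappa> + 1) * p))"
            using z_1_le[OF lower upper] c by simp
          also have "\<dots> \<le> R"
            unfolding R_def using c \<open>p \<le> real n\<close> by (intro mult_left_mono sum_mono) auto
          finally have "Z 1 \<le> ennreal R" by (simp add: ennreal_leI flip: ennreal_z)
          moreover have "(\<Sum>i<N. ennreal (\<phi> [i])) \<le> (\<Sum>i\<in>I. ennreal (\<phi> [i]))"
            by (rule sum_mono2) (use I in auto)
          ultimately show ?thesis unfolding sum by (rule order_trans[rotated])
        qed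
        then have "(\<Sum>i. ennreal (\<phi> [i])) \<le> ennreal R" by (intro suminf_le_const) auto
        moreover have "partition_sum \<phi> 1 = (\<Sum>i. ennreal (\<phi> [i]))"
          using partition_sum[of 1] by (simp add: word_sum_1[unfolded One_nat_def] restricted_weight_def nn_integral_count_space_nat)
        ultimately show False using False by (simp add: less_top[symmetric] top_unique)
      qed
    qed
    with pressure show ?thesis by simp
  qed
qed

end
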